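(* Let $R$ be a Noetherian ring and $M\subseteq R^p$ a submodule having a rank. Let $h\in R^p$ be such that $M+Rh$ also has a rank and $\operatorname{rank}(M)=\operatorname{rank}(M+Rh)$. Then the following conditions are equivalent. (1) $h\in\overline M$. (2) $\overline{\mathbf I_i(M)}=\overline{\mathbf I_i(M+Rh)}$ for all $i\geq 1$. (3) $\overline{\mathbf I_r(M)}=\overline{\mathbf I_r(M+Rh)}$ for $r=\operatorname{rank}(M)$.
   Context: Rings are commutative Noetherian. An $R$-module $M$ has a rank if there is $e\in\mathbb N$ with $M_{\mathfrak p}\cong R_{\mathfrak p}^e$ for every associated prime $\mathfrak p$ of $R$; then $\operatorname{rank}(M)=e$. For a submodule $M\subseteq R^p$, identified with a matrix whose columns generate it, $\mathbf I_i(M)$ is the ideal generated by the $i\times i$ minors of this matrix (with $\mathbf I_i(M)=0$ if $i>p$, and $\mathbf I_0(M)=R$ as for Fitting ideals); it does not depend on the matrix. An element $h\in R^p$ is integral over a submodule $M\subseteq R^p$ if for every minimal prime $\mathfrak p$ of $R$ and every discrete valuation ring or field $V$ between $R/\mathfrak p$ and $R_{\mathfrak p}/\mathfrak pR_{\mathfrak p}$, the image of $h$ in $V^p$ lies in the $V$-submodule $MV$ of $V^p$ generated by the image of $M$. The integral closure $\overline M$ is the submodule of all $h\in R^p$ integral over $M$; for ideals this is the usual integral closure. *)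

theory Defs
  imports "HOL-Algebra.Algebra" "HOL-Combinatorics.Permutations"
begin

section \<open>Free modules and submodules\<close>

text \<open>A module record also carries the ring operations \<open>mult\<close> and \<open>one\<close>; the locale
  \<^locale>\<open>module\<close> ignores them, so they are left unspecified below.\<close>

definition free_module :: "('a, 'c) ring_scheme \<Rightarrow> nat \<Rightarrow> ('a, nat \<Rightarrow> 'a) module" where
  "free_module R p =
     \<lparr>carrier = {..<p} \<rightarrow>\<^sub>E carrier R, monoid.mult = undefined, one = undefined,
      ring.zero = (\<lambda>i\<in>{..<p}. \<zero>\<^bsub>R\<^esub>),
      add = (\<lambda>x y. \<lambda>i\<in>{..<p}. x i \<oplus>\<^bsub>R\<^esub> y i),
      smult = (\<lambda>a x. \<lambda>i\<in>{..<p}. a \<otimes>\<^bsub>R\<^esub> x i)\<rparr>"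

definition submodule_gen ::
    "('a, 'c) ring_scheme \<Rightarrow> ('a, 'b, 'm) module_scheme \<Rightarrow> 'b set \<Rightarrow> 'b set" where
  "submodule_gen R M Z = \<Inter>{N. submodule N R M \<and> Z \<subseteq> N}"

definition module_isomorphic ::
    "('a, 'c) ring_scheme \<Rightarrow> ('a, 'b, 'm) module_scheme \<Rightarrow> ('a, 'd, 'n) module_scheme \<Rightarrow> bool" where
  "module_isomorphic R M N \<longleftrightarrow>
     (\<exists>f \<in> iso (add_monoid M) (add_monoid N).
        \<forall>a\<in>carrier R. \<forall>x\<in>carrier M. f (a \<odot>\<^bsub>M\<^esub> x) = a \<odot>\<^bsub>N\<^esub> f x)"

text \<open>The submodule \<open>M + Rh\<close> of \<open>R\<^sup>p\<close>.\<close>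

definition adjoin :: "('a, 'c) ring_scheme \<Rightarrow> nat \<Rightarrow> (nat \<Rightarrow> 'a) set \<Rightarrow> (nat \<Rightarrow> 'a) \<Rightarrow> (nat \<Rightarrow> 'a) set" where
  "adjoin R p M h =
     {m \<oplus>\<^bsub>free_module R p\<^esub> (a \<odot>\<^bsub>free_module R p\<^esub> h) | m a. m \<in> M \<and> a \<in> carrier R}"


section \<open>Localization\<close>

text \<open>For a multiplicative set \<open>S\<close>, the fraction \<open>x/s\<close> is the class of all pairs \<open>(y, t)\<close> with
  \<open>u t x = u s y\<close> for some \<open>u \<in> S\<close>. Operations on classes are unions over representatives; all
  representatives contribute the same class.\<close>

definition fraction :: "'a set \<Rightarrow> ('a, 'b, 'm) module_scheme \<Rightarrow> 'b \<Rightarrow> 'a \<Rightarrow> ('b \<times> 'a) set" where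
  "fraction S M x s =
     {(y, t). y \<in> carrier M \<and> t \<in> S \<and> (\<exists>u\<in>S. u \<odot>\<^bsub>M\<^esub> (t \<odot>\<^bsub>M\<^esub> x) = u \<odot>\<^bsub>M\<^esub> (s \<odot>\<^bsub>M\<^esub> y))}"

definition loc_module ::
    "('a, 'c) ring_scheme \<Rightarrow> 'a set \<Rightarrow> ('a, 'b, 'm) module_scheme
      \<Rightarrow> (('a \<times> 'a) set, ('b \<times> 'a) set) module" where
  "loc_module R S M =
     \<lparr>carrier = {fraction S M x s | x s. x \<in> carrier M \<and> s \<in> S},
      monoid.mult = undefined, one = undefined,
      ring.zero = fraction S M \<zero>\<^bsub>M\<^esub> \<one>\<^bsub>R\<^esub>,
      add = (\<lambda>Y Z. \<Union>(x, s)\<in>Y. \<Union>(y, t)\<in>Z.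
               fraction S M ((t \<odot>\<^bsub>M\<^esub> x) \<oplus>\<^bsub>M\<^esub> (s \<odot>\<^bsub>M\<^esub> y)) (s \<otimes>\<^bsub>R\<^esub> t)),
      smult = (\<lambda>A Z. \<Union>(a, s)\<in>A. \<Union>(x, t)\<in>Z. fraction S M (a \<odot>\<^bsub>M\<^esub> x) (s \<otimes>\<^bsub>R\<^esub> t))\<rparr>"

definition regular_module :: "('a, 'c) ring_scheme \<Rightarrow> ('a, 'a) module" where
  "regular_module R =
     \<lparr>carrier = carrier R, monoid.mult = monoid.mult R, one = one R, ring.zero = ring.zero R,
      add = add R, smult = monoid.mult R\<rparr>"

definition loc_ring :: "('a, 'c) ring_scheme \<Rightarrow> 'a set \<Rightarrow> ('a \<times> 'a) set ring" where
  "loc_ring R S =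
     (let L = loc_module R S (regular_module R) in
      \<lparr>carrier = carrier L, monoid.mult = smult L,
       one = fraction S (regular_module R) \<one>\<^bsub>R\<^esub> \<one>\<^bsub>R\<^esub>, ring.zero = ring.zero L, add = add L\<rparr>)"

definition loc_map :: "('a, 'c) ring_scheme \<Rightarrow> 'a set \<Rightarrow> 'a \<Rightarrow> ('a \<times> 'a) set" where
  "loc_map R S a = fraction S (regular_module R) a \<one>\<^bsub>R\<^esub>"

text \<open>The residue field \<open>R\<^sub>P / P R\<^sub>P\<close> and the canonical map from \<open>R\<close>, whose kernel is \<open>P\<close> and
  whose image is therefore (a copy of) \<open>R/P\<close>.\<close>

definition extended_prime :: "('a, 'c) ring_scheme \<Rightarrow> 'a set \<Rightarrow> ('a \<times> 'a) set set" where
  "extended_prime R P =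
     genideal (loc_ring R (carrier R - P)) (loc_map R (carrier R - P) ` P)"

definition residue_field :: "('a, 'c) ring_scheme \<Rightarrow> 'a set \<Rightarrow> ('a \<times> 'a) set set ring" where
  "residue_field R P = loc_ring R (carrier R - P) Quot extended_prime R P"

definition residue_map :: "('a, 'c) ring_scheme \<Rightarrow> 'a set \<Rightarrow> 'a \<Rightarrow> ('a \<times> 'a) set set" where
  "residue_map R P a =
     extended_prime R P +>\<^bsub>loc_ring R (carrier R - P)\<^esub> loc_map R (carrier R - P) a"


section \<open>Rank\<close>

definition associated_prime :: "('a, 'c) ring_scheme \<Rightarrow> 'a set \<Rightarrow> bool" where
  "associated_prime R P \<longleftrightarrow>
     primeideal P R \<and> (\<exists>x\<in>carrier R. P = {a \<in> carrier R. a \<otimes>\<^bsub>R\<^esub> x = \<zero>\<^bsub>R\<^esub>})"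

definition is_rank :: "('a, 'c) ring_scheme \<Rightarrow> ('a, 'b, 'm) module_scheme \<Rightarrow> nat \<Rightarrow> bool" where
  "is_rank R M e \<longleftrightarrow>
     (\<forall>P. associated_prime R P \<longrightarrow>
        module_isomorphic (loc_ring R (carrier R - P)) (loc_module R (carrier R - P) M)
          (free_module (loc_ring R (carrier R - P)) e))"

definition has_rank :: "('a, 'c) ring_scheme \<Rightarrow> ('a, 'b, 'm) module_scheme \<Rightarrow> bool" where
  "has_rank R M \<longleftrightarrow> (\<exists>e. is_rank R M e)"

text \<open>A Noetherian ring \<open>R \<noteq> 0\<close> has an associated prime, so the rank is then unique. Over the zero
  ring every \<open>e\<close> is a rank, and one fixed value is chosen for all modules.\<close>

definition rank :: "('a, 'c) ring_scheme \<Rightarrow> ('a, 'b, 'm) module_scheme \<Rightarrow> nat" where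
  "rank R M = (SOME e. is_rank R M e)"


section \<open>Ideals of minors\<close>

text \<open>A matrix with \<open>p\<close> rows and \<open>n\<close> columns is given by its columns \<open>A 0, \<dots>, A (n - 1)\<close> in
  \<open>R\<^sup>p\<close>, so the entry in row \<open>k\<close> and column \<open>l\<close> is \<open>A l k\<close>.\<close>

definition generating_matrix ::
    "('a, 'c) ring_scheme \<Rightarrow> nat \<Rightarrow> (nat \<Rightarrow> 'a) set \<Rightarrow> nat \<Rightarrow> (nat \<Rightarrow> nat \<Rightarrow> 'a) \<Rightarrow> bool" where
  "generating_matrix R p M n A \<longleftrightarrow>
     A ` {..<n} \<subseteq> carrier (free_module R p) \<and> submodule_gen R (free_module R p) (A ` {..<n}) = M"

definition ring_det :: "('a, 'c) ring_scheme \<Rightarrow> nat \<Rightarrow> (nat \<Rightarrow> nat \<Rightarrow> 'a) \<Rightarrow> 'a" where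
  "ring_det R i B =
     (\<Oplus>\<^bsub>R\<^esub>\<sigma>\<in>{\<sigma>. \<sigma> permutes {..<i}}. [(sign \<sigma> :: int)] \<cdot>\<^bsub>R\<^esub> (\<Otimes>\<^bsub>R\<^esub>k\<in>{..<i}. B k (\<sigma> k)))"

definition minors ::
    "('a, 'c) ring_scheme \<Rightarrow> nat \<Rightarrow> nat \<Rightarrow> (nat \<Rightarrow> nat \<Rightarrow> 'a) \<Rightarrow> nat \<Rightarrow> 'a set" where
  "minors R p n A i =
     {ring_det R i (\<lambda>k l. A (\<gamma> l) (\<rho> k)) | \<rho> \<gamma>.
        strict_mono_on {..<i} \<rho> \<and> \<rho> ` {..<i} \<subseteq> {..<p} \<and>
        strict_mono_on {..<i} \<gamma> \<and> \<gamma> ` {..<i} \<subseteq> {..<n}}"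

text \<open>The ideal below does not depend on the chosen generating matrix, and such a matrix exists
  when \<open>R\<close> is Noetherian. The only \<open>0 \<times> 0\<close> minor is \<open>1\<close>, and there are no minors of size
  \<open>i > p\<close>, so the conventions for these \<open>i\<close> hold.\<close>

definition minors_ideal :: "('a, 'c) ring_scheme \<Rightarrow> nat \<Rightarrow> nat \<Rightarrow> (nat \<Rightarrow> 'a) set \<Rightarrow> 'a set" where
  "minors_ideal R p i M =
     (SOME I. \<exists>n A. generating_matrix R p M n A \<and> I = genideal R (minors R p n A i))"


section \<open>Integral closure\<close>

definition minimal_prime :: "('a, 'c) ring_scheme \<Rightarrow> 'a set \<Rightarrow> bool" where
  "minimal_prime R P \<longleftrightarrow> primeideal P R \<and> (\<forall>Q. primeideal Q R \<and> Q \<subseteq> P \<longrightarrow> Q = P)"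

text \<open>A discrete valuation ring is a principal ideal domain with exactly one nonzero prime ideal.\<close>

definition discrete_valuation_ring :: "('a, 'c) ring_scheme \<Rightarrow> bool" where
  "discrete_valuation_ring V \<longleftrightarrow>
     principal_domain V \<and> (\<exists>!Q. primeideal Q V \<and> Q \<noteq> {\<zero>\<^bsub>V\<^esub>})"

definition valuation_between :: "('a, 'c) ring_scheme \<Rightarrow> 'a set \<Rightarrow> ('a \<times> 'a) set set set \<Rightarrow> bool" where
  "valuation_between R P V \<longleftrightarrow>
     subring V (residue_field R P) \<and> residue_map R P ` carrier R \<subseteq> V \<and>
     (discrete_valuation_ring (residue_field R P \<lparr>carrier := V\<rparr>) \<or>
      field (residue_field R P \<lparr>carrier := V\<rparr>))"

definition vec_image :: "('a, 'c) ring_scheme \<Rightarrow> 'a set \<Rightarrow> nat \<Rightarrow> (nat \<Rightarrow> 'a) \<Rightarrow> nat \<Rightarrow> ('a \<times> 'a) set set" where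
  "vec_image R P p x = (\<lambda>i\<in>{..<p}. residue_map R P (x i))"

definition integral_closure :: "('a, 'c) ring_scheme \<Rightarrow> nat \<Rightarrow> (nat \<Rightarrow> 'a) set \<Rightarrow> (nat \<Rightarrow> 'a) set" where
  "integral_closure R p M =
     {h \<in> carrier (free_module R p).
        \<forall>P V. minimal_prime R P \<and> valuation_between R P V \<longrightarrow>
          (let W = residue_field R P \<lparr>carrier := V\<rparr> in
           vec_image R P p h \<in> submodule_gen W (free_module W p) (vec_image R P p ` M))}"

text \<open>An ideal is regarded as a submodule of \<open>R\<^sup>1\<close>.\<close>

definition ideal_closure :: "('a, 'c) ring_scheme \<Rightarrow> 'a set \<Rightarrow> 'a set" where
  "ideal_closure R I =
     {x \<in> carrier R. (\<lambda>i\<in>{..<1}. x) \<in> integral_closure R 1 ({..<1} \<rightarrow>\<^sub>E I)}"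

end

theory Submission
  imports Defs
begin

text \<open>Membership in an integral closure is tested in the rings \<open>V\<close> between \<open>R/P\<close> and its fraction
  field, \<open>P\<close> a minimal prime. If \<open>h \<in> MV\<close>, then \<open>MV = (M + Rh)V\<close>, so all minors of \<open>M\<close> and \<open>M + Rh\<close>
  generate the same ideals of \<open>V\<close>.

  Conversely, \<open>P\<close> is an associated prime, \<open>P = ann z\<close>. As \<open>(M + Rh)\<^sub>P\<close> is generated by \<open>r\<close> elements,
  the \<open>(r + 1)\<close>-minors of \<open>M + Rh\<close> vanish in \<open>V\<close>. As \<open>M\<^sub>P\<close> is free of rank \<open>r\<close>, McCoy's argument with
  \<open>z\<close> shows that some \<open>r\<close>-minor of \<open>M\<close> does not lie in \<open>P\<close>. Divisibility in \<open>V\<close> is total, so some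
  \<open>r\<close>-minor \<open>d \<noteq> 0\<close> of \<open>M\<close> generates \<open>I\<^sub>r(M)V = I\<^sub>r(M + Rh)V\<close>. Cramer's rule writes \<open>d h\<close> as a
  combination of the columns defining \<open>d\<close>, with coefficients in \<open>I\<^sub>r(M + Rh)V = dV\<close>; cancelling \<open>d\<close>
  gives \<open>h \<in> MV\<close>.\<close>

section \<open>Submodules of free modules\<close>

text \<open>McCoy's argument is needed because freeness of \<open>M_P\<close> is a statement over
  the localization, while the tests take place modulo \<open>P\<close>: the localization need not be
  a field, and a minor that is nonzero there may still vanish in \<open>V\<close>. The element
  \<open>z\<close> bridges this gap. It is killed by all of \<open>P\<close> and by nothing outside
  \<open>P\<close>, so a relation that holds modulo \<open>P\<close> becomes, multiplied by
  \<open>z\<close>, a relation over \<open>R\<close>, and \<open>u d z = 0\<close> with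
  \<open>u\<close> outside \<open>P\<close> forces \<open>d\<close> into \<open>P\<close>. Localized
  data return to \<open>R\<close> by clearing denominators: a basis is represented by vectors of
  \<open>R^p\<close> that span up to multipliers outside \<open>P\<close> and are independent up to
  annihilators outside \<open>P\<close>. Elements outside \<open>P\<close> have nonzero image in the
  domain \<open>V\<close>, so they cancel there. Condition (3) enters through one observation: each
  \<open>r\<close>-minor of \<open>M + Rh\<close> lies in the closure of the ideal that it helps to
  generate, hence in the closure of \<open>I_r(M)\<close>. Condition (2) omits \<open>i = 0\<close>,
  so for \<open>r = 0\<close> condition (3) rests on the fact that both modules have the same empty
  minor.\<close>

lemma free_module_simps [simp]:
  "carrier (free_module R p) = {..<p} \<rightarrow>\<^sub>E carrier R"
  "\<zero>\<^bsub>free_module R p\<^esub> = (\<lambda>i\<in>{..<p}. \<zero>\<^bsub>R\<^esub>)"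
  "x \<oplus>\<^bsub>free_module R p\<^esub> y = (\<lambda>i\<in>{..<p}. x i \<oplus>\<^bsub>R\<^esub> y i)"
  "a \<odot>\<^bsub>free_module R p\<^esub> x = (\<lambda>i\<in>{..<p}. a \<otimes>\<^bsub>R\<^esub> x i)"
  by (simp_all add: free_module_def)

lemma (in cring) free_module_module: "module R (free_module R p)"
proof (rule moduleI)
  show "abelian_group (free_module R p)"
  proof (rule abelian_groupI)
    fix x assume x: "x \<in> carrier (free_module R p)"
    then show "\<exists>y\<in>carrier (free_module R p). y \<oplus>\<^bsub>free_module R p\<^esub> x = \<zero>\<^bsub>free_module R p\<^esub>"
      by (intro bexI[of _ "\<lambda>i\<in>{..<p}. \<ominus> x i"]) (auto simp: PiE_iff l_neg)
    show "\<zero>\<^bsub>free_module R p\<^esub> \<oplus>\<^bsub>free_module R p\<^esub> x = x"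
      using x by (auto simp: PiE_iff extensional_def)
  qed (auto simp: PiE_iff a_ac fun_eq_iff)
qed (auto simp: PiE_iff l_distr r_distr m_assoc is_cring fun_eq_iff extensional_def)

lemma submodule_gen_minimal: "submodule N R M \<Longrightarrow> Z \<subseteq> N \<Longrightarrow> submodule_gen R M Z \<subseteq> N"
  by (auto simp: submodule_gen_def)

lemma submodule_gen_superset: "Z \<subseteq> submodule_gen R M Z"
  by (auto simp: submodule_gen_def)

lemma (in module) submodule_gen_submodule:
  assumes "Z \<subseteq> carrier M"
  shows "submodule (submodule_gen R M Z) R M"
proof (rule submoduleI)
  show "submodule_gen R M Z \<subseteq> carrier M"
    using assms carrier_is_submodule by (rule submodule_gen_minimal[rotated])
  show "\<zero>\<^bsub>M\<^esub> \<in> submodule_gen R M Z"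
    by (auto simp: submodule_gen_def submodule_def dest: subgroup.one_closed)
qed (auto simp: submodule_gen_def submoduleE)

lemma (in cring)
  assumes "submodule N R (free_module R p)"
  shows submodule_free_subset: "N \<subseteq> {..<p} \<rightarrow>\<^sub>E carrier R"
    and submodule_free_zero: "(\<lambda>i\<in>{..<p}. \<zero>) \<in> N"
    and submodule_free_add: "\<And>x y. x \<in> N \<Longrightarrow> y \<in> N \<Longrightarrow> (\<lambda>i\<in>{..<p}. x i \<oplus> y i) \<in> N"
    and submodule_free_smult: "\<And>a x. a \<in> carrier R \<Longrightarrow> x \<in> N \<Longrightarrow> (\<lambda>i\<in>{..<p}. a \<otimes> x i) \<in> N"
proof -
  interpret F: module R "free_module R p" by (rule free_module_module)
  show "N \<subseteq> {..<p} \<rightarrow>\<^sub>E carrier R" using F.submoduleE(1)[OF assms] by simp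
  show "(\<lambda>i\<in>{..<p}. \<zero>) \<in> N"
    using assms by (auto simp: submodule_def dest!: subgroup.one_closed)
  show "\<And>x y. x \<in> N \<Longrightarrow> y \<in> N \<Longrightarrow> (\<lambda>i\<in>{..<p}. x i \<oplus> y i) \<in> N"
    using F.submoduleE(5)[OF assms] by simp
  show "\<And>a x. a \<in> carrier R \<Longrightarrow> x \<in> N \<Longrightarrow> (\<lambda>i\<in>{..<p}. a \<otimes> x i) \<in> N"
    using F.submoduleE(4)[OF assms] by simp
qed

text \<open>Closure under negation comes from scalar multiplication by
  \<open>\<ominus> \<one>\<close>.\<close>

lemma (in cring) submodule_freeI:
  assumes "N \<subseteq> {..<p} \<rightarrow>\<^sub>E carrier R"
    and "(\<lambda>i\<in>{..<p}. \<zero>) \<in> N"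
    and "\<And>x y. x \<in> N \<Longrightarrow> y \<in> N \<Longrightarrow> (\<lambda>i\<in>{..<p}. x i \<oplus> y i) \<in> N"
    and smult: "\<And>a x. a \<in> carrier R \<Longrightarrow> x \<in> N \<Longrightarrow> (\<lambda>i\<in>{..<p}. a \<otimes> x i) \<in> N"
  shows "submodule N R (free_module R p)"
proof -
  interpret F: module R "free_module R p" by (rule free_module_module)
  show ?thesis
  proof (rule F.submoduleI)
    fix x assume x: "x \<in> N"
    then have "(\<ominus> \<one>) \<odot>\<^bsub>free_module R p\<^esub> x \<in> N"
      using smult[of "\<ominus> \<one>" x] by simp
    then show "\<ominus>\<^bsub>free_module R p\<^esub> x \<in> N"
      using x assms(1) F.smult_l_minus[of \<one> x] F.smult_one[of x] by auto
  qed (use assms in auto)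
qed

text \<open>The sum is formed in \<open>R\<close>, one coordinate at a time, because the determinant
  identities used later concern one row of a matrix; \<open>submodule_finsum_eq_lincomb\<close>
  translates from sums in a module.\<close>

definition lincomb ::
    "('a, 'c) ring_scheme \<Rightarrow> nat \<Rightarrow> nat \<Rightarrow> (nat \<Rightarrow> 'a) \<Rightarrow> (nat \<Rightarrow> nat \<Rightarrow> 'a) \<Rightarrow> nat \<Rightarrow> 'a" where
  "lincomb R p n c A = (\<lambda>i\<in>{..<p}. \<Oplus>\<^bsub>R\<^esub>j\<in>{..<n}. c j \<otimes>\<^bsub>R\<^esub> A j i)"

lemma (in cring) lincomb_mem_submodule:
  assumes N: "submodule N R (free_module R p)"
    and A: "\<And>j. j < n \<Longrightarrow> A j \<in> N" and c: "\<And>j. j < n \<Longrightarrow> c j \<in> carrier R"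
  shows "lincomb R p n c A \<in> N"
  using A c
proof (induction n)
  case 0
  have "lincomb R p 0 c A = (\<lambda>i\<in>{..<p}. \<zero>)" by (simp add: lincomb_def)
  then show ?case using submodule_free_zero[OF N] by metis
next
  case (Suc n)
  have Aj: "A j i \<in> carrier R" if "j < Suc n" "i < p" for i j
    using Suc.prems(1)[OF that(1)] that(2) submodule_free_subset[OF N] by auto
  have "(\<lambda>i\<in>{..<p}. (\<lambda>i\<in>{..<p}. c n \<otimes> A n i) i \<oplus> lincomb R p n c A i) \<in> N"
    by (intro submodule_free_add[OF N] submodule_free_smult[OF N] Suc) auto
  also have "(\<lambda>i\<in>{..<p}. (\<lambda>i\<in>{..<p}. c n \<otimes> A n i) i \<oplus> lincomb R p n c A i) =
      lincomb R p (Suc n) c A"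
    using Aj Suc.prems(2)
    by (auto simp: lincomb_def lessThan_Suc restrict_def fun_eq_iff
        intro!: finsum_insert[symmetric])
  finally show ?case .
qed

section \<open>Finite generation of submodules of free modules\<close>

lemma (in cring) submodule_Int_coordinates:
  assumes N: "submodule N R (free_module R p)"
  shows "submodule {x \<in> N. \<forall>i. k \<le> i \<and> i < p \<longrightarrow> x i = \<zero>} R (free_module R p)"
  using submodule_free_subset[OF N] submodule_free_zero[OF N] submodule_free_add[OF N]
    submodule_free_smult[OF N]
  by (intro submodule_freeI) auto

text \<open>Serves twice: finite generation of this ideal drives the induction in the next lemma,
  and for \<open>p = 1\<close> it turns a submodule of \<open>R^1\<close> into an ideal.\<close>

lemma (in cring) coordinate_ideal:
  assumes N: "submodule N R (free_module R p)" and k: "k < p"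
  shows "ideal ((\<lambda>x. x k) ` N) R"
proof (rule idealI)
  have NR: "x k \<in> carrier R" if "x \<in> N" for x
    using submodule_free_subset[OF N] that k by auto
  show "ring R" by (rule ring_axioms)
  show "subgroup ((\<lambda>x. x k) ` N) (add_monoid R)"
  proof (rule add.subgroupI)
    show "(\<lambda>x. x k) ` N \<subseteq> carrier R" using NR by auto
    show "(\<lambda>x. x k) ` N \<noteq> {}" using submodule_free_zero[OF N] by auto
    fix a assume "a \<in> (\<lambda>x. x k) ` N"
    then obtain x where x: "x \<in> N" "a = x k" by auto
    have "(\<lambda>i\<in>{..<p}. \<ominus> \<one> \<otimes> x i) \<in> N" using x by (intro submodule_free_smult[OF N]) auto
    then have "\<ominus> \<one> \<otimes> x k \<in> (\<lambda>x. x k) ` N" using k by (auto intro!: rev_image_eqI)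
    then show "\<ominus> a \<in> (\<lambda>x. x k) ` N" using NR[OF x(1)] x(2) by (simp add: l_minus)
    fix b assume "b \<in> (\<lambda>x. x k) ` N"
    then obtain y where y: "y \<in> N" "b = y k" by auto
    show "a \<oplus> b \<in> (\<lambda>x. x k) ` N"
      using submodule_free_add[OF N x(1) y(1)] k x y by (auto intro!: rev_image_eqI)
  qed
  fix a r assume "a \<in> (\<lambda>x. x k) ` N" and r: "r \<in> carrier R"
  then obtain x where x: "x \<in> N" "a = x k" by auto
  show "r \<otimes> a \<in> (\<lambda>x. x k) ` N"
    using submodule_free_smult[OF N r x(1)] k x by (auto intro!: rev_image_eqI)
  then show "a \<otimes> r \<in> (\<lambda>x. x k) ` N" using NR x r by (simp add: m_comm)
qed

text \<open>Induction along the filtration of \<open>N\<close> by the submodules \<open>N' k\<close>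
  of vectors whose coordinates from \<open>k\<close> on vanish; \<open>N' p\<close> is
  \<open>N\<close>. The \<open>k\<close>-th coordinates of \<open>N' (Suc k)\<close> form a finitely
  generated ideal, and subtracting a suitable vector with the same \<open>k\<close>-th coordinate
  brings \<open>x\<close> down to \<open>N' k\<close>.\<close>

lemma submodule_free_finitely_generated:
  fixes R (structure)
  assumes "cring R" "noetherian_ring R" and N: "submodule N R (free_module R p)"
  obtains n A where "generating_matrix R p N n A"
proof -
  interpret cring R by fact
  interpret noetherian_ring R by fact
  interpret F: module R "free_module R p" by (rule free_module_module)
  define N' where "N' k = {x \<in> N. \<forall>i. k \<le> i \<and> i < p \<longrightarrow> x i = \<zero>}" for k
  have N': "submodule (N' k) R (free_module R p)" for k
    unfolding N'_def by (rule submodule_Int_coordinates[OF N])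
  \<comment> \<open>Generation is phrased as containment in every submodule \<open>T\<close> above
    \<open>Z\<close>, which lets the step from \<open>k\<close> to \<open>Suc k\<close> work inside
    one fixed \<open>T\<close>.\<close>
  have "\<exists>Z\<subseteq>N. finite Z \<and> (\<forall>T. submodule T R (free_module R p) \<and> Z \<subseteq> T \<longrightarrow> N' k \<subseteq> T)"
    if "k \<le> p" for k
    using that
  proof (induction k)
    case 0
    have "x = (\<lambda>i\<in>{..<p}. \<zero>)" if x: "x \<in> N' 0" for x
    proof
      fix i
      have "x \<in> extensional {..<p}" using x submodule_free_subset[OF N] by (auto simp: N'_def PiE_iff)
      then show "x i = (\<lambda>i\<in>{..<p}. \<zero>) i"
        using x by (cases "i < p") (simp_all add: N'_def extensional_def)
    qed
    then have "N' 0 \<subseteq> T" if "submodule T R (free_module R p)" for T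
      using submodule_free_zero[OF that] by (metis subsetI)
    then show ?case
      by (intro exI[of _ "{}"]) simp
  next
    case (Suc k)
    then obtain Z where Z: "Z \<subseteq> N" "finite Z"
      "\<And>T. submodule T R (free_module R p) \<Longrightarrow> Z \<subseteq> T \<Longrightarrow> N' k \<subseteq> T" by auto
    have k: "k < p" using Suc.prems by simp
    obtain C where C: "C \<subseteq> carrier R" "finite C" "(\<lambda>x. x k) ` N' (Suc k) = Idl C"
      using finetely_gen[OF coordinate_ideal[OF N'[of "Suc k"] k]] by auto
    have "C \<subseteq> (\<lambda>x. x k) ` N' (Suc k)" using genideal_self[OF C(1)] C(3) by simp
    then obtain Y where Y: "Y \<subseteq> N' (Suc k)" "finite Y" "C = (\<lambda>x. x k) ` Y"
      using C(2) by (meson finite_subset_image)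
    have "N' (Suc k) \<subseteq> T" if T: "submodule T R (free_module R p)" "Z \<union> Y \<subseteq> T" for T
    proof
      fix x assume x: "x \<in> N' (Suc k)"
      \<comment> \<open>Intersecting with \<open>N' (Suc k)\<close> ensures that the vector
        \<open>y\<close> found below lies in \<open>T\<close> and also has zero coordinates beyond
        \<open>k\<close>.\<close>
      have TN: "submodule (T \<inter> N' (Suc k)) R (free_module R p)"
        using T(1) N'[of "Suc k"] submodule_free_subset[OF T(1)]
        by (intro submodule_freeI)
          (auto intro: submodule_free_zero submodule_free_add submodule_free_smult)
      have "C \<subseteq> (\<lambda>x. x k) ` (T \<inter> N' (Suc k))" using Y T(2) by auto
      then have "Idl C \<subseteq> (\<lambda>x. x k) ` (T \<inter> N' (Suc k))"
        by (rule genideal_minimal[OF coordinate_ideal[OF TN k]])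
      moreover have "x k \<in> Idl C" using x unfolding C(3)[symmetric] by (rule imageI)
      ultimately have "x k \<in> (\<lambda>x. x k) ` (T \<inter> N' (Suc k))" by (rule subsetD)
      then obtain y where "x k = y k" "y \<in> T \<inter> N' (Suc k)" by (rule imageE)
      then have y: "y \<in> T" "y \<in> N' (Suc k)" "y k = x k" by simp_all
      have xR: "x i \<in> carrier R" and yR: "y i \<in> carrier R" if "i < p" for i
        using x y(2) submodule_free_subset[OF N'[of "Suc k"]] that by (auto simp: subset_iff)
      let ?my = "\<lambda>i\<in>{..<p}. \<ominus> \<one> \<otimes> y i"
      let ?d = "\<lambda>i\<in>{..<p}. x i \<oplus> ?my i"
      have d: "?d \<in> N' (Suc k)"
        using x y(2) by (intro submodule_free_add[OF N'] submodule_free_smult[OF N']) auto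
      have "?d i = \<zero>" if "k \<le> i" "i < p" for i
      proof (cases "i = k")
        case True
        then show ?thesis using y(3) yR[OF that(2)] that by (simp add: l_minus r_neg)
      next
        case False
        then show ?thesis using d that by (simp add: N'_def)
      qed
      then have "?d \<in> N' k" using d by (simp add: N'_def)
      then have "?d \<in> T" using Z(3)[OF T(1)] T(2) by auto
      then have "(\<lambda>i\<in>{..<p}. ?d i \<oplus> y i) \<in> T" using y(1) by (rule submodule_free_add[OF T(1)])
      also have "(\<lambda>i\<in>{..<p}. ?d i \<oplus> y i) = x"
        using xR yR x submodule_free_subset[OF N', of "Suc k"]
        by (auto simp: fun_eq_iff l_minus a_assoc l_neg PiE_iff extensional_def)
      finally show "x \<in> T" .
    qed
    then show ?case
      using Z Y(1,2) by (intro exI[of _ "Z \<union> Y"]) (auto simp: N'_def)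
  qed
  from this[OF le_refl] obtain Z where Z: "Z \<subseteq> N" "finite Z"
    "\<And>T. submodule T R (free_module R p) \<Longrightarrow> Z \<subseteq> T \<Longrightarrow> N' p \<subseteq> T" by auto
  have NN: "N' p = N" by (auto simp: N'_def)
  obtain A where A: "bij_betw A {..<card Z} Z"
    using ex_bij_betw_nat_finite[OF Z(2)] by (auto simp: lessThan_atLeast0)
  have ZR: "Z \<subseteq> carrier (free_module R p)" using Z(1) submodule_free_subset[OF N] by simp
  have "submodule_gen R (free_module R p) Z = N"
    using submodule_gen_minimal[OF N Z(1)]
      Z(3)[OF F.submodule_gen_submodule[OF ZR] submodule_gen_superset] NN by simp
  then have "generating_matrix R p N (card Z) A"
    using A ZR by (auto simp: generating_matrix_def bij_betw_def)
  then show ?thesis by (rule that)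
qed

lemma (in cring) adjoin_submodule:
  assumes M: "submodule M R (free_module R p)" and h: "h \<in> carrier (free_module R p)"
  shows "submodule (adjoin R p M h) R (free_module R p)"
    and "M \<subseteq> adjoin R p M h" and "h \<in> adjoin R p M h"
proof -
  interpret F: module R "free_module R p" by (rule free_module_module)
  note MS = F.submoduleE[OF M]
  let ?F = "free_module R p"
  have z: "\<zero>\<^bsub>?F\<^esub> \<in> M" using submodule_free_zero[OF M] by simp
  show M_le: "M \<subseteq> adjoin R p M h"
  proof
    fix m assume m: "m \<in> M"
    then have "m = m \<oplus>\<^bsub>?F\<^esub> \<zero> \<odot>\<^bsub>?F\<^esub> h"
      using h MS(1) F.smult_l_null[of h] F.r_zero[of m] by auto
    then show "m \<in> adjoin R p M h" using m unfolding adjoin_def by blast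
  qed
  have "h = \<zero>\<^bsub>?F\<^esub> \<oplus>\<^bsub>?F\<^esub> \<one> \<odot>\<^bsub>?F\<^esub> h"
    using h F.smult_one[of h] F.l_zero[of h] by metis
  then show "h \<in> adjoin R p M h" using z unfolding adjoin_def by blast
  show "submodule (adjoin R p M h) R (free_module R p)"
  proof (rule F.submoduleI)
    show "adjoin R p M h \<subseteq> carrier ?F"
      using MS(1) h F.smult_closed F.add.m_closed unfolding adjoin_def by blast
    show "\<zero>\<^bsub>?F\<^esub> \<in> adjoin R p M h" using M_le z by blast
  next
    fix x assume "x \<in> adjoin R p M h"
    then obtain m a where m: "m \<in> M" "a \<in> carrier R" "x = m \<oplus>\<^bsub>?F\<^esub> a \<odot>\<^bsub>?F\<^esub> h"
      unfolding adjoin_def by blast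
    have mc: "m \<in> carrier ?F" using m MS(1) by blast
    have "\<ominus>\<^bsub>?F\<^esub> x = \<ominus>\<^bsub>?F\<^esub> m \<oplus>\<^bsub>?F\<^esub> (\<ominus> a) \<odot>\<^bsub>?F\<^esub> h"
      using F.minus_add[OF mc F.smult_closed[OF m(2) h]] F.smult_l_minus[OF m(2) h] m(3) by metis
    then show "\<ominus>\<^bsub>?F\<^esub> x \<in> adjoin R p M h"
      using m MS(3)[OF m(1)] a_inv_closed[OF m(2)] unfolding adjoin_def by blast
    fix y assume "y \<in> adjoin R p M h"
    then obtain n b where n: "n \<in> M" "b \<in> carrier R" "y = n \<oplus>\<^bsub>?F\<^esub> b \<odot>\<^bsub>?F\<^esub> h"
      unfolding adjoin_def by blast
    have nc: "n \<in> carrier ?F" using n MS(1) by blast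
    have "x \<oplus>\<^bsub>?F\<^esub> y = (m \<oplus>\<^bsub>?F\<^esub> n) \<oplus>\<^bsub>?F\<^esub> (a \<oplus> b) \<odot>\<^bsub>?F\<^esub> h"
      unfolding m(3) n(3) F.smult_l_distr[OF m(2) n(2) h]
      using mc nc F.smult_closed[OF m(2) h] F.smult_closed[OF n(2) h]
      by (simp add: F.a_ac del: free_module_simps)
    then show "x \<oplus>\<^bsub>?F\<^esub> y \<in> adjoin R p M h"
      using MS(5)[OF m(1) n(1)] m n a_closed unfolding adjoin_def by blast
  next
    fix b x assume b: "b \<in> carrier R" and "x \<in> adjoin R p M h"
    then obtain m a where m: "m \<in> M" "a \<in> carrier R" "x = m \<oplus>\<^bsub>?F\<^esub> a \<odot>\<^bsub>?F\<^esub> h"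
      unfolding adjoin_def by blast
    have mc: "m \<in> carrier ?F" using m MS(1) by blast
    have "b \<odot>\<^bsub>?F\<^esub> x = (b \<odot>\<^bsub>?F\<^esub> m) \<oplus>\<^bsub>?F\<^esub> (b \<otimes> a) \<odot>\<^bsub>?F\<^esub> h"
      unfolding m(3) F.smult_r_distr[OF b mc F.smult_closed[OF m(2) h]] F.smult_assoc1[OF b m(2) h] ..
    then show "b \<odot>\<^bsub>?F\<^esub> x \<in> adjoin R p M h"
      using MS(4)[OF b m(1)] m_closed[OF b m(2)] unfolding adjoin_def by blast
  qed
qed

section \<open>Determinants and ideals of minors\<close>

text \<open>The sign is taken as an element of \<open>R\<close> so that it can be multiplied;
  \<open>ring_det\<close> lets the integer sign act by integer multiples, and
  \<open>sign_add_pow\<close> compares the two.\<close>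

definition perm_sign :: "('a, 'c) ring_scheme \<Rightarrow> (nat \<Rightarrow> nat) \<Rightarrow> 'a" where
  "perm_sign R f = (if evenperm f then \<one>\<^bsub>R\<^esub> else \<ominus>\<^bsub>R\<^esub> \<one>\<^bsub>R\<^esub>)"

lemma permutes_finite_permutation: "f permutes {..<i::nat} \<Longrightarrow> permutation f"
  by (auto simp: permutation_permutes)

lemma permutes_lessThan_lt: "f permutes {..<i::nat} \<Longrightarrow> k < i \<Longrightarrow> f k < i"
  using permutes_in_image by fastforce

context cring
begin

lemma perm_sign_closed [simp]: "perm_sign R f \<in> carrier R"
  by (simp add: perm_sign_def)

lemma perm_sign_compose:
  "permutation f \<Longrightarrow> permutation g \<Longrightarrow> perm_sign R (f \<circ> g) = perm_sign R f \<otimes> perm_sign R g"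
  by (simp add: perm_sign_def evenperm_comp l_minus r_minus)

lemma perm_sign_inv: "permutation f \<Longrightarrow> perm_sign R (inv_into UNIV f) = perm_sign R f"
  by (simp add: perm_sign_def evenperm_inv)

lemma perm_sign_transpose: "perm_sign R (Transposition.transpose a b) = (if a = b then \<one> else \<ominus> \<one>)"
  by (simp add: perm_sign_def evenperm_swap)

lemma sign_add_pow:
  assumes "x \<in> carrier R" shows "[(sign f :: int)] \<cdot> x = perm_sign R f \<otimes> x"
proof -
  have "[(- 1 :: int)] \<cdot> x = \<ominus> x"
    using assms add.int_pow_neg[of x 1] add.int_pow_1[of x] by (simp add: a_inv_def)
  then show ?thesis
    using assms add.int_pow_1[of x] by (simp add: sign_def perm_sign_def l_minus)
qed

lemma leibniz_factors_closed:
  fixes i :: nat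
  assumes "\<forall>k<i. \<forall>l<i. B k l \<in> carrier R" and "f permutes {..<i}"
  shows "(\<lambda>k. B k (f k)) \<in> {..<i} \<rightarrow> carrier R"
  using assms(1) permutes_lessThan_lt[OF assms(2)] by auto

lemma ring_det_eq:
  assumes "\<forall>k<i. \<forall>l<i. B k l \<in> carrier R"
  shows "ring_det R i B =
    (\<Oplus>\<sigma>\<in>{\<sigma>. \<sigma> permutes {..<i}}. perm_sign R \<sigma> \<otimes> (\<Otimes>k\<in>{..<i}. B k (\<sigma> k)))"
  unfolding ring_det_def
  using leibniz_factors_closed[where B = B and i = i, OF assms]
  by (intro finsum_cong') (auto simp: sign_add_pow intro!: finprod_closed)

lemma ring_det_closed:
  assumes "\<forall>k<i. \<forall>l<i. B k l \<in> carrier R"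
  shows "ring_det R i B \<in> carrier R"
  using leibniz_factors_closed[where B = B and i = i, OF assms]
  by (subst ring_det_eq[OF assms]) (auto intro!: finsum_closed m_closed finprod_closed)

lemma ring_det_cong:
  assumes "\<forall>k<i. \<forall>l<i. B k l = B' k l"
    and "\<forall>k<i. \<forall>l<i. B k l \<in> carrier R"
  shows "ring_det R i B = ring_det R i B'"
proof -
  have B': "\<forall>k<i. \<forall>l<i. B' k l \<in> carrier R" using assms by metis
  have "(\<Otimes>k\<in>{..<i}. B k (\<sigma> k)) = (\<Otimes>k\<in>{..<i}. B' k (\<sigma> k))" if "\<sigma> permutes {..<i}" for \<sigma>
    using assms leibniz_factors_closed[where B = B' and i = i, OF B' that] permutes_lessThan_lt[OF that]
    by (intro finprod_cong') auto
  then show ?thesis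
    using leibniz_factors_closed[where B = B' and i = i, OF B']
    unfolding ring_det_eq[where B = B and i = i, OF assms(2)] ring_det_eq[where B = B' and i = i, OF B']
    by (intro finsum_cong') (auto intro!: m_closed finprod_closed)
qed

text \<open>The Leibniz sum is reindexed by inverse permutations, which have the same sign, and each
  product is reindexed by \<open>\<sigma>\<close>.\<close>

lemma ring_det_transpose:
  assumes B: "\<forall>k<i. \<forall>l<i. B k l \<in> carrier R"
  shows "ring_det R i (\<lambda>k l. B l k) = ring_det R i B"
proof -
  have Bt: "\<forall>k<i. \<forall>l<i. B l k \<in> carrier R" using B by blast
  let ?P = "{\<sigma>. \<sigma> permutes {..<i}}"
  define g where "g \<sigma> = perm_sign R \<sigma> \<otimes> (\<Otimes>k\<in>{..<i}. B (\<sigma> k) k)" for \<sigma>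
  have gc: "g \<in> ?P \<rightarrow> carrier R"
    using leibniz_factors_closed[where B = "\<lambda>k l. B l k" and i = i, OF Bt]
    by (auto simp: g_def intro!: m_closed finprod_closed)
  have im: "inv_into UNIV ` ?P = ?P"
    using image_inverse_permutations[of "{..<i}"] by (auto simp: image_def)
  have inj: "inj_on (inv_into UNIV) ?P"
    by (rule inj_on_inverseI[where g = "inv_into UNIV"]) (auto dest: permutes_inv_inv)
  have "ring_det R i (\<lambda>k l. B l k) = (\<Oplus>\<sigma>\<in>?P. g \<sigma>)"
    using ring_det_eq[where B = "\<lambda>k l. B l k" and i = i] B unfolding g_def by simp
  also have "\<dots> = (\<Oplus>\<sigma>\<in>inv_into UNIV ` ?P. g \<sigma>)" by (simp only: im)
  also have "\<dots> = (\<Oplus>\<sigma>\<in>?P. g (inv_into UNIV \<sigma>))"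
    using finsum_reindex[OF _ inj, of g] gc im by simp
  also have "\<dots> = (\<Oplus>\<sigma>\<in>?P. perm_sign R \<sigma> \<otimes> (\<Otimes>k\<in>{..<i}. B k (\<sigma> k)))"
  proof (rule finsum_cong')
    fix \<sigma> assume "\<sigma> \<in> ?P"
    then have \<sigma>: "\<sigma> permutes {..<i}" by simp
    have "(\<Otimes>k\<in>{..<i}. B (inv_into UNIV \<sigma> k) k) = (\<Otimes>k\<in>\<sigma> ` {..<i}. B (inv_into UNIV \<sigma> k) k)"
      using permutes_image[OF \<sigma>] by simp
    also have "\<dots> = (\<Otimes>k\<in>{..<i}. B (inv_into UNIV \<sigma> (\<sigma> k)) (\<sigma> k))"
      using leibniz_factors_closed[where B = "\<lambda>k l. B l k" and i = i, OF Bt permutes_inv[OF \<sigma>]]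
        permutes_image[OF \<sigma>] permutes_inj_on[OF \<sigma>]
      by (intro finprod_reindex) auto
    also have "\<dots> = (\<Otimes>k\<in>{..<i}. B k (\<sigma> k))"
      using permutes_inverses[OF \<sigma>] by simp
    finally show "g (inv_into UNIV \<sigma>) = perm_sign R \<sigma> \<otimes> (\<Otimes>k\<in>{..<i}. B k (\<sigma> k))"
      by (simp add: g_def perm_sign_inv permutes_finite_permutation[OF \<sigma>])
  qed (use leibniz_factors_closed[where B = B and i = i, OF B] in \<open>auto intro!: m_closed finprod_closed\<close>)
  also have "\<dots> = ring_det R i B" using ring_det_eq[where i = i, OF B] by simp
  finally show ?thesis .
qed

text \<open>Reindexing by left composition with \<open>\<pi>\<close> produces its sign once more,
  and the square of a sign is one.\<close>

lemma ring_det_permute_columns: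
  assumes B: "\<forall>k<i. \<forall>l<i. B k l \<in> carrier R" and \<pi>: "\<pi> permutes {..<i}"
  shows "ring_det R i (\<lambda>k l. B k (\<pi> l)) = perm_sign R \<pi> \<otimes> ring_det R i B"
proof -
  let ?P = "{\<sigma>. \<sigma> permutes {..<i}}"
  define g where "g \<sigma> = perm_sign R \<sigma> \<otimes> (\<Otimes>k\<in>{..<i}. B k (\<sigma> k))" for \<sigma>
  have gc: "g \<in> ?P \<rightarrow> carrier R"
    using leibniz_factors_closed[where B = B and i = i, OF B]
    by (auto simp: g_def intro!: m_closed finprod_closed)
  have B\<pi>: "\<forall>k<i. \<forall>l<i. B k (\<pi> l) \<in> carrier R"
    using B permutes_lessThan_lt[OF \<pi>] by simp
  have im: "(\<circ>) \<pi> ` ?P = ?P"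
    using image_compose_permutations_left[OF \<pi>] by (auto simp: image_def)
  have inj: "inj_on ((\<circ>) \<pi>) ?P"
    using permutes_inj[OF \<pi>] by (auto intro!: inj_onI simp: fun.inj_map_strong fun_eq_iff inj_eq)
  have cl: "(\<Otimes>k\<in>{..<i}. B k (\<pi> (\<sigma> k))) \<in> carrier R" if "\<sigma> \<in> ?P" for \<sigma>
    using leibniz_factors_closed[where B = "\<lambda>k l. B k (\<pi> l)" and i = i, OF B\<pi>] that
    by (intro finprod_closed) auto
  have g\<pi>: "g (\<pi> \<circ> \<sigma>) = perm_sign R \<pi> \<otimes> (perm_sign R \<sigma> \<otimes> (\<Otimes>k\<in>{..<i}. B k (\<pi> (\<sigma> k))))"
    if "\<sigma> \<in> ?P" for \<sigma>
    using that perm_sign_compose[OF permutes_finite_permutation[OF \<pi>]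
        permutes_finite_permutation[of \<sigma>]] cl[OF that]
    by (simp add: g_def m_assoc)
  have "perm_sign R \<pi> \<otimes> ring_det R i B = perm_sign R \<pi> \<otimes> (\<Oplus>\<sigma>\<in>(\<circ>) \<pi> ` ?P. g \<sigma>)"
    unfolding im using B by (simp add: ring_det_eq g_def)
  also have "\<dots> = perm_sign R \<pi> \<otimes> (\<Oplus>\<sigma>\<in>?P. g (\<pi> \<circ> \<sigma>))"
    using finsum_reindex[OF _ inj, of g] gc im by simp
  also have "\<dots> = (\<Oplus>\<sigma>\<in>?P. perm_sign R \<pi> \<otimes> g (\<pi> \<circ> \<sigma>))"
    using gc im by (intro finsum_rdistr) (auto simp: finite_permutations)
  also have "\<dots> = (\<Oplus>\<sigma>\<in>?P. perm_sign R \<sigma> \<otimes> (\<Otimes>k\<in>{..<i}. B k (\<pi> (\<sigma> k))))"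
  proof (rule finsum_cong')
    fix \<sigma> assume \<sigma>: "\<sigma> \<in> ?P"
    have "perm_sign R \<pi> \<otimes> perm_sign R \<pi> = \<one>" by (simp add: perm_sign_def l_minus)
    then show "perm_sign R \<pi> \<otimes> g (\<pi> \<circ> \<sigma>) = perm_sign R \<sigma> \<otimes> (\<Otimes>k\<in>{..<i}. B k (\<pi> (\<sigma> k)))"
      using cl[OF \<sigma>] by (simp add: g\<pi>[OF \<sigma>] m_assoc[symmetric])
  qed (use cl in auto)
  also have "\<dots> = ring_det R i (\<lambda>k l. B k (\<pi> l))"
    using ring_det_eq[where B = "\<lambda>k l. B k (\<pi> l)" and i = i, OF B\<pi>] by simp
  finally show ?thesis by simp
qed

text \<open>Exchanging the two columns only shows that the determinant equals its negative, which is
  inconclusive when 2 is a zero divisor. Composition with the transposition is therefore used as a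
  bijection from even to odd permutations, under which the terms cancel in pairs.\<close>

lemma ring_det_equal_columns:
  assumes B: "\<forall>k<i. \<forall>l<i. B k l \<in> carrier R"
    and ab: "a < i" "b < i" "a \<noteq> b" and eq: "\<forall>k<i. B k a = B k b"
  shows "ring_det R i B = \<zero>"
proof -
  let ?P = "{\<sigma>. \<sigma> permutes {..<i}}"
  let ?E = "{\<sigma>. \<sigma> permutes {..<i} \<and> evenperm \<sigma>}"
  let ?O = "{\<sigma>. \<sigma> permutes {..<i} \<and> \<not> evenperm \<sigma>}"
  let ?t = "Transposition.transpose a b"
  define g where "g \<sigma> = (\<Otimes>k\<in>{..<i}. B k (\<sigma> k))" for \<sigma>
  have gc: "g \<sigma> \<in> carrier R" if "\<sigma> permutes {..<i}" for \<sigma>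
    using leibniz_factors_closed[where B = B and i = i, OF B] that by (auto simp: g_def intro!: finprod_closed)
  have t: "?t permutes {..<i}" using ab by (intro permutes_swap_id) auto
  have gt: "g (?t \<circ> \<sigma>) = g \<sigma>" if "\<sigma> permutes {..<i}" for \<sigma>
    unfolding g_def using leibniz_factors_closed[where B = B and i = i, OF B that] eq
    by (intro finprod_cong') (auto simp: Transposition.transpose_def)
  have ev: "evenperm (?t \<circ> \<sigma>) \<longleftrightarrow> \<not> evenperm \<sigma>" if "\<sigma> permutes {..<i}" for \<sigma>
    using ab permutes_finite_permutation[OF that] permutes_finite_permutation[OF t]
    by (simp add: evenperm_comp evenperm_swap)
  have tt: "?t \<circ> (?t \<circ> \<sigma>) = \<sigma>" for \<sigma> by (simp add: fun_eq_iff)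
  have im: "(\<circ>) ?t ` ?E = ?O"
  proof (intro equalityI subsetI)
    fix \<sigma> assume "\<sigma> \<in> (\<circ>) ?t ` ?E"
    then show "\<sigma> \<in> ?O" using ev permutes_compose[OF _ t] by auto
  next
    fix \<sigma> assume "\<sigma> \<in> ?O"
    then have "?t \<circ> \<sigma> \<in> ?E" using ev permutes_compose[OF _ t] by auto
    then show "\<sigma> \<in> (\<circ>) ?t ` ?E" using tt[of \<sigma>] by (metis image_eqI)
  qed
  have inj: "inj_on ((\<circ>) ?t) ?E" by (rule inj_on_inverseI[where g = "(\<circ>) ?t"]) (rule tt)
  have fin: "finite ?E" "finite ?O"
    using finite_permutations[of "{..<i}"] by (auto elim!: rev_finite_subset)
  have gE: "(\<Oplus>\<sigma>\<in>?E. g \<sigma>) \<in> carrier R" using gc by (intro finsum_closed) auto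
  have "ring_det R i B = (\<Oplus>\<sigma>\<in>?E \<union> ?O. perm_sign R \<sigma> \<otimes> g \<sigma>)"
    using B by (subst ring_det_eq) (auto simp: g_def intro!: arg_cong[where f = "finsum R _"])
  also have "\<dots> = (\<Oplus>\<sigma>\<in>?E. perm_sign R \<sigma> \<otimes> g \<sigma>) \<oplus> (\<Oplus>\<sigma>\<in>?O. perm_sign R \<sigma> \<otimes> g \<sigma>)"
    using fin gc by (intro finsum_Un_disjoint) auto
  also have "(\<Oplus>\<sigma>\<in>?E. perm_sign R \<sigma> \<otimes> g \<sigma>) = (\<Oplus>\<sigma>\<in>?E. g \<sigma>)"
    using gc by (intro finsum_cong') (auto simp: perm_sign_def)
  also have "(\<Oplus>\<sigma>\<in>?O. perm_sign R \<sigma> \<otimes> g \<sigma>) = (\<Oplus>\<sigma>\<in>?O. (\<ominus> \<one>) \<otimes> g \<sigma>)"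
    using gc by (intro finsum_cong') (auto simp: perm_sign_def)
  also have "\<dots> = (\<ominus> \<one>) \<otimes> (\<Oplus>\<sigma>\<in>(\<circ>) ?t ` ?E. g \<sigma>)"
    unfolding im using gc fin by (intro finsum_rdistr[symmetric]) auto
  also have "(\<Oplus>\<sigma>\<in>(\<circ>) ?t ` ?E. g \<sigma>) = (\<Oplus>\<sigma>\<in>?E. g (?t \<circ> \<sigma>))"
    using inj im gc by (intro finsum_reindex) auto
  also have "\<dots> = (\<Oplus>\<sigma>\<in>?E. g \<sigma>)" using gc gt by (intro finsum_cong') auto
  finally show ?thesis using gE by (simp add: l_minus r_neg)
qed

section \<open>Row rules, expansion of a determinant and Cramer's rule\<close>

lemma ring_det_permute_rows:
  assumes B: "\<forall>k<i. \<forall>l<i. B k l \<in> carrier R" and \<pi>: "\<pi> permutes {..<i}"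
  shows "ring_det R i (\<lambda>k l. B (\<pi> k) l) = perm_sign R \<pi> \<otimes> ring_det R i B"
proof -
  have Bt: "\<forall>k<i. \<forall>l<i. B l k \<in> carrier R" using B by blast
  have B\<pi>: "\<forall>k<i. \<forall>l<i. B (\<pi> k) l \<in> carrier R" using B permutes_lessThan_lt[OF \<pi>] by blast
  show ?thesis
    using ring_det_permute_columns[where B = "\<lambda>k l. B l k", OF Bt \<pi>]
      ring_det_transpose[where B = B, OF B]
      ring_det_transpose[where B = "\<lambda>k l. B (\<pi> k) l", OF B\<pi>] by simp
qed

lemma ring_det_equal_rows:
  assumes B: "\<forall>k<i. \<forall>l<i. B k l \<in> carrier R"
    and ab: "a < i" "b < i" "a \<noteq> b" and eq: "\<forall>l<i. B a l = B b l"
  shows "ring_det R i B = \<zero>"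
proof -
  have Bt: "\<forall>k<i. \<forall>l<i. B l k \<in> carrier R" using B by blast
  show ?thesis
    using ring_det_equal_columns[where B = "\<lambda>k l. B l k", OF Bt ab eq]
      ring_det_transpose[where B = B, OF B] by simp
qed

text \<open>Isolating the factor from row \<open>m\<close> makes linearity in that row visible: the
  rest of each term is independent of \<open>x\<close>.\<close>

lemma ring_det_row_eq:
  assumes B: "\<forall>k<i. \<forall>l<i. B k l \<in> carrier R"
    and x: "\<forall>l<i. x l \<in> carrier R" and m: "m < i"
  shows "ring_det R i (B(m := x)) =
    (\<Oplus>\<sigma>\<in>{\<sigma>. \<sigma> permutes {..<i}}. x (\<sigma> m) \<otimes> (perm_sign R \<sigma> \<otimes> (\<Otimes>k\<in>{..<i} - {m}. B k (\<sigma> k))))"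
proof -
  have B': "\<forall>k<i. \<forall>l<i. (B(m := x)) k l \<in> carrier R" using B x by simp
  have cl: "(\<Otimes>k\<in>{..<i} - {m}. B k (\<sigma> k)) \<in> carrier R" if "\<sigma> permutes {..<i}" for \<sigma>
    using leibniz_factors_closed[where B = B and i = i, OF B that] by (intro finprod_closed) auto
  have "(\<Otimes>k\<in>{..<i}. (B(m := x)) k (\<sigma> k)) = x (\<sigma> m) \<otimes> (\<Otimes>k\<in>{..<i} - {m}. B k (\<sigma> k))"
    if \<sigma>: "\<sigma> permutes {..<i}" for \<sigma>
  proof -
    have "(\<Otimes>k\<in>{..<i}. (B(m := x)) k (\<sigma> k)) = (\<Otimes>k\<in>insert m ({..<i} - {m}). (B(m := x)) k (\<sigma> k))"
      using m by (simp add: insert_absorb)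
    also have "\<dots> = x (\<sigma> m) \<otimes> (\<Otimes>k\<in>{..<i} - {m}. (B(m := x)) k (\<sigma> k))"
      using leibniz_factors_closed[where B = "B(m := x)" and i = i, OF B' \<sigma>] x
        permutes_lessThan_lt[OF \<sigma> m]
      by (subst finprod_insert) auto
    also have "(\<Otimes>k\<in>{..<i} - {m}. (B(m := x)) k (\<sigma> k)) = (\<Otimes>k\<in>{..<i} - {m}. B k (\<sigma> k))"
      using leibniz_factors_closed[where B = B and i = i, OF B \<sigma>] by (intro finprod_cong') auto
    finally show ?thesis .
  qed
  then show ?thesis
    unfolding ring_det_eq[where B = "B(m := x)" and i = i, OF B'] using cl x permutes_lessThan_lt[OF _ m]
    by (intro finsum_cong') (auto simp: m_lcomm)
qed

lemma ring_det_row_add: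
  assumes B: "\<forall>k<i. \<forall>l<i. B k l \<in> carrier R"
    and x: "\<forall>l<i. x l \<in> carrier R" and y: "\<forall>l<i. y l \<in> carrier R" and m: "m < i"
  shows "ring_det R i (B(m := \<lambda>l. x l \<oplus> y l)) = ring_det R i (B(m := x)) \<oplus> ring_det R i (B(m := y))"
proof -
  let ?P = "{\<sigma>. \<sigma> permutes {..<i}}"
  define c where "c \<sigma> = perm_sign R \<sigma> \<otimes> (\<Otimes>k\<in>{..<i} - {m}. B k (\<sigma> k))" for \<sigma>
  have c: "c \<sigma> \<in> carrier R" if "\<sigma> permutes {..<i}" for \<sigma>
    unfolding c_def using leibniz_factors_closed[where B = B and i = i, OF B that]
    by (intro m_closed finprod_closed) auto
  have xy: "\<forall>l<i. x l \<oplus> y l \<in> carrier R" using x y by simp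
  have "(\<Oplus>\<sigma>\<in>?P. (x (\<sigma> m) \<oplus> y (\<sigma> m)) \<otimes> c \<sigma>) =
      (\<Oplus>\<sigma>\<in>?P. x (\<sigma> m) \<otimes> c \<sigma> \<oplus> y (\<sigma> m) \<otimes> c \<sigma>)"
    using c x y permutes_lessThan_lt[OF _ m] by (intro finsum_cong') (auto simp: l_distr)
  also have "\<dots> = (\<Oplus>\<sigma>\<in>?P. x (\<sigma> m) \<otimes> c \<sigma>) \<oplus> (\<Oplus>\<sigma>\<in>?P. y (\<sigma> m) \<otimes> c \<sigma>)"
    using c x y permutes_lessThan_lt[OF _ m] by (intro finsum_addf) auto
  finally show ?thesis
    using ring_det_row_eq[where B = B and i = i, OF B x m]
      ring_det_row_eq[where B = B and i = i, OF B y m]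
      ring_det_row_eq[where B = B and i = i, OF B xy m] by (simp add: c_def)
qed

lemma ring_det_row_smult:
  assumes B: "\<forall>k<i. \<forall>l<i. B k l \<in> carrier R"
    and x: "\<forall>l<i. x l \<in> carrier R" and a: "a \<in> carrier R" and m: "m < i"
  shows "ring_det R i (B(m := \<lambda>l. a \<otimes> x l)) = a \<otimes> ring_det R i (B(m := x))"
proof -
  let ?P = "{\<sigma>. \<sigma> permutes {..<i}}"
  define c where "c \<sigma> = perm_sign R \<sigma> \<otimes> (\<Otimes>k\<in>{..<i} - {m}. B k (\<sigma> k))" for \<sigma>
  have c: "c \<sigma> \<in> carrier R" if "\<sigma> permutes {..<i}" for \<sigma>
    unfolding c_def using leibniz_factors_closed[where B = B and i = i, OF B that]
    by (intro m_closed finprod_closed) auto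
  have ax: "\<forall>l<i. a \<otimes> x l \<in> carrier R" using x a by simp
  have "(\<Oplus>\<sigma>\<in>?P. (a \<otimes> x (\<sigma> m)) \<otimes> c \<sigma>) = (\<Oplus>\<sigma>\<in>?P. a \<otimes> (x (\<sigma> m) \<otimes> c \<sigma>))"
    using c x a permutes_lessThan_lt[OF _ m] by (intro finsum_cong') (auto simp: m_assoc)
  also have "\<dots> = a \<otimes> (\<Oplus>\<sigma>\<in>?P. x (\<sigma> m) \<otimes> c \<sigma>)"
    using c x a permutes_lessThan_lt[OF _ m]
    by (intro finsum_rdistr[symmetric]) (auto simp: finite_permutations)
  finally show ?thesis
    using ring_det_row_eq[where B = B and i = i, OF B x m]
      ring_det_row_eq[where B = B and i = i, OF B ax m] by (simp add: c_def)
qed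

text \<open>Every permutation of \<open>{..<Suc r}\<close> is, in exactly one way, a permutation
  fixing \<open>r\<close> followed by the transposition of \<open>r\<close> and \<open>b\<close>,
  where \<open>b\<close> is the image of \<open>r\<close>. The cofactor of \<open>b < r\<close> thus
  appears as minus the determinant in which column \<open>b\<close> is replaced by column
  \<open>r\<close>. This form avoids deleted columns and shifted indices, and it is already the
  numerator in Cramer's rule.\<close>

lemma ring_det_expand_last_row:
  assumes B: "\<forall>k<Suc r. \<forall>l<Suc r. B k l \<in> carrier R"
  shows "ring_det R (Suc r) B =
    B r r \<otimes> ring_det R r B \<oplus>
    (\<Oplus>b\<in>{..<r}. B r b \<otimes> \<ominus> ring_det R r (\<lambda>k l. B k (if l = b then r else l)))"
proof -
  let ?P = "{\<sigma>. \<sigma> permutes {..<r}}" and ?Q = "{\<sigma>. \<sigma> permutes {..<Suc r}}"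
  let ?t = "Transposition.transpose r"
  define f where "f \<sigma> = perm_sign R \<sigma> \<otimes> (\<Otimes>k\<in>{..<Suc r}. B k (\<sigma> k))" for \<sigma>
  define D where "D b = ring_det R r (\<lambda>k l. B k (if l = b then r else l))" for b
  have Bb: "\<forall>k<r. \<forall>l<r. B k (if l = b then r else l) \<in> carrier R" if "b < Suc r" for b
    using B that by simp
  have D: "D b \<in> carrier R" if "b < Suc r" for b
    unfolding D_def by (rule ring_det_closed[OF Bb[OF that]])
  have Dr: "D r = ring_det R r B"
    unfolding D_def by (rule ring_det_cong) (use B in auto)
  have fc: "f \<sigma> \<in> carrier R" if "\<sigma> \<in> ?Q" for \<sigma>
    unfolding f_def using leibniz_factors_closed[OF B, of \<sigma>] that
    by (intro m_closed finprod_closed) auto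
  have \<sigma>r: "\<sigma> r = r" if "\<sigma> \<in> ?P" for \<sigma> using that by (auto simp: permutes_def)
  have Qb: "?Q = (\<Union>b\<in>{..<Suc r}. (\<circ>) (?t b) ` ?P)"
    unfolding lessThan_Suc permutes_insert by (auto intro: rev_image_eqI)
  have inj: "inj_on ((\<circ>) (?t b)) ?P" for b
    by (rule inj_on_inverseI[where g = "(\<circ>) (?t b)"]) (simp add: fun_eq_iff)
  have fb: "f (?t b \<circ> \<sigma>) =
      (if b = r then \<one> else \<ominus> \<one>) \<otimes> (B r b \<otimes>
        (perm_sign R \<sigma> \<otimes> (\<Otimes>k\<in>{..<r}. B k (if \<sigma> k = b then r else \<sigma> k))))"
    if b: "b < Suc r" and \<sigma>: "\<sigma> \<in> ?P" for b \<sigma>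
  proof -
    have P: "(\<lambda>k. B k (if \<sigma> k = b then r else \<sigma> k)) \<in> {..<r} \<rightarrow> carrier R"
      using leibniz_factors_closed[where B = "\<lambda>k l. B k (if l = b then r else l)", OF Bb[OF b]] \<sigma>
      by simp
    have "(\<Otimes>k\<in>{..<Suc r}. B k ((?t b \<circ> \<sigma>) k)) =
        B r b \<otimes> (\<Otimes>k\<in>{..<r}. B k (if \<sigma> k = b then r else \<sigma> k))"
    proof -
      have eq: "B k ((?t b \<circ> \<sigma>) k) = B k (if \<sigma> k = b then r else \<sigma> k)" if "k < r" for k
        using permutes_lessThan_lt[of \<sigma> r k] \<sigma> that
        by (auto simp: Transposition.transpose_def)
      have "(\<Otimes>k\<in>{..<Suc r}. B k ((?t b \<circ> \<sigma>) k)) =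
          B r ((?t b \<circ> \<sigma>) r) \<otimes> (\<Otimes>k\<in>{..<r}. B k ((?t b \<circ> \<sigma>) k))"
        unfolding lessThan_Suc using P eq B b \<sigma>r[OF \<sigma>] by (intro finprod_insert) auto
      also have "(\<Otimes>k\<in>{..<r}. B k ((?t b \<circ> \<sigma>) k)) =
          (\<Otimes>k\<in>{..<r}. B k (if \<sigma> k = b then r else \<sigma> k))"
        using P eq by (intro finprod_cong') auto
      finally show ?thesis using \<sigma>r[OF \<sigma>] by simp
    qed
    moreover have "permutation (?t b)" by (rule permutation_swap_id)
    moreover have "permutation \<sigma>" using \<sigma> permutes_finite_permutation by auto
    ultimately show ?thesis
      using P B b finprod_closed[OF P]
      by (auto simp: f_def perm_sign_compose perm_sign_transpose m_ac)
  qed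
  have "ring_det R (Suc r) B = (\<Oplus>\<sigma>\<in>(\<Union>b\<in>{..<Suc r}. (\<circ>) (?t b) ` ?P). f \<sigma>)"
    unfolding Qb[symmetric] f_def using ring_det_eq[OF B] by simp
  also have "\<dots> = (\<Oplus>b\<in>{..<Suc r}. \<Oplus>\<sigma>\<in>(\<circ>) (?t b) ` ?P. f \<sigma>)"
  proof (rule add.finprod_UN_disjoint)
    \<comment> \<open>Evaluation at \<open>r\<close> recovers \<open>b\<close>, so the classes of
      permutations are disjoint.\<close>
    have "b = c" if "?t b \<circ> \<sigma> = ?t c \<circ> \<tau>" "\<sigma> \<in> ?P" "\<tau> \<in> ?P" for b c \<sigma> \<tau>
      using fun_cong[OF that(1), of r] \<sigma>r[OF that(2)] \<sigma>r[OF that(3)] by simp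
    then show "pairwise (\<lambda>b c. disjnt ((\<circ>) (?t b) ` ?P) ((\<circ>) (?t c) ` ?P)) {..<Suc r}"
      unfolding pairwise_def disjnt_def by blast
  next
    fix b \<sigma> assume "b \<in> {..<Suc r}" "\<sigma> \<in> (\<circ>) (?t b) ` ?P"
    then have "\<sigma> \<in> ?Q" unfolding Qb by blast
    then show "f \<sigma> \<in> carrier R" by (rule fc)
  qed (auto simp: finite_permutations)
  also have "\<dots> = (\<Oplus>b\<in>{..<Suc r}. (if b = r then \<one> else \<ominus> \<one>) \<otimes> (B r b \<otimes> D b))"
  proof (rule finsum_cong')
    fix b assume b: "b \<in> {..<Suc r}"
    then have bl: "b < Suc r" by simp
    let ?s = "if b = r then \<one> else \<ominus> \<one>"
    let ?g = "\<lambda>\<sigma>. perm_sign R \<sigma> \<otimes> (\<Otimes>k\<in>{..<r}. B k (if \<sigma> k = b then r else \<sigma> k))"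
    have gc: "?g \<in> ?P \<rightarrow> carrier R"
      using leibniz_factors_closed[where B = "\<lambda>k l. B k (if l = b then r else l)", OF Bb[OF bl]]
      by (auto intro!: m_closed finprod_closed)
    have sub: "(\<circ>) (?t b) ` ?P \<subseteq> ?Q" unfolding Qb using b by blast
    have s: "?s \<in> carrier R" "B r b \<in> carrier R" using B b by auto
    have "(\<Oplus>\<sigma>\<in>(\<circ>) (?t b) ` ?P. f \<sigma>) = (\<Oplus>\<sigma>\<in>?P. f (?t b \<circ> \<sigma>))"
      using sub fc by (intro finsum_reindex inj) auto
    also have "\<dots> = (\<Oplus>\<sigma>\<in>?P. ?s \<otimes> B r b \<otimes> ?g \<sigma>)"
    proof (rule finsum_cong')
      show "(\<lambda>\<sigma>. ?s \<otimes> B r b \<otimes> ?g \<sigma>) \<in> ?P \<rightarrow> carrier R"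
        using m_closed[OF m_closed[OF s] funcset_mem[OF gc]] by (rule Pi_I)
      fix \<sigma> assume \<sigma>: "\<sigma> \<in> ?P"
      show "f (?t b \<circ> \<sigma>) = ?s \<otimes> B r b \<otimes> ?g \<sigma>"
        using fb[OF bl \<sigma>] s m_assoc[OF s funcset_mem[OF gc \<sigma>]] by simp
    qed simp
    also have "\<dots> = ?s \<otimes> B r b \<otimes> (\<Oplus>\<sigma>\<in>?P. ?g \<sigma>)"
      using gc s by (intro finsum_rdistr[symmetric]) (auto simp: finite_permutations)
    also have "(\<Oplus>\<sigma>\<in>?P. ?g \<sigma>) = D b"
      unfolding D_def
      using ring_det_eq[where B = "\<lambda>k l. B k (if l = b then r else l)", OF Bb[OF bl]] by simp
    finally show "(\<Oplus>\<sigma>\<in>(\<circ>) (?t b) ` ?P. f \<sigma>) = ?s \<otimes> (B r b \<otimes> D b)"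
      unfolding m_assoc[OF s D[OF bl]] .
  qed (use B D in auto)
  also have "\<dots> = B r r \<otimes> D r \<oplus>
      (\<Oplus>b\<in>{..<r}. (if b = r then \<one> else \<ominus> \<one>) \<otimes> (B r b \<otimes> D b))"
    unfolding lessThan_Suc using B D by (subst finsum_insert) auto
  also have "(\<Oplus>b\<in>{..<r}. (if b = r then \<one> else \<ominus> \<one>) \<otimes> (B r b \<otimes> D b)) =
      (\<Oplus>b\<in>{..<r}. B r b \<otimes> \<ominus> D b)"
    using B D by (intro finsum_cong') (auto simp: l_minus r_minus)
  finally show ?thesis unfolding Dr by (simp only: D_def)
qed

text \<open>The coefficients involve only the first \<open>r\<close> rows. Keeping these and letting
  row \<open>r\<close> run through all rows of a matrix therefore gives a single relation between
  its columns.\<close>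

lemma ring_det_cramer:
  assumes B: "\<forall>k<Suc r. \<forall>l<Suc r. B k l \<in> carrier R" and 0: "ring_det R (Suc r) B = \<zero>"
  shows "ring_det R r B \<otimes> B r r =
    (\<Oplus>b\<in>{..<r}. ring_det R r (\<lambda>k l. B k (if l = b then r else l)) \<otimes> B r b)"
proof -
  define D where "D b = ring_det R r (\<lambda>k l. B k (if l = b then r else l))" for b
  have D: "D b \<in> carrier R" if "b < r" for b
    unfolding D_def by (rule ring_det_closed) (use B that in auto)
  have d: "ring_det R r B \<in> carrier R" by (rule ring_det_closed) (use B in auto)
  have Br: "B r r \<in> carrier R" using B by simp
  have S: "(\<Oplus>b\<in>{..<r}. D b \<otimes> B r b) \<in> carrier R"
    using B D by (intro finsum_closed) auto
  have "(\<Oplus>b\<in>{..<r}. B r b \<otimes> \<ominus> D b) = (\<Oplus>b\<in>{..<r}. \<ominus> \<one> \<otimes> (D b \<otimes> B r b))"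
    using B D by (intro finsum_cong') (auto simp: l_minus r_minus m_comm)
  also have "\<dots> = \<ominus> \<one> \<otimes> (\<Oplus>b\<in>{..<r}. D b \<otimes> B r b)"
    using B D by (intro finsum_rdistr[symmetric]) auto
  also have "\<dots> = \<ominus> (\<Oplus>b\<in>{..<r}. D b \<otimes> B r b)" using S by (simp add: l_minus)
  finally have "B r r \<otimes> ring_det R r B \<oplus> \<ominus> (\<Oplus>b\<in>{..<r}. D b \<otimes> B r b) = \<zero>"
    using ring_det_expand_last_row[OF B] 0 by (simp add: D_def)
  then have "B r r \<otimes> ring_det R r B = (\<Oplus>b\<in>{..<r}. D b \<otimes> B r b)"
    using S d Br sum_zero_eq_neg[of "B r r \<otimes> ring_det R r B" "\<ominus> (\<Oplus>b\<in>{..<r}. D b \<otimes> B r b)"]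
    by simp
  then show ?thesis using d Br by (simp add: D_def m_comm)
qed

end

section \<open>Ideals of minors\<close>

lemma inj_on_lessThan_sort:
  fixes \<gamma> :: "nat \<Rightarrow> nat"
  assumes "inj_on \<gamma> {..<i}"
  obtains \<gamma>' \<pi> where "strict_mono_on {..<i} \<gamma>'" "\<gamma>' ` {..<i} = \<gamma> ` {..<i}"
    "\<pi> permutes {..<i}" "\<And>l. l < i \<Longrightarrow> \<gamma> l = \<gamma>' (\<pi> l)"
proof -
  have "card (\<gamma> ` {..<i}) = i" using assms by (simp add: card_image)
  then obtain \<gamma>' where \<gamma>': "bij_betw \<gamma>' {..<i} (\<gamma> ` {..<i})" "strict_mono_on {..<i} \<gamma>'"
    using ex_bij_betw_strict_mono_card[of "\<gamma> ` {..<i}"] by auto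
  define \<pi> where "\<pi> l = (if l < i then inv_into {..<i} \<gamma>' (\<gamma> l) else l)" for l
  have im: "\<gamma>' ` {..<i} = \<gamma> ` {..<i}" using \<gamma>'(1) by (simp add: bij_betw_def)
  have \<pi>: "\<pi> l < i" "\<gamma> l = \<gamma>' (\<pi> l)" if "l < i" for l
    using that im inv_into_into[of "\<gamma> l" \<gamma>' "{..<i}"] f_inv_into_f[of "\<gamma> l" \<gamma>' "{..<i}"]
    by (auto simp: \<pi>_def)
  have "inj_on \<pi> {..<i}" using \<pi>(2) assms by (metis inj_on_def lessThan_iff)
  then have "bij_betw \<pi> {..<i} {..<i}"
    using \<pi>(1) endo_inj_surj[of "{..<i}" \<pi>] by (auto simp: bij_betw_def)
  then have "\<pi> permutes {..<i}" by (rule bij_imp_permutes) (simp add: \<pi>_def)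
  then show ?thesis using that[OF \<gamma>'(2) im] \<pi>(2) by blast
qed

context cring
begin

lemma minors_closed:
  assumes "\<forall>j<n. A j \<in> carrier (free_module R p)"
  shows "minors R p n A i \<subseteq> carrier R"
proof
  fix x assume "x \<in> minors R p n A i"
  then obtain \<rho> \<gamma> where x: "x = ring_det R i (\<lambda>k l. A (\<gamma> l) (\<rho> k))"
    and "\<rho> ` {..<i} \<subseteq> {..<p}" "\<gamma> ` {..<i} \<subseteq> {..<n}" by (auto simp: minors_def)
  then show "x \<in> carrier R"
    unfolding x using assms by (intro ring_det_closed) (auto simp: image_subset_iff PiE_iff)
qed

text \<open>The index maps are constrained only on \<open>{..<i}\<close>; their restrictions to this
  set are finite in number and give the same minors. Finiteness later permits the choice of a minor
  that divides all others.\<close>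

lemma finite_minors:
  assumes A: "\<forall>j<n. A j \<in> carrier (free_module R p)"
  shows "finite (minors R p n A i)"
proof (rule finite_subset)
  let ?f = "\<lambda>(\<rho>, \<gamma>). ring_det R i (\<lambda>k l. A (\<gamma> l) (\<rho> k))"
  show "minors R p n A i \<subseteq> ?f ` (({..<i} \<rightarrow>\<^sub>E {..<p}) \<times> ({..<i} \<rightarrow>\<^sub>E {..<n}))"
  proof
    fix x assume "x \<in> minors R p n A i"
    then obtain \<rho> \<gamma> where x: "x = ring_det R i (\<lambda>k l. A (\<gamma> l) (\<rho> k))"
      and im: "\<rho> ` {..<i} \<subseteq> {..<p}" "\<gamma> ` {..<i} \<subseteq> {..<n}" by (auto simp: minors_def)
    have "x = ?f (restrict \<rho> {..<i}, restrict \<gamma> {..<i})"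
      unfolding x prod.case using A im by (intro ring_det_cong) (auto simp: PiE_iff image_subset_iff)
    then show "x \<in> ?f ` (({..<i} \<rightarrow>\<^sub>E {..<p}) \<times> ({..<i} \<rightarrow>\<^sub>E {..<n}))"
      using im by (intro image_eqI[of _ _ "(restrict \<rho> {..<i}, restrict \<gamma> {..<i})"]) auto
  qed
qed (auto intro!: finite_PiE)

text \<open>A repeated row or column makes the determinant zero; otherwise sorting the indices
  changes it only by signs. This frees later arguments from increasing index maps.\<close>

lemma arbitrary_minor_mem_ideal:
  assumes A: "\<forall>j<n. A j \<in> carrier (free_module R p)"
    and \<rho>: "\<rho> ` {..<i} \<subseteq> {..<p}" and \<gamma>: "\<gamma> ` {..<i} \<subseteq> {..<n}"
  shows "ring_det R i (\<lambda>k l. A (\<gamma> l) (\<rho> k)) \<in> Idl (minors R p n A i)"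
proof -
  interpret I: ideal "Idl (minors R p n A i)" R by (rule genideal_ideal[OF minors_closed[OF A]])
  have B: "\<forall>k<i. \<forall>l<i. A (\<gamma> l) (\<rho> k) \<in> carrier R"
    using A \<rho> \<gamma> by (auto simp: image_subset_iff PiE_iff)
  show ?thesis
  proof (cases "inj_on \<rho> {..<i} \<and> inj_on \<gamma> {..<i}")
    case True
    obtain \<gamma>' \<pi> where \<gamma>': "strict_mono_on {..<i} \<gamma>'" "\<gamma>' ` {..<i} = \<gamma> ` {..<i}"
      and \<pi>: "\<pi> permutes {..<i}" and \<gamma>\<pi>: "\<And>l. l < i \<Longrightarrow> \<gamma> l = \<gamma>' (\<pi> l)"
      using inj_on_lessThan_sort[of \<gamma> i] True by blast
    obtain \<rho>' \<tau> where \<rho>': "strict_mono_on {..<i} \<rho>'" "\<rho>' ` {..<i} = \<rho> ` {..<i}"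
      and \<tau>: "\<tau> permutes {..<i}" and \<rho>\<tau>: "\<And>l. l < i \<Longrightarrow> \<rho> l = \<rho>' (\<tau> l)"
      using inj_on_lessThan_sort[of \<rho> i] True by blast
    have B': "\<forall>k<i. \<forall>l<i. A (\<gamma>' l) (\<rho>' k) \<in> carrier R"
    proof (intro allI impI)
      fix k l assume kl: "k < i" "l < i"
      then have "\<gamma>' l \<in> \<gamma> ` {..<i}" "\<rho>' k \<in> \<rho> ` {..<i}"
        unfolding \<gamma>'(2)[symmetric] \<rho>'(2)[symmetric] by auto
      then have "\<gamma>' l < n" "\<rho>' k < p" using \<rho> \<gamma> by blast+
      then show "A (\<gamma>' l) (\<rho>' k) \<in> carrier R" using A by (auto simp: PiE_iff)
    qed
    have B'': "\<forall>k<i. \<forall>l<i. A (\<gamma>' (\<pi> l)) (\<rho>' k) \<in> carrier R"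
      using B' permutes_lessThan_lt[OF \<pi>] by blast
    have minor: "ring_det R i (\<lambda>k l. A (\<gamma>' l) (\<rho>' k)) \<in> minors R p n A i"
      unfolding minors_def using \<gamma>' \<rho>' \<rho> \<gamma> by blast
    have "ring_det R i (\<lambda>k l. A (\<gamma> l) (\<rho> k)) =
        ring_det R i (\<lambda>k l. A (\<gamma>' (\<pi> l)) (\<rho>' (\<tau> k)))"
      by (rule ring_det_cong) (use B \<gamma>\<pi> \<rho>\<tau> in auto)
    also have "\<dots> = perm_sign R \<tau> \<otimes> (perm_sign R \<pi> \<otimes> ring_det R i (\<lambda>k l. A (\<gamma>' l) (\<rho>' k)))"
      using ring_det_permute_rows[where B = "\<lambda>k l. A (\<gamma>' (\<pi> l)) (\<rho>' k)", OF B'' \<tau>]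
        ring_det_permute_columns[where B = "\<lambda>k l. A (\<gamma>' l) (\<rho>' k)", OF B' \<pi>] by simp
    also have "\<dots> \<in> Idl (minors R p n A i)"
      using minor genideal_self[OF minors_closed[OF A]]
      by (intro I.I_l_closed) auto
    finally show ?thesis .
  next
    case False
    have "ring_det R i (\<lambda>k l. A (\<gamma> l) (\<rho> k)) = \<zero>"
    proof (cases "inj_on \<gamma> {..<i}")
      case True
      then obtain a b where "a < i" "b < i" "a \<noteq> b" "\<rho> a = \<rho> b"
        using False by (auto simp: inj_on_def)
      then show ?thesis
        using ring_det_equal_rows[where B = "\<lambda>k l. A (\<gamma> l) (\<rho> k)", OF B, of a b] by simp
    next
      case False
      then obtain a b where "a < i" "b < i" "a \<noteq> b" "\<gamma> a = \<gamma> b"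
        by (auto simp: inj_on_def)
      then show ?thesis
        using ring_det_equal_columns[where B = "\<lambda>k l. A (\<gamma> l) (\<rho> k)", OF B, of a b] by simp
    qed
    then show ?thesis by simp
  qed
qed

text \<open>By multilinearity, the columns can be replaced one after the other by members of \<open>A\<close>.\<close>

lemma span_minor_mem_ideal:
  assumes A: "\<forall>j<n. A j \<in> carrier (free_module R p)"
    and \<rho>: "\<rho> ` {..<i} \<subseteq> {..<p}"
    and v: "\<forall>l<i. v l \<in> submodule_gen R (free_module R p) (A ` {..<n})"
  shows "ring_det R i (\<lambda>k l. v l (\<rho> k)) \<in> Idl (minors R p n A i)"
proof -
  interpret I: ideal "Idl (minors R p n A i)" R by (rule genideal_ideal[OF minors_closed[OF A]])
  interpret F: module R "free_module R p" by (rule free_module_module)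
  let ?G = "submodule_gen R (free_module R p) (A ` {..<n})"
  have AF: "A ` {..<n} \<subseteq> carrier (free_module R p)" using A by auto
  have G: "?G \<subseteq> carrier (free_module R p)"
    using F.submodule_gen_submodule[OF AF] F.submoduleE(1) by blast
  have AG: "A ` {..<n} \<subseteq> ?G" by (rule submodule_gen_superset)
  \<comment> \<open>\<open>E\<close> is the transposed determinant: the vectors \<open>v k\<close>
    become rows, to which the linearity rules apply.\<close>
  define E where "E v = ring_det R i (\<lambda>k l. v k (\<rho> l))" for v :: "nat \<Rightarrow> nat \<Rightarrow> 'a"
  have ent: "\<forall>k<i. \<forall>l<i. v k (\<rho> l) \<in> carrier R" if "\<forall>k<i. v k \<in> carrier (free_module R p)" for v
    using that \<rho> by (auto simp: PiE_iff image_subset_iff)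
  have tr: "ring_det R i (\<lambda>k l. v l (\<rho> k)) = E v" if "\<forall>k<i. v k \<in> carrier (free_module R p)" for v
    unfolding E_def using ring_det_transpose[where B = "\<lambda>k l. v k (\<rho> l)", OF ent[OF that]] .
  have upd: "E (v(m := x)) = ring_det R i ((\<lambda>k l. v k (\<rho> l))(m := \<lambda>l. x (\<rho> l)))" for v m x
    unfolding E_def by (rule arg_cong[where f = "ring_det R i"]) auto
  have "E v \<in> Idl (minors R p n A i)"
    if "m \<le> i" "\<forall>l<m. v l \<in> ?G" "\<forall>l. m \<le> l \<and> l < i \<longrightarrow> v l \<in> A ` {..<n}" for m v
    using that
  proof (induction m arbitrary: v)
    case 0
    then have "\<forall>l. \<exists>j. l < i \<longrightarrow> j < n \<and> v l = A j" by auto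
    then obtain \<gamma> where \<gamma>: "\<forall>l<i. \<gamma> l < n \<and> v l = A (\<gamma> l)" by metis
    have vc: "\<forall>k<i. v k \<in> carrier (free_module R p)" using \<gamma> A by simp
    have "E v = ring_det R i (\<lambda>k l. A (\<gamma> l) (\<rho> k))"
      unfolding tr[OF vc, symmetric]
      by (rule ring_det_cong) (use ent[OF vc] \<gamma> in auto)
    then show ?case using arbitrary_minor_mem_ideal[OF A \<rho>, of \<gamma>] \<gamma> by auto
  next
    case (Suc m)
    have m: "m < i" using Suc.prems(1) by simp
    have vc: "\<forall>k<i. v k \<in> carrier (free_module R p)"
    proof (intro allI impI)
      fix k assume "k < i"
      then have "v k \<in> ?G" using Suc.prems(2,3) AG by (cases "k < Suc m") auto
      then show "v k \<in> carrier (free_module R p)" using G by blast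
    qed
    have xc: "\<forall>l<i. x (\<rho> l) \<in> carrier R" if "x \<in> carrier (free_module R p)" for x
      using that \<rho> by (auto simp: PiE_iff image_subset_iff)
    \<comment> \<open>The vectors admissible in position \<open>m\<close> form a submodule. It
      contains every \<open>A j\<close> by the induction hypothesis, hence the whole span.\<close>
    let ?T = "{x \<in> carrier (free_module R p). E (v(m := x)) \<in> Idl (minors R p n A i)}"
    have add: "E (v(m := \<lambda>i\<in>{..<p}. x i \<oplus> y i)) = E (v(m := x)) \<oplus> E (v(m := y))"
      if "x \<in> carrier (free_module R p)" "y \<in> carrier (free_module R p)" for x y
    proof -
      have "E (v(m := \<lambda>i\<in>{..<p}. x i \<oplus> y i)) =
          ring_det R i ((\<lambda>k l. v k (\<rho> l))(m := \<lambda>l. x (\<rho> l) \<oplus> y (\<rho> l)))"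
        unfolding upd using \<rho> ent[OF vc] xc[OF that(1)] xc[OF that(2)]
        by (intro ring_det_cong) (auto simp: image_subset_iff)
      then show ?thesis
        unfolding upd using ring_det_row_add[OF ent[OF vc] xc[OF that(1)] xc[OF that(2)] m] by simp
    qed
    have smult: "E (v(m := \<lambda>i\<in>{..<p}. a \<otimes> x i)) = a \<otimes> E (v(m := x))"
      if "a \<in> carrier R" "x \<in> carrier (free_module R p)" for a x
    proof -
      have "E (v(m := \<lambda>i\<in>{..<p}. a \<otimes> x i)) =
          ring_det R i ((\<lambda>k l. v k (\<rho> l))(m := \<lambda>l. a \<otimes> x (\<rho> l)))"
        unfolding upd using \<rho> ent[OF vc] xc[OF that(2)] that(1)
        by (intro ring_det_cong) (auto simp: image_subset_iff)
      then show ?thesis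
        unfolding upd using ring_det_row_smult[OF ent[OF vc] xc[OF that(2)] that(1) m] by simp
    qed
    have AT: "A ` {..<n} \<subseteq> ?T"
    proof
      fix x assume x: "x \<in> A ` {..<n}"
      have "E (v(m := x)) \<in> Idl (minors R p n A i)"
        by (rule Suc.IH) (use Suc.prems x in \<open>auto simp: not_less_eq_eq\<close>)
      then show "x \<in> ?T" using x AF by auto
    qed
    have T: "submodule ?T R (free_module R p)"
    proof (rule submodule_freeI)
      have "(\<lambda>i\<in>{..<p}. \<zero> \<otimes> (\<lambda>i\<in>{..<p}. \<zero>) i) = (\<lambda>i\<in>{..<p}. \<zero>)"
        by (auto simp: fun_eq_iff)
      moreover have "E (v(m := \<lambda>i\<in>{..<p}. \<zero>)) \<in> carrier R"
        unfolding E_def by (rule ring_det_closed) (use ent[OF vc] \<rho> in \<open>auto simp: image_subset_iff\<close>)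
      ultimately have "E (v(m := \<lambda>i\<in>{..<p}. \<zero>)) = \<zero>"
        using smult[of \<zero> "\<lambda>i\<in>{..<p}. \<zero>"] by simp
      then show "(\<lambda>i\<in>{..<p}. \<zero>) \<in> ?T" by simp
    next
      fix x y assume "x \<in> ?T" "y \<in> ?T"
      then show "(\<lambda>i\<in>{..<p}. x i \<oplus> y i) \<in> ?T" using add[of x y] by auto
    next
      fix a x assume "a \<in> carrier R" "x \<in> ?T"
      then show "(\<lambda>i\<in>{..<p}. a \<otimes> x i) \<in> ?T" using smult[of a x] I.I_l_closed by auto
    qed auto
    have "v m \<in> ?T" using submodule_gen_minimal[OF T AT] Suc.prems(2) by blast
    then show ?case by simp
  qed
  from this[of i v] have "E v \<in> Idl (minors R p n A i)" using v by (meson leD le_refl)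
  moreover have "\<forall>k<i. v k \<in> carrier (free_module R p)" using v G by blast
  ultimately show ?thesis using tr[of v] by simp
qed

text \<open>With fewer than \<open>i\<close> generators there is no strictly increasing choice of
  \<open>i\<close> of them, so the ideal of minors is generated by the empty set.\<close>

lemma span_minor_eq_zero:
  assumes "\<forall>j<n. A j \<in> carrier (free_module R p)" "\<rho> ` {..<i} \<subseteq> {..<p}"
    "\<forall>l<i. v l \<in> submodule_gen R (free_module R p) (A ` {..<n})" "n < i"
  shows "ring_det R i (\<lambda>k l. v l (\<rho> k)) = \<zero>"
proof -
  have "minors R p n A i = {}"
  proof (rule ccontr)
    assume "minors R p n A i \<noteq> {}"
    then obtain \<gamma> :: "nat \<Rightarrow> nat" where "strict_mono_on {..<i} \<gamma>" "\<gamma> ` {..<i} \<subseteq> {..<n}"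
      by (auto simp: minors_def)
    then have "card {..<i} \<le> card {..<n}"
      by (meson card_inj_on_le finite_lessThan strict_mono_on_imp_inj_on)
    then show False using assms(4) by simp
  qed
  moreover have "Idl {} \<subseteq> {\<zero>}" by (rule genideal_minimal) (auto intro: zeroideal)
  ultimately show ?thesis using span_minor_mem_ideal[OF assms(1-3)] by auto
qed

end

section \<open>Determinants and minors under ring homomorphisms\<close>

context ring_hom_cring
begin

lemma hom_ring_det:
  assumes B: "\<forall>k<i. \<forall>l<i. B k l \<in> carrier R"
  shows "h (ring_det R i B) = ring_det S i (\<lambda>k l. h (B k l))"
proof -
  have B': "\<forall>k<i. \<forall>l<i. h (B k l) \<in> carrier S" using B by simp
  have s: "h (perm_sign R \<sigma>) = perm_sign S \<sigma>" for \<sigma> by (simp add: perm_sign_def)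
  have pc: "(\<Otimes>k\<in>{..<i}. B k (\<sigma> k)) \<in> carrier R" if "\<sigma> permutes {..<i}" for \<sigma>
    using R.leibniz_factors_closed[OF B that] by (rule R.finprod_closed)
  have p: "h (\<Otimes>k\<in>{..<i}. B k (\<sigma> k)) = (\<Otimes>\<^bsub>S\<^esub>k\<in>{..<i}. h (B k (\<sigma> k)))"
    if "\<sigma> permutes {..<i}" for \<sigma>
    using hom_finprod[OF R.leibniz_factors_closed[OF B that]] by (simp add: o_def)
  have pc': "(\<Otimes>\<^bsub>S\<^esub>k\<in>{..<i}. h (B k (\<sigma> k))) \<in> carrier S" if "\<sigma> permutes {..<i}" for \<sigma>
    using S.leibniz_factors_closed[OF B' that] by (rule S.finprod_closed)
  have "h (ring_det R i B) =
      (\<Oplus>\<^bsub>S\<^esub>\<sigma>\<in>{\<sigma>. \<sigma> permutes {..<i}}. h (perm_sign R \<sigma> \<otimes>\<^bsub>R\<^esub> (\<Otimes>k\<in>{..<i}. B k (\<sigma> k))))"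
    unfolding R.ring_det_eq[OF B] using pc by (subst hom_finsum) (auto simp: o_def)
  also have "\<dots> = (\<Oplus>\<^bsub>S\<^esub>\<sigma>\<in>{\<sigma>. \<sigma> permutes {..<i}}.
      perm_sign S \<sigma> \<otimes>\<^bsub>S\<^esub> (\<Otimes>\<^bsub>S\<^esub>k\<in>{..<i}. h (B k (\<sigma> k))))"
    using pc pc' p s by (intro S.finsum_cong') auto
  also have "\<dots> = ring_det S i (\<lambda>k l. h (B k l))"
    using S.ring_det_eq[OF B'] by simp
  finally show ?thesis .
qed

lemma image_minors:
  assumes A: "\<forall>j<n. A j \<in> carrier (free_module R p)"
  shows "h ` minors R p n A i = minors S p n (\<lambda>j. \<lambda>k\<in>{..<p}. h (A j k)) i"
proof -
  let ?C = "\<lambda>\<rho> \<gamma>. strict_mono_on {..<i} \<rho> \<and> \<rho> ` {..<i} \<subseteq> {..<p} \<and>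
    strict_mono_on {..<i} \<gamma> \<and> \<gamma> ` {..<i} \<subseteq> {..<n}"
  have eq: "h (ring_det R i (\<lambda>k l. A (\<gamma> l) (\<rho> k))) =
      ring_det S i (\<lambda>k l. (\<lambda>k\<in>{..<p}. h (A (\<gamma> l) k)) (\<rho> k))"
    if "\<rho> ` {..<i} \<subseteq> {..<p}" "\<gamma> ` {..<i} \<subseteq> {..<n}" for \<rho> \<gamma>
  proof -
    have B: "\<forall>k<i. \<forall>l<i. A (\<gamma> l) (\<rho> k) \<in> carrier R"
      using A that by (auto simp: image_subset_iff PiE_iff)
    show ?thesis
      unfolding hom_ring_det[where B = "\<lambda>k l. A (\<gamma> l) (\<rho> k)", OF B]
      by (rule S.ring_det_cong) (use B that in \<open>auto simp: image_subset_iff\<close>)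
  qed
  have "h ` minors R p n A i = {h (ring_det R i (\<lambda>k l. A (\<gamma> l) (\<rho> k))) | \<rho> \<gamma>. ?C \<rho> \<gamma>}"
    unfolding minors_def by blast
  also have "\<dots> = minors S p n (\<lambda>j. \<lambda>k\<in>{..<p}. h (A j k)) i"
    unfolding minors_def
    by (intro Collect_cong ex_cong1 iffI; elim conjE; intro conjI; (assumption | simp only: eq)?)
  finally show ?thesis .
qed

end

section \<open>Localization\<close>

lemma regular_module_simps [simp]:
  "carrier (regular_module R) = carrier R" "\<zero>\<^bsub>regular_module R\<^esub> = \<zero>\<^bsub>R\<^esub>"
  "a \<oplus>\<^bsub>regular_module R\<^esub> b = a \<oplus>\<^bsub>R\<^esub> b" "a \<odot>\<^bsub>regular_module R\<^esub> b = a \<otimes>\<^bsub>R\<^esub> b"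
  by (simp_all add: regular_module_def)

lemma (in cring) regular_module_module: "module R (regular_module R)"
proof (rule moduleI)
  show "abelian_group (regular_module R)"
    by (rule abelian_groupI) (auto simp: a_ac intro: a_inv_closed l_neg)
qed (auto simp: l_distr r_distr m_assoc is_cring)

locale multiplicative_subset = cring +
  fixes S
  assumes S_subset: "S \<subseteq> carrier R" and one_mem: "\<one> \<in> S"
    and mult_mem: "s \<in> S \<Longrightarrow> t \<in> S \<Longrightarrow> s \<otimes> t \<in> S"
begin

lemma S_carrier [simp]: "s \<in> S \<Longrightarrow> s \<in> carrier R"
  using S_subset by blast

end

locale localized_module = multiplicative_subset R S + module R M
  for R (structure) and S and M (structure)
begin

abbreviation "fr \<equiv> fraction S M"

lemma fraction_eq_iff:
  assumes "x \<in> carrier M" "y \<in> carrier M" "s \<in> S" "t \<in> S"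
  shows "fr x s = fr y t \<longleftrightarrow> (\<exists>u\<in>S. u \<odot>\<^bsub>M\<^esub> (t \<odot>\<^bsub>M\<^esub> x) = u \<odot>\<^bsub>M\<^esub> (s \<odot>\<^bsub>M\<^esub> y))"
proof
  assume "fr x s = fr y t"
  moreover have "(y, t) \<in> fr y t" using assms one_mem by (auto simp: fraction_def)
  ultimately have "(y, t) \<in> fr x s" by simp
  then show "\<exists>u\<in>S. u \<odot>\<^bsub>M\<^esub> (t \<odot>\<^bsub>M\<^esub> x) = u \<odot>\<^bsub>M\<^esub> (s \<odot>\<^bsub>M\<^esub> y)"
    by (auto simp: fraction_def)
next
  have sub: "fr x s \<subseteq> fr y t"
    if "x \<in> carrier M" "y \<in> carrier M" "s \<in> S" "t \<in> S"
      and u: "u \<in> S" "u \<odot>\<^bsub>M\<^esub> (t \<odot>\<^bsub>M\<^esub> x) = u \<odot>\<^bsub>M\<^esub> (s \<odot>\<^bsub>M\<^esub> y)" for x y s t u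
  proof
    fix q assume "q \<in> fr x s"
    then obtain z w v where q: "q = (z, w)" "z \<in> carrier M" "w \<in> S" and v: "v \<in> S"
      "v \<odot>\<^bsub>M\<^esub> (w \<odot>\<^bsub>M\<^esub> x) = v \<odot>\<^bsub>M\<^esub> (s \<odot>\<^bsub>M\<^esub> z)" by (auto simp: fraction_def)
    \<comment> \<open>Both \<open>(y, t)\<close> and \<open>(z, w)\<close> are related to
      \<open>(x, s)\<close>. As in the usual proof of transitivity, the new witness is the product
      of the two old ones and the middle denominator \<open>s\<close>.\<close>
    have "(u \<otimes> v \<otimes> s) \<odot>\<^bsub>M\<^esub> (w \<odot>\<^bsub>M\<^esub> y) = (v \<otimes> w) \<odot>\<^bsub>M\<^esub> (u \<odot>\<^bsub>M\<^esub> (s \<odot>\<^bsub>M\<^esub> y))"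
      using that(1-4) u(1) q(2,3) v(1) by (simp add: smult_assoc1[symmetric] m_ac)
    also have "\<dots> = (u \<otimes> t) \<odot>\<^bsub>M\<^esub> (v \<odot>\<^bsub>M\<^esub> (w \<odot>\<^bsub>M\<^esub> x))"
      unfolding u(2)[symmetric] using that(1-4) u(1) q(2,3) v(1) by (simp add: smult_assoc1[symmetric] m_ac)
    also have "\<dots> = (u \<otimes> v \<otimes> s) \<odot>\<^bsub>M\<^esub> (t \<odot>\<^bsub>M\<^esub> z)"
      unfolding v(2) using that(1-4) u(1) q(2,3) v(1) by (simp add: smult_assoc1[symmetric] m_ac)
    finally show "q \<in> fr y t"
      using that q v mult_mem[OF mult_mem[OF u(1) v(1)] that(3)] by (auto simp: fraction_def)
  qed
  assume "\<exists>u\<in>S. u \<odot>\<^bsub>M\<^esub> (t \<odot>\<^bsub>M\<^esub> x) = u \<odot>\<^bsub>M\<^esub> (s \<odot>\<^bsub>M\<^esub> y)"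
  then obtain u where u: "u \<in> S" "u \<odot>\<^bsub>M\<^esub> (t \<odot>\<^bsub>M\<^esub> x) = u \<odot>\<^bsub>M\<^esub> (s \<odot>\<^bsub>M\<^esub> y)" by blast
  show "fr x s = fr y t"
    using sub[OF assms u] sub[OF assms(2,1,4,3) u(1) u(2)[symmetric]] by blast
qed

lemma fraction_cancel:
  assumes "x \<in> carrier M" "s \<in> S" "t \<in> S"
  shows "fr (t \<odot>\<^bsub>M\<^esub> x) (t \<otimes> s) = fr x s"
  using assms one_mem mult_mem by (subst fraction_eq_iff) (auto simp: smult_assoc1[symmetric] m_ac)

lemma mem_fraction_self: "x \<in> carrier M \<Longrightarrow> s \<in> S \<Longrightarrow> (x, s) \<in> fr x s"
  using one_mem by (auto simp: fraction_def)

lemma loc_module_carrier: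
  "carrier (loc_module R S M) = {fr x s | x s. x \<in> carrier M \<and> s \<in> S}"
  by (simp add: loc_module_def)

lemma fraction_closed [simp]: "x \<in> carrier M \<Longrightarrow> s \<in> S \<Longrightarrow> fr x s \<in> carrier (loc_module R S M)"
  by (auto simp: loc_module_carrier)

text \<open>The union defining \<open>add\<close> runs over nonempty classes and its members are all
  equal: the product of the witnesses for two changes of representative is a witness for the
  sums.\<close>

lemma loc_module_add:
  assumes xy: "x \<in> carrier M" "y \<in> carrier M" "s \<in> S" "t \<in> S"
  shows "fr x s \<oplus>\<^bsub>loc_module R S M\<^esub> fr y t = fr (t \<odot>\<^bsub>M\<^esub> x \<oplus>\<^bsub>M\<^esub> s \<odot>\<^bsub>M\<^esub> y) (s \<otimes> t)"
proof -
  have "fr (t' \<odot>\<^bsub>M\<^esub> x' \<oplus>\<^bsub>M\<^esub> s' \<odot>\<^bsub>M\<^esub> y') (s' \<otimes> t') = fr (t \<odot>\<^bsub>M\<^esub> x \<oplus>\<^bsub>M\<^esub> s \<odot>\<^bsub>M\<^esub> y) (s \<otimes> t)"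
    if rep: "(x', s') \<in> fr x s" "(y', t') \<in> fr y t" for x' s' y' t'
  proof -
    obtain u where u: "u \<in> S" "u \<odot>\<^bsub>M\<^esub> (s' \<odot>\<^bsub>M\<^esub> x) = u \<odot>\<^bsub>M\<^esub> (s \<odot>\<^bsub>M\<^esub> x')" "x' \<in> carrier M" "s' \<in> S"
      using rep(1) by (auto simp: fraction_def)
    obtain v where v: "v \<in> S" "v \<odot>\<^bsub>M\<^esub> (t' \<odot>\<^bsub>M\<^esub> y) = v \<odot>\<^bsub>M\<^esub> (t \<odot>\<^bsub>M\<^esub> y')" "y' \<in> carrier M" "t' \<in> S"
      using rep(2) by (auto simp: fraction_def)
    note mem = xy u(1,3,4) v(1,3,4) mult_mem
    have "(u \<otimes> v) \<odot>\<^bsub>M\<^esub> ((s \<otimes> t) \<odot>\<^bsub>M\<^esub> (t' \<odot>\<^bsub>M\<^esub> x' \<oplus>\<^bsub>M\<^esub> s' \<odot>\<^bsub>M\<^esub> y')) =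
        (v \<otimes> t \<otimes> t') \<odot>\<^bsub>M\<^esub> (u \<odot>\<^bsub>M\<^esub> (s \<odot>\<^bsub>M\<^esub> x')) \<oplus>\<^bsub>M\<^esub> (u \<otimes> s \<otimes> s') \<odot>\<^bsub>M\<^esub> (v \<odot>\<^bsub>M\<^esub> (t \<odot>\<^bsub>M\<^esub> y'))"
      using mem by (simp add: smult_assoc1[symmetric] smult_r_distr m_ac)
    also have "\<dots> = (u \<otimes> v) \<odot>\<^bsub>M\<^esub> ((s' \<otimes> t') \<odot>\<^bsub>M\<^esub> (t \<odot>\<^bsub>M\<^esub> x \<oplus>\<^bsub>M\<^esub> s \<odot>\<^bsub>M\<^esub> y))"
      unfolding u(2)[symmetric] v(2)[symmetric]
      using mem by (simp add: smult_assoc1[symmetric] smult_r_distr m_ac)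
    finally show ?thesis
      using mem by (subst fraction_eq_iff) auto
  qed
  then have "\<And>q r. q \<in> fr x s \<Longrightarrow> r \<in> fr y t \<Longrightarrow>
      fr (snd r \<odot>\<^bsub>M\<^esub> fst q \<oplus>\<^bsub>M\<^esub> snd q \<odot>\<^bsub>M\<^esub> fst r) (snd q \<otimes> snd r) =
      fr (t \<odot>\<^bsub>M\<^esub> x \<oplus>\<^bsub>M\<^esub> s \<odot>\<^bsub>M\<^esub> y) (s \<otimes> t)" by simp
  then show ?thesis
    using mem_fraction_self[OF xy(1,3)] mem_fraction_self[OF xy(2,4)]
    by (auto simp: loc_module_def case_prod_beta simp del: prod.sel)
qed

lemma loc_module_smult:
  assumes ax: "a \<in> carrier R" "x \<in> carrier M" "s \<in> S" "t \<in> S"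
  shows "fraction S (regular_module R) a s \<odot>\<^bsub>loc_module R S M\<^esub> fr x t = fr (a \<odot>\<^bsub>M\<^esub> x) (s \<otimes> t)"
proof -
  have "fr (a' \<odot>\<^bsub>M\<^esub> x') (s' \<otimes> t') = fr (a \<odot>\<^bsub>M\<^esub> x) (s \<otimes> t)"
    if rep: "(a', s') \<in> fraction S (regular_module R) a s" "(x', t') \<in> fr x t" for x' s' a' t'
  proof -
    obtain u where u: "u \<in> S" "u \<otimes> (s' \<otimes> a) = u \<otimes> (s \<otimes> a')" "a' \<in> carrier R" "s' \<in> S"
      using rep(1) by (auto simp: fraction_def)
    obtain v where v: "v \<in> S" "v \<odot>\<^bsub>M\<^esub> (t' \<odot>\<^bsub>M\<^esub> x) = v \<odot>\<^bsub>M\<^esub> (t \<odot>\<^bsub>M\<^esub> x')" "x' \<in> carrier M" "t' \<in> S"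
      using rep(2) by (auto simp: fraction_def)
    note mem = ax u(1,3,4) v(1,3,4) mult_mem
    have "(u \<otimes> v) \<odot>\<^bsub>M\<^esub> ((s \<otimes> t) \<odot>\<^bsub>M\<^esub> (a' \<odot>\<^bsub>M\<^esub> x')) =
        (u \<otimes> (s \<otimes> a')) \<odot>\<^bsub>M\<^esub> (v \<odot>\<^bsub>M\<^esub> (t \<odot>\<^bsub>M\<^esub> x'))"
      using mem by (simp add: smult_assoc1[symmetric] m_ac)
    also have "\<dots> = (u \<otimes> v) \<odot>\<^bsub>M\<^esub> ((s' \<otimes> t') \<odot>\<^bsub>M\<^esub> (a \<odot>\<^bsub>M\<^esub> x))"
      unfolding u(2)[symmetric] v(2)[symmetric]
      using mem by (simp add: smult_assoc1[symmetric] m_ac)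
    finally show ?thesis
      using mem by (subst fraction_eq_iff) auto
  qed
  then have eq: "\<And>q r. q \<in> fraction S (regular_module R) a s \<Longrightarrow> r \<in> fr x t \<Longrightarrow>
      fr (fst q \<odot>\<^bsub>M\<^esub> fst r) (snd q \<otimes> snd r) = fr (a \<odot>\<^bsub>M\<^esub> x) (s \<otimes> t)" by simp
  have "(a, s) \<in> fraction S (regular_module R) a s"
    using ax one_mem by (auto simp: fraction_def)
  then show ?thesis
    using mem_fraction_self[OF ax(2,4)] eq
    by (auto simp: loc_module_def case_prod_beta simp del: prod.sel)
qed

text \<open>When a fraction with denominator \<open>t\<close> joins those with common denominator
  \<open>s\<close>, the old numerators are multiplied by \<open>t\<close> and the new one by
  \<open>s\<close>.\<close>

lemma common_denominator:
  assumes "\<And>j. j < n \<Longrightarrow> y j \<in> carrier (loc_module R S M)"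
  obtains s x where "s \<in> S" "\<And>j. j < (n::nat) \<Longrightarrow> x j \<in> carrier M \<and> y j = fr (x j) s"
proof -
  have "\<exists>s\<in>S. \<exists>x. \<forall>j<n. x j \<in> carrier M \<and> y j = fr (x j) s"
    using assms
  proof (induction n)
    case 0
    then show ?case using one_mem by auto
  next
    case (Suc n)
    then obtain s x where s: "s \<in> S" and x: "\<forall>j<n. x j \<in> carrier M \<and> y j = fr (x j) s"
      by auto
    obtain z t where z: "z \<in> carrier M" "t \<in> S" "y n = fr z t"
      using Suc.prems[of n] by (auto simp: loc_module_carrier)
    have "t \<odot>\<^bsub>M\<^esub> x j \<in> carrier M \<and> y j = fr (t \<odot>\<^bsub>M\<^esub> x j) (t \<otimes> s)" if "j < n" for j
      using x that z s fraction_cancel by simp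
    moreover have "y n = fr (s \<odot>\<^bsub>M\<^esub> z) (t \<otimes> s)"
      using z s fraction_cancel[of z t s] by (simp add: m_comm)
    ultimately have "\<forall>j<Suc n. (if j = n then s \<odot>\<^bsub>M\<^esub> z else t \<odot>\<^bsub>M\<^esub> x j) \<in> carrier M \<and>
        y j = fr (if j = n then s \<odot>\<^bsub>M\<^esub> z else t \<odot>\<^bsub>M\<^esub> x j) (t \<otimes> s)"
      using z s by (simp add: less_Suc_eq)
    then show ?case
      using mult_mem[OF z(2) s]
      by (intro bexI[of _ "t \<otimes> s"] exI[of _ "\<lambda>j. if j = n then s \<odot>\<^bsub>M\<^esub> z else t \<odot>\<^bsub>M\<^esub> x j"])
  qed
  then show ?thesis using that by blast
qed

end

section \<open>The localized ring and bases of localized modules\<close>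

context multiplicative_subset
begin

sublocale ring: localized_module R S "regular_module R"
  by (intro localized_module.intro multiplicative_subset_axioms regular_module_module)

lemma loc_ring_simps:
  "carrier (loc_ring R S) = carrier (loc_module R S (regular_module R))"
  "\<one>\<^bsub>loc_ring R S\<^esub> = ring.fr \<one> \<one>"
  "\<zero>\<^bsub>loc_ring R S\<^esub> = ring.fr \<zero> \<one>"
  by (simp_all add: loc_ring_def loc_module_def Let_def)

lemma loc_ring_cases:
  assumes "A \<in> carrier (loc_ring R S)"
  obtains a s where "a \<in> carrier R" "s \<in> S" "A = ring.fr a s"
  using assms by (auto simp: loc_ring_simps ring.loc_module_carrier)

lemma loc_ring_fraction_closed [simp]:
  "a \<in> carrier R \<Longrightarrow> s \<in> S \<Longrightarrow> ring.fr a s \<in> carrier (loc_ring R S)"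
  by (simp add: loc_ring_simps)

lemma loc_ring_fraction_eq_iff:
  "a \<in> carrier R \<Longrightarrow> b \<in> carrier R \<Longrightarrow> s \<in> S \<Longrightarrow> t \<in> S \<Longrightarrow>
    ring.fr a s = ring.fr b t \<longleftrightarrow> (\<exists>u\<in>S. u \<otimes> (t \<otimes> a) = u \<otimes> (s \<otimes> b))"
  using ring.fraction_eq_iff by simp

lemma loc_ring_add:
  "a \<in> carrier R \<Longrightarrow> b \<in> carrier R \<Longrightarrow> s \<in> S \<Longrightarrow> t \<in> S \<Longrightarrow>
    ring.fr a s \<oplus>\<^bsub>loc_ring R S\<^esub> ring.fr b t = ring.fr (t \<otimes> a \<oplus> s \<otimes> b) (s \<otimes> t)"
  using ring.loc_module_add by (simp add: loc_ring_def Let_def)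

lemma loc_ring_mult:
  "a \<in> carrier R \<Longrightarrow> b \<in> carrier R \<Longrightarrow> s \<in> S \<Longrightarrow> t \<in> S \<Longrightarrow>
    ring.fr a s \<otimes>\<^bsub>loc_ring R S\<^esub> ring.fr b t = ring.fr (a \<otimes> b) (s \<otimes> t)"
  using ring.loc_module_smult by (simp add: loc_ring_def Let_def)

lemma loc_ring_fraction_cong:
  "a \<in> carrier R \<Longrightarrow> b \<in> carrier R \<Longrightarrow> s \<in> S \<Longrightarrow> t \<in> S \<Longrightarrow> t \<otimes> a = s \<otimes> b \<Longrightarrow>
    ring.fr a s = ring.fr b t"
  using one_mem by (auto simp: loc_ring_fraction_eq_iff)

lemma loc_ring_cring: "cring (loc_ring R S)"
proof (rule cringI)
  let ?L = "loc_ring R S"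
  note LS = loc_ring_add loc_ring_mult mult_mem one_mem loc_ring_simps(2,3)
  show "abelian_group ?L"
  proof (rule abelian_groupI)
    fix A B assume "A \<in> carrier ?L" "B \<in> carrier ?L"
    then show "A \<oplus>\<^bsub>?L\<^esub> B \<in> carrier ?L"
      by (elim loc_ring_cases) (simp add: LS)
  next
    show "\<zero>\<^bsub>?L\<^esub> \<in> carrier ?L" by (simp add: LS)
  next
    fix A B C assume "A \<in> carrier ?L" "B \<in> carrier ?L" "C \<in> carrier ?L"
    then show "A \<oplus>\<^bsub>?L\<^esub> B \<oplus>\<^bsub>?L\<^esub> C = A \<oplus>\<^bsub>?L\<^esub> (B \<oplus>\<^bsub>?L\<^esub> C)"
      by (elim loc_ring_cases) (simp add: LS l_distr r_distr m_ac a_ac)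
  next
    fix A B assume "A \<in> carrier ?L" "B \<in> carrier ?L"
    then show "A \<oplus>\<^bsub>?L\<^esub> B = B \<oplus>\<^bsub>?L\<^esub> A"
      by (elim loc_ring_cases) (simp add: LS m_comm a_comm)
  next
    fix A assume "A \<in> carrier ?L"
    then obtain a s where A: "a \<in> carrier R" "s \<in> S" "A = ring.fr a s" by (rule loc_ring_cases)
    then show "\<zero>\<^bsub>?L\<^esub> \<oplus>\<^bsub>?L\<^esub> A = A" by (simp add: LS)
    have "ring.fr (\<ominus> a) s \<oplus>\<^bsub>?L\<^esub> A = ring.fr \<zero> (s \<otimes> s)"
      using A by (simp add: LS r_minus l_neg)
    also have "\<dots> = \<zero>\<^bsub>?L\<^esub>"
      unfolding loc_ring_simps by (rule loc_ring_fraction_cong) (use A LS in auto)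
    finally show "\<exists>B\<in>carrier ?L. B \<oplus>\<^bsub>?L\<^esub> A = \<zero>\<^bsub>?L\<^esub>"
      using A by (intro bexI[of _ "ring.fr (\<ominus> a) s"]) auto
  qed
  show "comm_monoid ?L"
  proof (rule comm_monoidI)
    fix A B assume "A \<in> carrier ?L" "B \<in> carrier ?L"
    then show "A \<otimes>\<^bsub>?L\<^esub> B \<in> carrier ?L" "A \<otimes>\<^bsub>?L\<^esub> B = B \<otimes>\<^bsub>?L\<^esub> A"
      by (elim loc_ring_cases, simp add: LS m_comm)+
  next
    show "\<one>\<^bsub>?L\<^esub> \<in> carrier ?L" by (simp add: LS)
  next
    fix A B C assume "A \<in> carrier ?L" "B \<in> carrier ?L" "C \<in> carrier ?L"
    then show "A \<otimes>\<^bsub>?L\<^esub> B \<otimes>\<^bsub>?L\<^esub> C = A \<otimes>\<^bsub>?L\<^esub> (B \<otimes>\<^bsub>?L\<^esub> C)"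
      by (elim loc_ring_cases) (simp add: LS m_assoc)
  next
    fix A assume "A \<in> carrier ?L"
    then show "\<one>\<^bsub>?L\<^esub> \<otimes>\<^bsub>?L\<^esub> A = A"
      by (elim loc_ring_cases) (simp add: LS)
  qed
  fix A B C assume "A \<in> carrier ?L" "B \<in> carrier ?L" "C \<in> carrier ?L"
  then obtain a s b t c v where *: "a \<in> carrier R" "s \<in> S" "A = ring.fr a s"
    "b \<in> carrier R" "t \<in> S" "B = ring.fr b t" "c \<in> carrier R" "v \<in> S" "C = ring.fr c v"
    by (metis loc_ring_cases)
  then show "(A \<oplus>\<^bsub>?L\<^esub> B) \<otimes>\<^bsub>?L\<^esub> C = A \<otimes>\<^bsub>?L\<^esub> C \<oplus>\<^bsub>?L\<^esub> B \<otimes>\<^bsub>?L\<^esub> C"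
    by (simp add: LS, intro loc_ring_fraction_cong) (auto simp: LS l_distr r_distr m_ac)
qed

lemma loc_map_hom: "loc_map R S \<in> ring_hom R (loc_ring R S)"
  unfolding loc_map_def
  by (rule ring_hom_memI) (simp_all add: loc_ring_add loc_ring_mult loc_ring_simps(2) one_mem)

text \<open>The \<open>g j\<close> become a basis over \<open>S\<^sup>-\<^sup>1R\<close>; clearing denominators expresses this inside
  \<open>M\<close> itself.\<close>

lemma localized_basis:
  assumes M: "module R M"
    and iso: "module_isomorphic (loc_ring R S) (loc_module R S M) (free_module (loc_ring R S) e)"
  obtains g where "\<forall>j<e. g j \<in> carrier M"
    and "\<forall>x\<in>carrier M. \<exists>t\<in>S. \<exists>a. (\<forall>j<e. a j \<in> carrier R) \<and>
      t \<odot>\<^bsub>M\<^esub> x = (\<Oplus>\<^bsub>M\<^esub>j\<in>{..<e}. a j \<odot>\<^bsub>M\<^esub> g j)"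
    and "\<forall>a. (\<forall>j<e. a j \<in> carrier R) \<longrightarrow> (\<Oplus>\<^bsub>M\<^esub>j\<in>{..<e}. a j \<odot>\<^bsub>M\<^esub> g j) = \<zero>\<^bsub>M\<^esub> \<longrightarrow>
      (\<forall>j<e. \<exists>u\<in>S. u \<otimes> a j = \<zero>)"
proof -
  interpret M: localized_module R S M
    by (intro localized_module.intro multiplicative_subset_axioms M)
  let ?L = "loc_ring R S" and ?N = "loc_module R S M"
  interpret L: cring ?L by (rule loc_ring_cring)
  interpret lm: ring_hom_cring R ?L "loc_map R S"
    by (intro ring_hom_cring.intro is_cring L.is_cring ring_hom_cring_axioms.intro loc_map_hom)
  let ?F = "free_module ?L e"
  obtain f where f: "f \<in> iso (add_monoid ?N) (add_monoid ?F)"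
    and flin: "\<And>a x. a \<in> carrier ?L \<Longrightarrow> x \<in> carrier ?N \<Longrightarrow> f (a \<odot>\<^bsub>?N\<^esub> x) = a \<odot>\<^bsub>?F\<^esub> f x"
    using iso unfolding module_isomorphic_def by blast
  have bij: "bij_betw f (carrier ?N) (carrier ?F)" using f by (simp add: iso_def)
  have fc: "f x \<in> carrier ?F" if "x \<in> carrier ?N" for x by (rule bij_betw_apply[OF bij that])
  have fadd: "f (x \<oplus>\<^bsub>?N\<^esub> y) = f x \<oplus>\<^bsub>?F\<^esub> f y" if "x \<in> carrier ?N" "y \<in> carrier ?N" for x y
    using f that by (simp add: iso_def hom_def)
  define \<epsilon> where "\<epsilon> j = (\<lambda>i\<in>{..<e}. if i = j then \<one>\<^bsub>?L\<^esub> else \<zero>\<^bsub>?L\<^esub>)" for j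
  \<comment> \<open>\<open>y j\<close> is the preimage of the \<open>j\<close>-th unit vector; the
    vectors \<open>g j\<close> below are the numerators of the \<open>y j\<close> over a common
    denominator \<open>s\<close>.\<close>
  define y where "y j = inv_into (carrier ?N) f (\<epsilon> j)" for j
  have "\<epsilon> j \<in> f ` carrier ?N" for j using bij by (auto simp: bij_betw_def \<epsilon>_def)
  then have y: "y j \<in> carrier ?N" "f (y j) = \<epsilon> j" for j
    by (auto simp: y_def intro: inv_into_into f_inv_into_f)
  obtain s g where s: "s \<in> S" and g: "\<And>j. j < e \<Longrightarrow> g j \<in> carrier M \<and> y j = M.fr (g j) s"
    using M.common_denominator[of e y] y(1) by blast
  have fadd1: "f (M.fr (x \<oplus>\<^bsub>M\<^esub> x') \<one>) = f (M.fr x \<one>) \<oplus>\<^bsub>?F\<^esub> f (M.fr x' \<one>)"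
    if "x \<in> carrier M" "x' \<in> carrier M" for x x'
    using fadd[of "M.fr x \<one>" "M.fr x' \<one>"] M.loc_module_add[of x x' \<one> \<one>] that one_mem by simp
  have flin1: "f (M.fr (a \<odot>\<^bsub>M\<^esub> x) \<one>) = loc_map R S a \<odot>\<^bsub>?F\<^esub> f (M.fr x \<one>)"
    if "a \<in> carrier R" "x \<in> carrier M" for a x
    using flin[of "loc_map R S a" "M.fr x \<one>"] M.loc_module_smult[of a x \<one> \<one>] that one_mem
    by (simp add: loc_map_def)
  have fg: "f (M.fr (g j) \<one>) = loc_map R S s \<odot>\<^bsub>?F\<^esub> \<epsilon> j" if j: "j < e" for j
  proof -
    have "loc_map R S s \<odot>\<^bsub>?N\<^esub> y j = M.fr (g j) \<one>"
      using g[OF j] s one_mem M.loc_module_smult[of s "g j" \<one> s] M.fraction_cancel[of "g j" \<one> s]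
      by (simp add: loc_map_def)
    then show ?thesis using flin[OF _ y(1)[of j], of "loc_map R S s"] y(2)[of j] s by simp
  qed
  \<comment> \<open>As a fraction over \<open>\<one>\<close>, the vector \<open>g j\<close> is
    \<open>s\<close> times \<open>y j\<close>, which accounts for the factor \<open>s\<close> in
    each coordinate. The sum is cut off at \<open>n\<close> for the induction; afterwards
    \<open>n\<close> is \<open>e\<close>.\<close>
  have comb: "(\<Oplus>\<^bsub>M\<^esub>j\<in>{..<n}. a j \<odot>\<^bsub>M\<^esub> g j) \<in> carrier M \<and>
      f (M.fr (\<Oplus>\<^bsub>M\<^esub>j\<in>{..<n}. a j \<odot>\<^bsub>M\<^esub> g j) \<one>) =
      (\<lambda>i\<in>{..<e}. if i < n then loc_map R S (a i \<otimes> s) else \<zero>\<^bsub>?L\<^esub>)"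
    if "n \<le> e" and a: "\<forall>j<e. a j \<in> carrier R" for n a
    using that(1)
  proof (induction n)
    case 0
    have z: "M.fr \<zero>\<^bsub>M\<^esub> \<one> \<in> carrier ?N" using one_mem by simp
    have "f (M.fr \<zero>\<^bsub>M\<^esub> \<one>) = loc_map R S \<zero> \<odot>\<^bsub>?F\<^esub> f (M.fr \<zero>\<^bsub>M\<^esub> \<one>)"
      using flin1[of \<zero> "\<zero>\<^bsub>M\<^esub>"] by simp
    also have "\<dots> = (\<lambda>i\<in>{..<e}. \<zero>\<^bsub>?L\<^esub>)"
      using fc[OF z] by (intro ext) (simp add: PiE_iff)
    finally show ?case by simp
  next
    case (Suc n)
    then have n: "n < e" "g n \<in> carrier M" "a n \<in> carrier R" using g a by auto
    let ?x = "\<Oplus>\<^bsub>M\<^esub>j\<in>{..<n}. a j \<odot>\<^bsub>M\<^esub> g j"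
    have IH: "?x \<in> carrier M"
      "f (M.fr ?x \<one>) = (\<lambda>i\<in>{..<e}. if i < n then loc_map R S (a i \<otimes> s) else \<zero>\<^bsub>?L\<^esub>)"
      using Suc by auto
    have "(\<Oplus>\<^bsub>M\<^esub>j\<in>{..<Suc n}. a j \<odot>\<^bsub>M\<^esub> g j) = a n \<odot>\<^bsub>M\<^esub> g n \<oplus>\<^bsub>M\<^esub> ?x"
      unfolding lessThan_Suc using n g a by (intro M.finsum_insert) auto
    moreover have "f (M.fr (a n \<odot>\<^bsub>M\<^esub> g n \<oplus>\<^bsub>M\<^esub> ?x) \<one>) =
        (\<lambda>i\<in>{..<e}. if i < Suc n then loc_map R S (a i \<otimes> s) else \<zero>\<^bsub>?L\<^esub>)"
      using n IH s a
      by (simp add: fadd1 flin1 fg[OF n(1)] \<epsilon>_def fun_eq_iff less_Suc_eq)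
    ultimately show ?case using n IH(1) by simp
  qed
  note comb = comb[OF le_refl]
  have span: "\<exists>t\<in>S. \<exists>a. (\<forall>j<e. a j \<in> carrier R) \<and>
      t \<odot>\<^bsub>M\<^esub> x = (\<Oplus>\<^bsub>M\<^esub>j\<in>{..<e}. a j \<odot>\<^bsub>M\<^esub> g j)" if x: "x \<in> carrier M" for x
  proof -
    have v: "f (M.fr x \<one>) \<in> carrier ?F" using x one_mem by (intro fc) simp
    then have "\<And>j. j < e \<Longrightarrow> f (M.fr x \<one>) j \<in> carrier (loc_module R S (regular_module R))"
      by (auto simp: loc_ring_simps(1) PiE_iff)
    with ring.common_denominator[of e "f (M.fr x \<one>)"]
    obtain t b where t: "t \<in> S"
      and b: "\<And>j. j < e \<Longrightarrow> b j \<in> carrier R \<and> f (M.fr x \<one>) j = ring.fr (b j) t"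
      by (metis regular_module_simps(1))
    have bR: "\<forall>j<e. b j \<in> carrier R" using b by simp
    let ?y = "\<Oplus>\<^bsub>M\<^esub>j\<in>{..<e}. b j \<odot>\<^bsub>M\<^esub> g j"
    have tsx: "(t \<otimes> s) \<odot>\<^bsub>M\<^esub> x \<in> carrier M" using x t s by simp
    \<comment> \<open>The multiplier \<open>t\<close> clears the denominators of the coordinates of
      \<open>x\<close>, and \<open>s\<close> matches the factor attached to the
      \<open>g j\<close>.\<close>
    have "f (M.fr ((t \<otimes> s) \<odot>\<^bsub>M\<^esub> x) \<one>) = loc_map R S (t \<otimes> s) \<odot>\<^bsub>?F\<^esub> f (M.fr x \<one>)"
      using x t s by (intro flin1) auto
    also have "\<dots> = (\<lambda>i\<in>{..<e}. if i < e then loc_map R S (b i \<otimes> s) else \<zero>\<^bsub>?L\<^esub>)"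
    proof -
      have "loc_map R S (t \<otimes> s) \<otimes>\<^bsub>?L\<^esub> ring.fr (b i) t = loc_map R S (b i \<otimes> s)" if "i < e" for i
      proof -
        have bi: "b i \<in> carrier R" using b that by blast
        show ?thesis
          unfolding loc_map_def using bi t s one_mem mult_mem
          by (simp add: loc_ring_mult, intro loc_ring_fraction_cong) (auto simp: m_ac)
      qed
      then show ?thesis using b by (auto simp: fun_eq_iff)
    qed
    also have "\<dots> = f (M.fr ?y \<one>)" using comb[OF bR] by simp
    finally have "M.fr ((t \<otimes> s) \<odot>\<^bsub>M\<^esub> x) \<one> = M.fr ?y \<one>"
      using tsx comb[OF bR] one_mem
      by (intro inj_onD[OF bij_betw_imp_inj_on[OF bij]] M.fraction_closed conjunct1[OF comb[OF bR]])
    then obtain u where u: "u \<in> S" "u \<odot>\<^bsub>M\<^esub> (\<one> \<odot>\<^bsub>M\<^esub> ((t \<otimes> s) \<odot>\<^bsub>M\<^esub> x)) = u \<odot>\<^bsub>M\<^esub> (\<one> \<odot>\<^bsub>M\<^esub> ?y)"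
      using M.fraction_eq_iff[OF tsx _ one_mem one_mem] comb[OF bR] by blast
    have "(u \<otimes> (t \<otimes> s)) \<odot>\<^bsub>M\<^esub> x = u \<odot>\<^bsub>M\<^esub> ?y"
      using u x t s tsx comb[OF bR] by (simp add: M.smult_assoc1)
    also have "\<dots> = (\<Oplus>\<^bsub>M\<^esub>j\<in>{..<e}. u \<odot>\<^bsub>M\<^esub> (b j \<odot>\<^bsub>M\<^esub> g j))"
      using u(1) bR g by (intro M.finsum_smult_ldistr) auto
    also have "\<dots> = (\<Oplus>\<^bsub>M\<^esub>j\<in>{..<e}. (u \<otimes> b j) \<odot>\<^bsub>M\<^esub> g j)"
      using u(1) bR g by (intro M.finsum_cong') (auto simp: M.smult_assoc1)
    finally show ?thesis
      using u(1) t s bR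
      by (intro bexI[of _ "u \<otimes> (t \<otimes> s)"] exI[of _ "\<lambda>j. u \<otimes> b j"]) (auto intro: mult_mem)
  qed
  have indep: "\<exists>u\<in>S. u \<otimes> a j = \<zero>"
    if a: "\<forall>j<e. a j \<in> carrier R" and 0: "(\<Oplus>\<^bsub>M\<^esub>j\<in>{..<e}. a j \<odot>\<^bsub>M\<^esub> g j) = \<zero>\<^bsub>M\<^esub>"
      and j: "j < e" for a j
  proof -
    \<comment> \<open>The given combination and the one with zero coefficients are the same element
      of \<open>M\<close>. Comparing the \<open>j\<close>-th coordinates of their images under
      \<open>f\<close> shows that \<open>a j \<otimes> s\<close> becomes zero in the localized
      ring.\<close>
    have z: "\<forall>j<e. \<zero> \<in> carrier R" by simp
    have "(\<Oplus>\<^bsub>M\<^esub>j\<in>{..<e}. \<zero> \<odot>\<^bsub>M\<^esub> g j) = \<zero>\<^bsub>M\<^esub>"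
      using g by (intro M.add.finprod_one_eqI) auto
    then have "(\<lambda>i\<in>{..<e}. if i < e then loc_map R S (a i \<otimes> s) else \<zero>\<^bsub>?L\<^esub>) =
        (\<lambda>i\<in>{..<e}. if i < e then loc_map R S (\<zero> \<otimes> s) else \<zero>\<^bsub>?L\<^esub>)"
      using comb[OF a] comb[OF z] 0 by metis
    from fun_cong[OF this, of j] have "ring.fr (a j \<otimes> s) \<one> = ring.fr \<zero> \<one>"
      using j s by (simp add: loc_map_def)
    then obtain u where "u \<in> S" "u \<otimes> (\<one> \<otimes> (a j \<otimes> s)) = u \<otimes> (\<one> \<otimes> \<zero>)"
      using a j s one_mem by (subst (asm) loc_ring_fraction_eq_iff) auto
    then have "(u \<otimes> s) \<otimes> a j = \<zero>" using a j s by (simp add: m_ac)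
    then show ?thesis using mult_mem[OF \<open>u \<in> S\<close> s] by blast
  qed
  show ?thesis
    by (rule that[of g]) (use g span indep in auto)
qed

end

section \<open>Localization at a prime and its residue field\<close>

lemma (in primeideal) complement_multiplicative_subset: "multiplicative_subset R (carrier R - I)"
proof
  show "\<one> \<in> carrier R - I"
    using I_notcarr one_imp_carrier by auto
  show "s \<otimes> t \<in> carrier R - I" if "s \<in> carrier R - I" "t \<in> carrier R - I" for s t
    using I_prime that by auto
qed auto

context primeideal
begin

lemma extended_prime_ideal: "ideal (extended_prime R I) (loc_ring R (carrier R - I))"
proof -
  interpret multiplicative_subset R "carrier R - I" by (rule complement_multiplicative_subset)
  interpret L: cring "loc_ring R (carrier R - I)" by (rule loc_ring_cring)
  show ?thesis
    unfolding extended_prime_def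
    using ring_hom_closed[OF loc_map_hom] a_subset by (intro L.genideal_ideal) auto
qed

lemma residue_field_cring: "cring (residue_field R I)"
proof -
  interpret multiplicative_subset R "carrier R - I" by (rule complement_multiplicative_subset)
  show ?thesis
    unfolding residue_field_def
    by (rule ideal.quotient_is_cring[OF extended_prime_ideal loc_ring_cring])
qed

lemma residue_map_hom: "residue_map R I \<in> ring_hom R (residue_field R I)"
proof -
  interpret multiplicative_subset R "carrier R - I" by (rule complement_multiplicative_subset)
  show ?thesis
    using ring_hom_trans[OF loc_map_hom ideal.rcos_ring_hom[OF extended_prime_ideal]]
    unfolding residue_field_def by (simp add: residue_map_def[abs_def] o_def)
qed

text \<open>An element \<open>t\<close> outside the prime has the inverse \<open>1/t\<close> in the
  localization, so its image divides one. Nontriviality of the target will come from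
  \<open>V\<close>, a domain with the same zero and one.\<close>

lemma residue_map_nonzero:
  assumes t: "t \<in> carrier R" "t \<notin> I" and 1: "\<one>\<^bsub>residue_field R I\<^esub> \<noteq> \<zero>\<^bsub>residue_field R I\<^esub>"
  shows "residue_map R I t \<noteq> \<zero>\<^bsub>residue_field R I\<^esub>"
proof
  assume 0: "residue_map R I t = \<zero>\<^bsub>residue_field R I\<^esub>"
  interpret multiplicative_subset R "carrier R - I" by (rule complement_multiplicative_subset)
  interpret \<kappa>: cring "residue_field R I" by (rule residue_field_cring)
  let ?q = "\<lambda>x. extended_prime R I +>\<^bsub>loc_ring R (carrier R - I)\<^esub> x"
  have q: "?q \<in> ring_hom (loc_ring R (carrier R - I)) (residue_field R I)"
    unfolding residue_field_def by (rule ideal.rcos_ring_hom[OF extended_prime_ideal])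
  have tS: "t \<in> carrier R - I" using t by simp
  have *: "loc_map R (carrier R - I) t \<otimes>\<^bsub>loc_ring R (carrier R - I)\<^esub> ring.fr \<one> t =
      \<one>\<^bsub>loc_ring R (carrier R - I)\<^esub>"
    unfolding loc_map_def loc_ring_simps using t tS one_mem
    by (simp add: loc_ring_mult, intro loc_ring_fraction_cong) auto
  have "\<one>\<^bsub>residue_field R I\<^esub> = ?q (loc_map R (carrier R - I) t \<otimes>\<^bsub>loc_ring R (carrier R - I)\<^esub> ring.fr \<one> t)"
    unfolding * using ring_hom_one[OF q] by simp
  also have "\<dots> = residue_map R I t \<otimes>\<^bsub>residue_field R I\<^esub> ?q (ring.fr \<one> t)"
    unfolding residue_map_def using t tS
    by (intro ring_hom_mult[OF q] ring_hom_closed[OF loc_map_hom]) auto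
  also have "\<dots> = \<zero>\<^bsub>residue_field R I\<^esub>"
    unfolding 0 using tS by (intro \<kappa>.l_null ring_hom_closed[OF q]) auto
  finally show False using 1 by simp
qed

end

section \<open>Associated primes and valuation rings\<close>

lemma (in cring) annihilator_ideal:
  assumes x: "x \<in> carrier R" shows "ideal {a \<in> carrier R. a \<otimes> x = \<zero>} R"
proof (rule idealI)
  show "ring R" by (rule ring_axioms)
  show "subgroup {a \<in> carrier R. a \<otimes> x = \<zero>} (add_monoid R)"
    using x by (intro add.subgroupI) (auto simp: l_distr l_minus intro: zero_closed)
  fix a b assume a: "a \<in> {a \<in> carrier R. a \<otimes> x = \<zero>}" and b: "b \<in> carrier R"
  then show "b \<otimes> a \<in> {a \<in> carrier R. a \<otimes> x = \<zero>}" using x by (auto simp: m_assoc)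
  then show "a \<otimes> b \<in> {a \<in> carrier R. a \<otimes> x = \<zero>}" using a b by (simp add: m_comm)
qed

text \<open>An annihilator that is maximal among those contained in the minimal prime \<open>P\<close> is prime.\<close>

lemma minimal_prime_associated:
  fixes R (structure)
  assumes "cring R" and "noetherian_ring R" and P: "minimal_prime R P"
  shows "associated_prime R P"
proof -
  interpret cring R by fact
  interpret noetherian_ring R by fact
  interpret P: primeideal P R using P by (simp add: minimal_prime_def)
  define ann where "ann x = {a \<in> carrier R. a \<otimes> x = \<zero>}" for x
  have ann: "ideal (ann x) R" if "x \<in> carrier R" for x
    unfolding ann_def by (rule annihilator_ideal[OF that])
  have ann_mult: "ann x \<subseteq> ann (s \<otimes> x)" if "s \<in> carrier R" "x \<in> carrier R" for s x
  proof
    fix c assume "c \<in> ann x"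
    then have c: "c \<in> carrier R" "c \<otimes> x = \<zero>" by (simp_all add: ann_def)
    then have "c \<otimes> (s \<otimes> x) = \<zero>" using m_lcomm[OF c(1) that] that by simp
    then show "c \<in> ann (s \<otimes> x)" using c by (simp add: ann_def)
  qed
  have 1: "\<one> \<notin> P" using P.I_notcarr P.one_imp_carrier by auto
  let ?F = "{ann x | x. x \<in> carrier R \<and> ann x \<subseteq> P}"
  have "\<exists>M\<in>?F. \<forall>J\<in>?F. M \<subseteq> J \<longrightarrow> J = M"
  proof (rule subset_Zorn_nonempty)
    have "ann \<one> \<subseteq> P" by (auto simp: ann_def)
    then show "?F \<noteq> {}" by blast
    fix C assume C: "C \<noteq> {}" "subset.chain ?F C"
    have "subset.chain {I. ideal I R} C"
      using C(2) ann by (auto simp: subset.chain_def subset_chain_def)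
    \<comment> \<open>The Noetherian property: a nonempty chain of ideals contains its
      union.\<close>
    then have "\<Union>C \<in> C" by (rule ideal_chain_is_trivial[OF C(1)])
    then show "\<Union>C \<in> ?F" using C(2) by (auto simp: subset_chain_def)
  qed
  then obtain J where J: "J \<in> ?F" and J_max: "\<forall>K\<in>?F. J \<subseteq> K \<longrightarrow> K = J" by (rule bexE)
  from J obtain x where x: "x \<in> carrier R" "ann x \<subseteq> P" and Jx: "J = ann x" by blast
  have max: "ann y = ann x" if "y \<in> carrier R" "ann y \<subseteq> P" "ann x \<subseteq> ann y" for y
    using bspec[OF J_max, of "ann y"] that unfolding Jx by blast
  have "primeideal (ann x) R"
  proof (rule primeidealI[OF ann[OF x(1)] is_cring])
    show "carrier R \<noteq> ann x" using x(2) 1 by auto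
    fix a b assume ab: "a \<in> carrier R" "b \<in> carrier R" "a \<otimes> b \<in> ann x"
    show "a \<in> ann x \<or> b \<in> ann x"
    proof (cases "ann (a \<otimes> x) \<subseteq> P")
      case True
      have "ann x \<subseteq> ann (a \<otimes> x)" using ann_mult[OF ab(1) x(1)] .
      then have "ann (a \<otimes> x) = ann x" using max[of "a \<otimes> x"] True ab x by simp
      moreover have "b \<in> ann (a \<otimes> x)" using ab x by (auto simp: ann_def m_ac)
      ultimately show ?thesis by simp
    next
      case False
      then obtain s where s: "s \<in> carrier R" "s \<otimes> (a \<otimes> x) = \<zero>" "s \<notin> P" by (auto simp: ann_def)
      \<comment> \<open>Here \<open>s\<close> kills \<open>a \<otimes> x\<close> and lies outside
        \<open>P\<close>. Passing from \<open>x\<close> to \<open>s \<otimes> x\<close> therefore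
        keeps the annihilator inside \<open>P\<close>; by maximality it equals \<open>ann x\<close>,
        and it contains \<open>a\<close>.\<close>
      have "ann (s \<otimes> x) \<subseteq> P"
      proof
        fix t assume "t \<in> ann (s \<otimes> x)"
        then have t: "t \<in> carrier R" "t \<otimes> s \<in> ann x" using s x by (auto simp: ann_def m_assoc)
        then show "t \<in> P" using x(2) P.I_prime[of t s] s by auto
      qed
      moreover have "ann x \<subseteq> ann (s \<otimes> x)" using ann_mult[OF s(1) x(1)] .
      ultimately have "ann (s \<otimes> x) = ann x" using max[of "s \<otimes> x"] s x by simp
      moreover have "a \<in> ann (s \<otimes> x)" using ab s x by (auto simp: ann_def m_lcomm)
      ultimately show ?thesis by simp
    qed
  qed
  then have "ann x = P" using P x(2) by (auto simp: minimal_prime_def)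
  then show ?thesis
    using x(1) P.primeideal_axioms by (auto simp: associated_prime_def ann_def)
qed

text \<open>\<open>V\<close> is given as a principal ideal domain with one nonzero prime
  \<open>Q\<close>, so total divisibility has to be derived. For nonzero \<open>a\<close> and
  \<open>b\<close> write \<open>a = a' g\<close> and \<open>b = b' g\<close> with \<open>g\<close> a
  generator of the ideal \<open>(a, b)\<close>; then \<open>a'\<close> and \<open>b'\<close>
  generate the unit ideal. As nonzero nonunits lie in \<open>Q\<close>, one of \<open>a'\<close> and
  \<open>b'\<close> is a unit.\<close>

lemma discrete_valuation_ring_divides:
  fixes V (structure)
  assumes V: "discrete_valuation_ring V" and ab: "a \<in> carrier V" "b \<in> carrier V"
  shows "a divides b \<or> b divides a"
proof -
  interpret principal_domain V using V by (simp add: discrete_valuation_ring_def)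
  obtain Q where Q: "\<And>I. primeideal I V \<Longrightarrow> I \<noteq> {\<zero>} \<Longrightarrow> I = Q"
    using V unfolding discrete_valuation_ring_def by blast
  obtain g where g: "g \<in> carrier V" "PIdl a <+> PIdl b = PIdl g"
    using exists_gen[OF add_ideals[OF cgenideal_ideal[OF ab(1)] cgenideal_ideal[OF ab(2)]]] by blast
  have "a \<oplus> \<zero> \<in> PIdl a <+> PIdl b"
    unfolding set_add_def' using cgenideal_self[OF ab(1)]
      additive_subgroup.zero_closed[OF ideal.axioms(1)[OF cgenideal_ideal[OF ab(2)]]] by blast
  then have "a \<in> PIdl a <+> PIdl b" using ab by simp
  then obtain a' where a': "a' \<in> carrier V" "a = a' \<otimes> g" unfolding g by (auto simp: cgenideal_def)
  have "\<zero> \<oplus> b \<in> PIdl a <+> PIdl b"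
    unfolding set_add_def' using cgenideal_self[OF ab(2)]
      additive_subgroup.zero_closed[OF ideal.axioms(1)[OF cgenideal_ideal[OF ab(1)]]] by blast
  then have "b \<in> PIdl a <+> PIdl b" using ab by simp
  then obtain b' where b': "b' \<in> carrier V" "b = b' \<otimes> g" unfolding g by (auto simp: cgenideal_def)
  have "g \<in> PIdl a <+> PIdl b" using cgenideal_self[OF g(1)] g(2) by simp
  then obtain x y where xy: "x \<in> carrier V" "y \<in> carrier V" "g = x \<otimes> a \<oplus> y \<otimes> b"
    unfolding set_add_def' cgenideal_def by auto
  have unit: "c \<otimes> g divides d \<otimes> g" if "c \<in> Units V" "d \<in> carrier V" for c d
  proof (rule dividesI)
    show "inv c \<otimes> d \<in> carrier V" using that by simp
    have "c \<otimes> g \<otimes> (inv c \<otimes> d) = (c \<otimes> inv c) \<otimes> (d \<otimes> g)"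
      using that g Units_closed[of c] Units_inv_closed[of c] by (simp add: m_ac del: Units_r_inv)
    then show "d \<otimes> g = c \<otimes> g \<otimes> (inv c \<otimes> d)" using that g by simp
  qed
  \<comment> \<open>A nonzero nonunit has an irreducible divisor, which generates a nonzero prime
    ideal, and that ideal can only be \<open>Q\<close>.\<close>
  have in_Q: "c \<in> Q" "primeideal Q V" if "c \<in> carrier V" "c \<noteq> \<zero>" "c \<notin> Units V" for c
  proof -
    have "c \<in> carrier V - {\<zero>}" using that by simp
    then obtain q where q: "q \<in> carrier V" "ring_irreducible q" "q divides c"
      using exists_irreducible_divisor \<open>c \<notin> Units V\<close> by metis
    have prime: "primeideal (PIdl q) V"
      by (rule maximalideal_prime[OF irreducible_imp_maximalideal[OF q(1,2)]])
    have "q \<noteq> \<zero>" using q(2) by (simp add: ring_irreducible_def)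
    then have "PIdl q = Q" using Q[OF prime] cgenideal_self[OF q(1)] by auto
    moreover have "c \<in> PIdl q" using q by (auto simp: factor_def cgenideal_def m_comm)
    ultimately show "c \<in> Q" "primeideal Q V" using prime by simp_all
  qed
  show ?thesis
  proof (cases "a = \<zero> \<or> b = \<zero>")
    case True
    then show ?thesis using ab divides_zero by auto
  next
    case False
    then have nz: "a' \<noteq> \<zero>" "b' \<noteq> \<zero>" "g \<noteq> \<zero>" using a' b' g by auto
    have "(x \<otimes> a' \<oplus> y \<otimes> b') \<otimes> g = x \<otimes> (a' \<otimes> g) \<oplus> y \<otimes> (b' \<otimes> g)"
      using a'(1) b'(1) g(1) xy(1,2) by (simp add: l_distr m_assoc)
    also have "\<dots> = \<one> \<otimes> g" unfolding a'(2)[symmetric] b'(2)[symmetric] xy(3)[symmetric] using g(1) by simp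
    finally have 1: "x \<otimes> a' \<oplus> y \<otimes> b' = \<one>"
      using m_rcancel[OF nz(3) g(1)] a'(1) b'(1) xy(1,2) by simp
    have "a' \<in> Units V \<or> b' \<in> Units V"
    proof (rule ccontr)
      assume "\<not> ?thesis"
      then have "a' \<in> Q" "b' \<in> Q" and Qp: "primeideal Q V"
        using in_Q a'(1) b'(1) nz by auto
      interpret Q: primeideal Q V by (rule Qp)
      have "x \<otimes> a' \<oplus> y \<otimes> b' \<in> Q"
        using \<open>a' \<in> Q\<close> \<open>b' \<in> Q\<close> xy by (intro Q.a_closed Q.I_l_closed)
      then show False using 1 Q.I_notcarr Q.one_imp_carrier by simp
    qed
    then show ?thesis using unit a' b' by auto
  qed
qed

lemma (in field) field_divides:
  assumes "a \<in> carrier R" "b \<in> carrier R" shows "a divides b \<or> b divides a"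
proof (cases "a = \<zero>")
  case True
  then show ?thesis using assms divides_zero by simp
next
  case False
  then have a: "a \<in> Units R" using assms field_Units by simp
  have "b = a \<otimes> (inv a \<otimes> b)" using a assms by (simp add: m_assoc[symmetric])
  then show ?thesis using a assms by (auto intro!: dividesI[of "inv a \<otimes> b"])
qed

lemma (in monoid) finite_total_divides:
  assumes "finite Y" "Y \<noteq> {}" "Y \<subseteq> carrier G"
    and total: "\<And>a b. a \<in> carrier G \<Longrightarrow> b \<in> carrier G \<Longrightarrow> a divides b \<or> b divides a"
  shows "\<exists>d\<in>Y. \<forall>x\<in>Y. d divides x"
  using assms(1-3)
proof (induction Y rule: finite_ne_induct)
  case (singleton x)
  then show ?case using total[of x x] by auto
next
  case (insert x E)
  then obtain d where d: "d \<in> E" "\<forall>y\<in>E. d divides y" by auto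
  have c: "x \<in> carrier G" "d \<in> carrier G" using insert.prems d by auto
  show ?case
  proof (cases "d divides x")
    case True
    then show ?thesis using d by auto
  next
    case False
    then have "x divides d" using total[OF c] by blast
    then have "\<forall>y\<in>insert x E. x divides y" using d c divides_trans total[of x x] by blast
    then show ?thesis by blast
  qed
qed

section \<open>Minors of independent vectors and membership in spans\<close>

context cring
begin

text \<open>McCoy's argument: if all minors of the first \<open>t + 1\<close> vectors lie in \<open>P = ann z\<close>, then Cramer's
  rule multiplied by \<open>z\<close> is a linear relation between these vectors.\<close>

lemma independent_minor_notin:
  assumes P: "primeideal P R" and z: "z \<in> carrier R" and Pz: "P = {a \<in> carrier R. a \<otimes> z = \<zero>}"
    and g: "\<forall>j<e. g j \<in> carrier (free_module R p)"
    and indep: "\<And>a j. \<forall>j<e. a j \<in> carrier R \<Longrightarrow> lincomb R p e a g = (\<lambda>i\<in>{..<p}. \<zero>) \<Longrightarrow> j < e \<Longrightarrow>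
      \<exists>u\<in>carrier R - P. u \<otimes> a j = \<zero>"
  shows "\<exists>\<rho>. \<rho> ` {..<e} \<subseteq> {..<p} \<and> ring_det R e (\<lambda>k l. g l (\<rho> k)) \<notin> P"
proof -
  interpret P: primeideal P R by (rule P)
  have 1: "\<one> \<notin> P" using P.I_notcarr P.one_imp_carrier by auto
  have gR: "g j k \<in> carrier R" if "j < e" "k < p" for j k using g that by (auto simp: PiE_iff)
  have "\<exists>\<rho>. \<rho> ` {..<t} \<subseteq> {..<p} \<and> ring_det R t (\<lambda>k l. g l (\<rho> k)) \<notin> P" if "t \<le> e" for t
    using that
  proof (induction t)
    case 0
    have "ring_det R 0 B = \<one>" for B by (simp add: ring_det_eq perm_sign_def)
    then show ?case using 1 by simp
  next
    case (Suc t)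
    then obtain \<rho> where \<rho>: "\<rho> ` {..<t} \<subseteq> {..<p}" "ring_det R t (\<lambda>k l. g l (\<rho> k)) \<notin> P" by auto
    have t: "t < e" using Suc.prems by simp
    show ?case
    proof (rule ccontr)
      assume "\<not> ?case"
      then have inP: "ring_det R (Suc t) (\<lambda>k l. g l (\<rho>' k)) \<in> P" if "\<rho>' ` {..<Suc t} \<subseteq> {..<p}" for \<rho>'
        using that by blast
      define d where "d = ring_det R t (\<lambda>k l. g l (\<rho> k))"
      define D where "D b = ring_det R t (\<lambda>k l. g (if l = b then t else l) (\<rho> k))" for b
      have d: "d \<in> carrier R" unfolding d_def
        by (rule ring_det_closed) (use gR t \<rho>(1) in \<open>auto simp: image_subset_iff\<close>)
      have D: "D b \<in> carrier R" if "b < t" for b unfolding D_def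
        by (rule ring_det_closed) (use gR t \<rho>(1) that in \<open>auto simp: image_subset_iff\<close>)
      \<comment> \<open>These are Cramer's coefficients for \<open>g 0, ..., g t\<close>, multiplied
        by \<open>z\<close> and extended by zero. In each coordinate the resulting combination is
        \<open>z\<close> times a determinant of size \<open>Suc t\<close>, which lies in
        \<open>P\<close>.\<close>
      define a where "a j = (if j = t then d \<otimes> z else if j < t then \<ominus> D j \<otimes> z else \<zero>)" for j
      have a: "\<forall>j<e. a j \<in> carrier R" using d D z unfolding a_def by auto
      have "(\<Oplus>j\<in>{..<e}. a j \<otimes> g j k) = \<zero>" if k: "k < p" for k
      proof -
        \<comment> \<open>The rows \<open>\<rho>\<close> are bordered by row \<open>k\<close>, which
          may already occur among them; for this reason the index maps of the induction are
          arbitrary rather than increasing.\<close>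
        let ?\<rho> = "\<rho>(t := k)"
        let ?B = "\<lambda>k l. g l (?\<rho> k)"
        have im: "?\<rho> ` {..<Suc t} \<subseteq> {..<p}"
          unfolding image_subset_iff using \<rho>(1) k by (auto simp: image_subset_iff)
        have B: "\<forall>k<Suc t. \<forall>l<Suc t. ?B k l \<in> carrier R"
          using gR t im by (auto simp: image_subset_iff)
        have d': "ring_det R t ?B = d" unfolding d_def
          by (rule ring_det_cong) (use gR t im in \<open>auto simp: image_subset_iff\<close>)
        have D': "ring_det R t (\<lambda>k l. g (if l = b then t else l) (?\<rho> k)) = D b" if "b < t" for b
          unfolding D_def
          by (rule ring_det_cong) (use gR t im that in \<open>auto simp: image_subset_iff\<close>)
        have S: "(\<Oplus>b\<in>{..<t}. g b k \<otimes> \<ominus> D b) \<in> carrier R"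
          using gR t k D by (intro finsum_closed) auto
        have "(\<Oplus>j\<in>{..<e}. a j \<otimes> g j k) = (\<Oplus>j\<in>{..<Suc t}. a j \<otimes> g j k)"
          using a gR k t by (intro add.finprod_mono_neutral_cong_right) (auto simp: a_def)
        also have "\<dots> = a t \<otimes> g t k \<oplus> (\<Oplus>j\<in>{..<t}. a j \<otimes> g j k)"
          unfolding lessThan_Suc using a gR k t by (intro finsum_insert) auto
        also have "a t \<otimes> g t k = (g t k \<otimes> d) \<otimes> z" using d z gR[OF t k] by (simp add: a_def m_ac)
        also have "(\<Oplus>j\<in>{..<t}. a j \<otimes> g j k) = (\<Oplus>j\<in>{..<t}. (g j k \<otimes> \<ominus> D j) \<otimes> z)"
          using gR k t z D by (intro finsum_cong') (auto simp: a_def m_ac)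
        also have "\<dots> = (\<Oplus>j\<in>{..<t}. g j k \<otimes> \<ominus> D j) \<otimes> z"
          using gR k t z D by (intro finsum_ldistr[symmetric]) auto
        also have "g t k \<otimes> d \<otimes> z \<oplus> (\<Oplus>j\<in>{..<t}. g j k \<otimes> \<ominus> D j) \<otimes> z =
            (g t k \<otimes> d \<oplus> (\<Oplus>j\<in>{..<t}. g j k \<otimes> \<ominus> D j)) \<otimes> z"
          using S d z gR[OF t k] by (simp add: l_distr)
        also have "g t k \<otimes> d \<oplus> (\<Oplus>j\<in>{..<t}. g j k \<otimes> \<ominus> D j) = ring_det R (Suc t) ?B"
        proof -
          have "(\<Oplus>b\<in>{..<t}. g b k \<otimes> \<ominus> ring_det R t (\<lambda>k l. g (if l = b then t else l) (?\<rho> k))) =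
              (\<Oplus>j\<in>{..<t}. g j k \<otimes> \<ominus> D j)"
            using gR k t D D' by (intro finsum_cong') auto
          then show ?thesis using ring_det_expand_last_row[OF B] unfolding d' by simp
        qed
        also have "ring_det R (Suc t) ?B \<otimes> z = \<zero>" using inP[OF im] Pz by blast
        finally show ?thesis .
      qed
      then have "lincomb R p e a g = (\<lambda>i\<in>{..<p}. \<zero>)" by (auto simp: lincomb_def fun_eq_iff)
      \<comment> \<open>Independence is applied to the coefficient \<open>d \<otimes> z\<close> of
        \<open>g t\<close>; then \<open>u \<otimes> d\<close> annihilates \<open>z\<close> and so
        lies in \<open>P\<close>.\<close>
      from indep[OF a this t] obtain u where u: "u \<in> carrier R" "u \<notin> P" "u \<otimes> (d \<otimes> z) = \<zero>"
        by (auto simp: a_def)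
      then have "u \<otimes> d \<in> carrier R" "(u \<otimes> d) \<otimes> z = \<zero>" using z d by (simp_all add: m_assoc)
      then have "u \<otimes> d \<in> P" unfolding Pz by blast
      then have "d \<in> P" using P.I_prime[OF u(1) d] u(2) by blast
      then show False using \<rho>(2) by (simp add: d_def)
    qed
  qed
  then show ?thesis by blast
qed

text \<open>After transposition, \<open>t k\<close> belongs to the \<open>k\<close>-th factor of
  every Leibniz product, whatever the permutation. Each column has its own multiplier, since
  denominators will be cleared column by column.\<close>

lemma ring_det_smult_columns:
  assumes B: "\<forall>k<i. \<forall>l<i. B k l \<in> carrier R" and t: "\<forall>l<i. t l \<in> carrier R"
  shows "ring_det R i (\<lambda>k l. t l \<otimes> B k l) = (\<Otimes>l\<in>{..<i}. t l) \<otimes> ring_det R i B"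
proof -
  let ?P = "{\<sigma>. \<sigma> permutes {..<i}}"
  have B': "\<forall>k<i. \<forall>l<i. t k \<otimes> B l k \<in> carrier R" using B t by simp
  have Bt: "\<forall>k<i. \<forall>l<i. B l k \<in> carrier R" using B by simp
  have T: "(\<Otimes>l\<in>{..<i}. t l) \<in> carrier R" using t by (intro finprod_closed) auto
  have C: "(\<Otimes>k\<in>{..<i}. B (\<sigma> k) k) \<in> carrier R" if "\<sigma> \<in> ?P" for \<sigma>
    using leibniz_factors_closed[where B = "\<lambda>k l. B l k", OF Bt] that by (intro finprod_closed) auto
  have "ring_det R i (\<lambda>k l. t k \<otimes> B l k) =
      (\<Oplus>\<sigma>\<in>?P. perm_sign R \<sigma> \<otimes> (\<Otimes>k\<in>{..<i}. t k \<otimes> B (\<sigma> k) k))"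
    using ring_det_eq[where B = "\<lambda>k l. t k \<otimes> B l k", OF B'] .
  also have "\<dots> = (\<Oplus>\<sigma>\<in>?P. (\<Otimes>l\<in>{..<i}. t l) \<otimes> (perm_sign R \<sigma> \<otimes> (\<Otimes>k\<in>{..<i}. B (\<sigma> k) k)))"
  proof (rule finsum_cong')
    fix \<sigma> assume \<sigma>: "\<sigma> \<in> ?P"
    have "(\<Otimes>k\<in>{..<i}. t k \<otimes> B (\<sigma> k) k) = (\<Otimes>k\<in>{..<i}. t k) \<otimes> (\<Otimes>k\<in>{..<i}. B (\<sigma> k) k)"
      using leibniz_factors_closed[where B = "\<lambda>k l. B l k", OF Bt, of \<sigma>] \<sigma> t
      by (intro finprod_multf) auto
    then show "perm_sign R \<sigma> \<otimes> (\<Otimes>k\<in>{..<i}. t k \<otimes> B (\<sigma> k) k) =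
        (\<Otimes>l\<in>{..<i}. t l) \<otimes> (perm_sign R \<sigma> \<otimes> (\<Otimes>k\<in>{..<i}. B (\<sigma> k) k))"
      using C[OF \<sigma>] T by (simp add: m_lcomm)
  qed (use C T in auto)
  also have "\<dots> = (\<Otimes>l\<in>{..<i}. t l) \<otimes> (\<Oplus>\<sigma>\<in>?P. perm_sign R \<sigma> \<otimes> (\<Otimes>k\<in>{..<i}. B (\<sigma> k) k))"
    using C T by (intro finsum_rdistr[symmetric]) (auto simp: finite_permutations)
  also have "\<dots> = (\<Otimes>l\<in>{..<i}. t l) \<otimes> ring_det R i (\<lambda>k l. B l k)"
    using ring_det_eq[where B = "\<lambda>k l. B l k", OF Bt] by simp
  finally show ?thesis
    using ring_det_transpose[where B = "\<lambda>k l. t k \<otimes> B l k", OF B'] ring_det_transpose[OF B] by simp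
qed

end

lemma (in domain) finprod_nonzero:
  "finite A \<Longrightarrow> (\<And>x. x \<in> A \<Longrightarrow> f x \<in> carrier R - {\<zero>}) \<Longrightarrow> finprod R f A \<noteq> \<zero>"
proof (induction A rule: finite_induct)
  case (insert x A)
  have "finprod R f (insert x A) = f x \<otimes> finprod R f A"
    using insert by (intro finprod_insert) auto
  moreover have "finprod R f A \<in> carrier R" using insert.prems by (intro finprod_closed) auto
  ultimately show ?case using insert integral_iff by auto
qed simp

text \<open>The \<open>r\<close>-minor \<open>d\<close> of \<open>A\<close> that divides all others serves as the denominator in Cramer's rule;
  the numerators are \<open>r\<close>-minors of vectors in the span of \<open>B\<close>, hence multiples of \<open>d\<close>.\<close>

lemma (in domain) mem_span_if_minors:
  assumes total: "\<And>a b. a \<in> carrier R \<Longrightarrow> b \<in> carrier R \<Longrightarrow> a divides b \<or> b divides a"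
    and A: "\<forall>j<n. A j \<in> submodule_gen R (free_module R p) (B ` {..<m})"
    and h: "h \<in> submodule_gen R (free_module R p) (B ` {..<m})"
    and B: "\<forall>j<m. B j \<in> carrier (free_module R p)"
    and G: "\<forall>j<r. G j \<in> carrier (free_module R p)"
    and rank: "\<And>x. x = h \<or> x \<in> A ` {..<n} \<Longrightarrow> \<exists>t\<in>carrier R - {\<zero>}.
      (\<lambda>i\<in>{..<p}. t \<otimes> x i) \<in> submodule_gen R (free_module R p) (G ` {..<r})"
    and minors: "minors R p m B r \<subseteq> Idl (minors R p n A r)"
    and nonzero: "\<not> minors R p n A r \<subseteq> {\<zero>}"
  shows "h \<in> submodule_gen R (free_module R p) (A ` {..<n})"
proof -
  interpret F: module R "free_module R p" by (rule free_module_module)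
  have BF: "B ` {..<m} \<subseteq> carrier (free_module R p)" using B by auto
  have spanB: "submodule_gen R (free_module R p) (B ` {..<m}) \<subseteq> carrier (free_module R p)"
    using F.submodule_gen_submodule[OF BF] F.submoduleE(1) by blast
  have Ac: "\<forall>j<n. A j \<in> carrier (free_module R p)" and hc: "h \<in> carrier (free_module R p)"
    using A h spanB by blast+
  have AF: "A ` {..<n} \<subseteq> carrier (free_module R p)" using Ac by auto
  have mc: "minors R p n A r \<subseteq> carrier R" by (rule minors_closed[OF Ac])
  obtain d where dm: "d \<in> minors R p n A r" and div: "\<forall>x\<in>minors R p n A r. d divides x"
    using finite_total_divides[OF finite_minors[OF Ac] _ mc total] nonzero by blast
  have d: "d \<in> carrier R" using dm mc by blast
  have d0: "d \<noteq> \<zero>"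
  proof
    assume "d = \<zero>"
    then have "minors R p n A r \<subseteq> {\<zero>}" using div zero_divides by auto
    then show False using nonzero by blast
  qed
  have "minors R p n A r \<subseteq> PIdl d"
    using div mc d by (auto simp: factor_def cgenideal_def m_comm)
  then have "Idl (minors R p n A r) \<subseteq> PIdl d" by (rule genideal_minimal[OF cgenideal_ideal[OF d]])
  then have "Idl (minors R p m B r) \<subseteq> PIdl d"
    using minors by (intro genideal_minimal[OF cgenideal_ideal[OF d]]) blast
  note IB = this
  obtain \<rho> \<gamma> where d_eq: "d = ring_det R r (\<lambda>k l. A (\<gamma> l) (\<rho> k))"
    and \<rho>: "\<rho> ` {..<r} \<subseteq> {..<p}" and \<gamma>: "\<gamma> ` {..<r} \<subseteq> {..<n}"
    using dm by (auto simp: minors_def)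
  \<comment> \<open>The columns selected by \<open>d\<close>, with \<open>h\<close> appended as
    column \<open>r\<close>.\<close>
  define c where "c l = (if l = r then h else A (\<gamma> l))" for l
  have c_cases: "c l = h \<or> c l \<in> A ` {..<n}" if "l < Suc r" for l
    using that \<gamma> by (auto simp: c_def less_Suc_eq)
  have c_span: "c l \<in> submodule_gen R (free_module R p) (B ` {..<m})" if "l < Suc r" for l
    using c_cases[OF that] A h by auto
  have cR: "c l k \<in> carrier R" if "l < Suc r" "k < p" for l k
    using c_span[OF that(1)] spanB that(2) by (auto simp: PiE_iff)
  define D where "D b = ring_det R r (\<lambda>k l. c (if l = b then r else l) (\<rho> k))" for b
  have "\<exists>q. q \<in> carrier R \<and> D b = q \<otimes> d" if b: "b < r" for b
  proof -
    have "D b \<in> Idl (minors R p m B r)"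
      unfolding D_def using b by (intro span_minor_mem_ideal[OF B \<rho>]) (auto intro: c_span)
    then show ?thesis using IB by (auto simp: cgenideal_def)
  qed
  then obtain q where q: "\<And>b. b < r \<Longrightarrow> q b \<in> carrier R \<and> D b = q b \<otimes> d" by metis
  have "\<exists>t. t \<in> carrier R - {\<zero>} \<and>
      (\<lambda>i\<in>{..<p}. t \<otimes> c l i) \<in> submodule_gen R (free_module R p) (G ` {..<r})"
    if "l < Suc r" for l
    using rank[OF c_cases[OF that]] by (elim bexE) (intro exI conjI)
  then obtain t where t: "\<And>l. l < Suc r \<Longrightarrow> t l \<in> carrier R - {\<zero>}"
    and tG: "\<And>l. l < Suc r \<Longrightarrow>
      (\<lambda>i\<in>{..<p}. t l \<otimes> c l i) \<in> submodule_gen R (free_module R p) (G ` {..<r})" by metis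
  have hk: "h k = (\<Oplus>b\<in>{..<r}. q b \<otimes> A (\<gamma> b) k)" if k: "k < p" for k
  proof -
    let ?\<rho> = "\<rho>(r := k)"
    let ?C = "\<lambda>k l. c l (?\<rho> k)"
    have im: "?\<rho> ` {..<Suc r} \<subseteq> {..<p}"
      unfolding image_subset_iff using \<rho> k by (auto simp: image_subset_iff)
    have C: "\<forall>k<Suc r. \<forall>l<Suc r. ?C k l \<in> carrier R"
      using cR im by (auto simp: image_subset_iff)
    have tC: "\<forall>l<Suc r. t l \<in> carrier R" using t by auto
    have AR: "A (\<gamma> b) k \<in> carrier R" if "b < r" for b
      using cR[of b k] that k by (simp add: c_def)
    \<comment> \<open>Scaled by \<open>t l\<close>, each of the \<open>r + 1\<close> columns lies in
      the span of the \<open>r\<close> vectors \<open>G\<close>, so the scaled determinant vanishes.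
      In a domain the product of the nonzero \<open>t l\<close> can then be cancelled.\<close>
    have "(\<Otimes>l\<in>{..<Suc r}. t l) \<otimes> ring_det R (Suc r) ?C =
        ring_det R (Suc r) (\<lambda>k l. t l \<otimes> ?C k l)"
      by (rule ring_det_smult_columns[OF C tC, symmetric])
    also have "\<dots> = ring_det R (Suc r) (\<lambda>k l. (\<lambda>i\<in>{..<p}. t l \<otimes> c l i) (?\<rho> k))"
      by (rule ring_det_cong) (use im C t in \<open>auto simp: image_subset_iff\<close>)
    also have "\<dots> = \<zero>"
      using tG by (intro span_minor_eq_zero[OF G im _ lessI]) blast
    finally have "ring_det R (Suc r) ?C = \<zero>"
      using finprod_nonzero[of "{..<Suc r}" t] t ring_det_closed[OF C]
        finprod_closed[of t "{..<Suc r}"] integral[of "\<Otimes>l\<in>{..<Suc r}. t l" "ring_det R (Suc r) ?C"]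
      by auto
    then have "ring_det R r ?C \<otimes> ?C r r =
        (\<Oplus>b\<in>{..<r}. ring_det R r (\<lambda>k l. ?C k (if l = b then r else l)) \<otimes> ?C r b)"
      by (rule ring_det_cramer[OF C])
    also have "ring_det R r ?C = d" unfolding d_eq
      by (rule ring_det_cong)
        (use Ac \<rho> \<gamma> in \<open>auto simp: c_def image_subset_iff PiE_iff\<close>)
    also have "(\<Oplus>b\<in>{..<r}. ring_det R r (\<lambda>k l. ?C k (if l = b then r else l)) \<otimes> ?C r b) =
        (\<Oplus>b\<in>{..<r}. d \<otimes> (q b \<otimes> A (\<gamma> b) k))"
    proof (rule finsum_cong')
      fix b assume b: "b \<in> {..<r}"
      have "ring_det R r (\<lambda>k l. ?C k (if l = b then r else l)) = D b" unfolding D_def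
        by (rule ring_det_cong) (use cR \<rho> b in \<open>auto simp: image_subset_iff\<close>)
      then show "ring_det R r (\<lambda>k l. ?C k (if l = b then r else l)) \<otimes> ?C r b = d \<otimes> (q b \<otimes> A (\<gamma> b) k)"
        using q b d AR by (simp add: c_def m_ac)
    qed (use q AR d in auto)
    also have "\<dots> = d \<otimes> (\<Oplus>b\<in>{..<r}. q b \<otimes> A (\<gamma> b) k)"
      using q AR d by (intro finsum_rdistr[symmetric]) auto
    finally have "d \<otimes> h k = d \<otimes> (\<Oplus>b\<in>{..<r}. q b \<otimes> A (\<gamma> b) k)" by (simp add: c_def)
    moreover have "h k \<in> carrier R" using cR[of r k] k by (simp add: c_def)
    moreover have "(\<Oplus>b\<in>{..<r}. q b \<otimes> A (\<gamma> b) k) \<in> carrier R"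
      using q AR by (intro finsum_closed) auto
    ultimately show ?thesis using m_lcancel[OF d0 d] by blast
  qed
  have "h = lincomb R p r q (\<lambda>b. A (\<gamma> b))"
    using hk hc by (auto simp: lincomb_def fun_eq_iff PiE_iff extensional_def)
  also have "\<dots> \<in> submodule_gen R (free_module R p) (A ` {..<n})"
    using \<gamma> q
    by (intro lincomb_mem_submodule F.submodule_gen_submodule[OF AF] subsetD[OF submodule_gen_superset])
      auto
  finally show ?thesis .
qed

text \<open>This translates between submodules of \<open>R^1\<close>, by which
  \<open>ideal_closure\<close> encodes ideals, and ideals generated by a set; it is applied over
  \<open>V\<close>.\<close>

lemma (in cring) singleton_mem_submodule_gen:
  assumes Z: "Z \<subseteq> carrier R"
  shows "(\<lambda>i\<in>{..<1}. v) \<in> submodule_gen R (free_module R 1) ((\<lambda>z. \<lambda>i\<in>{..<1}. z) ` Z) \<longleftrightarrow> v \<in> Idl Z"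
    (is "_ \<in> ?G \<longleftrightarrow> _")
proof
  interpret I: ideal "Idl Z" R by (rule genideal_ideal[OF Z])
  let ?T = "{x \<in> carrier (free_module R 1). x 0 \<in> Idl Z}"
  have T: "submodule ?T R (free_module R 1)"
    by (rule submodule_freeI) (auto simp: PiE_iff extensional_def I.a_closed I.I_l_closed)
  have "(\<lambda>z. \<lambda>i\<in>{..<1}. z) ` Z \<subseteq> ?T" 
    using genideal_self[OF Z] Z by (auto split: if_splits)
  then have "?G \<subseteq> ?T" by (rule submodule_gen_minimal[OF T])
  moreover assume "(\<lambda>i\<in>{..<1}. v) \<in> ?G"
  ultimately show "v \<in> Idl Z" by auto
next
  interpret F: module R "free_module R 1" by (rule free_module_module)
  have "(\<lambda>z. \<lambda>i\<in>{..<1}. z) ` Z \<subseteq> carrier (free_module R 1)"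
    using Z by (auto split: if_splits)
  then have G: "submodule ?G R (free_module R 1)" by (rule F.submodule_gen_submodule)
  have "Z \<subseteq> (\<lambda>x. x 0) ` ?G"
  proof
    fix z assume "z \<in> Z"
    then have "(\<lambda>i\<in>{..<1}. z) \<in> ?G" by (intro subsetD[OF submodule_gen_superset] imageI)
    then show "z \<in> (\<lambda>x. x 0) ` ?G" by (rule rev_image_eqI) simp
  qed
  then have "Idl Z \<subseteq> (\<lambda>x. x 0) ` ?G"
    by (rule genideal_minimal[OF coordinate_ideal[OF G zero_less_one]])
  moreover assume "v \<in> Idl Z"
  ultimately obtain x where x: "x \<in> ?G" "v = x 0" by blast
  have "x \<in> extensional {..<1}" using x(1) submodule_free_subset[OF G] by (auto simp: PiE_iff)
  then have "(\<lambda>i\<in>{..<1}. v) = x" using x(2) by (auto simp: fun_eq_iff extensional_def)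
  then show "(\<lambda>i\<in>{..<1}. v) \<in> ?G" using x(1) by simp
qed

section \<open>Minors and integral closure\<close>

lemma valuation_between_domain:
  assumes "valuation_between R P V"
  shows "domain (residue_field R P\<lparr>carrier := V\<rparr>)"
  using assms unfolding valuation_between_def discrete_valuation_ring_def
  by (auto simp: principal_domain_def field_def)

lemma valuation_between_divides:
  assumes "valuation_between R P V" "a \<in> V" "b \<in> V"
  shows "a divides\<^bsub>residue_field R P\<lparr>carrier := V\<rparr>\<^esub> b \<or> b divides\<^bsub>residue_field R P\<lparr>carrier := V\<rparr>\<^esub> a"
  using assms discrete_valuation_ring_divides[of "residue_field R P\<lparr>carrier := V\<rparr>" a b]
    field.field_divides[of "residue_field R P\<lparr>carrier := V\<rparr>" a b]
  unfolding valuation_between_def by auto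

lemma (in primeideal) residue_map_valuation_hom:
  assumes V: "valuation_between R I V"
  shows "ring_hom_cring R (residue_field R I\<lparr>carrier := V\<rparr>) (residue_map R I)"
proof -
  interpret W: domain "residue_field R I\<lparr>carrier := V\<rparr>" by (rule valuation_between_domain[OF V])
  have "residue_map R I \<in> ring_hom R (residue_field R I\<lparr>carrier := V\<rparr>)"
    using residue_map_hom V by (auto simp: ring_hom_def valuation_between_def)
  then show ?thesis
    by (intro ring_hom_cring.intro is_cring W.is_cring ring_hom_cring_axioms.intro)
qed

section \<open>Extension of spans and ideals along a ring homomorphism\<close>

context ring_hom_cring
begin

text \<open>The coordinatewise map goes between modules over different rings and is semilinear over
  \<open>h\<close>. Inclusions of spans are therefore proved by pulling a submodule back along
  it.\<close>

lemma vec_vimage_submodule: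
  assumes T: "submodule T S (free_module S p)"
  shows "submodule {x \<in> carrier (free_module R p). (\<lambda>i\<in>{..<p}. h (x i)) \<in> T} R (free_module R p)"
proof (rule R.submodule_freeI)
  show "(\<lambda>i\<in>{..<p}. \<zero>) \<in> {x \<in> carrier (free_module R p). (\<lambda>i\<in>{..<p}. h (x i)) \<in> T}"
    using S.submodule_free_zero[OF T] by (auto cong: restrict_cong)
next
  fix x y assume "x \<in> {x \<in> carrier (free_module R p). (\<lambda>i\<in>{..<p}. h (x i)) \<in> T}"
    "y \<in> {x \<in> carrier (free_module R p). (\<lambda>i\<in>{..<p}. h (x i)) \<in> T}"
  then have x: "x \<in> {..<p} \<rightarrow>\<^sub>E carrier R" "(\<lambda>i\<in>{..<p}. h (x i)) \<in> T"
    and y: "y \<in> {..<p} \<rightarrow>\<^sub>E carrier R" "(\<lambda>i\<in>{..<p}. h (y i)) \<in> T" by auto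
  have "(\<lambda>i\<in>{..<p}. h ((\<lambda>i\<in>{..<p}. x i \<oplus> y i) i)) =
      (\<lambda>i\<in>{..<p}. (\<lambda>i\<in>{..<p}. h (x i)) i \<oplus>\<^bsub>S\<^esub> (\<lambda>i\<in>{..<p}. h (y i)) i)"
    using x(1) y(1) by (auto simp: fun_eq_iff PiE_iff)
  also have "\<dots> \<in> T" by (rule S.submodule_free_add[OF T x(2) y(2)])
  finally show "(\<lambda>i\<in>{..<p}. x i \<oplus> y i) \<in>
      {x \<in> carrier (free_module R p). (\<lambda>i\<in>{..<p}. h (x i)) \<in> T}"
    using x(1) y(1) by (simp add: PiE_iff)
next
  fix a x assume a: "a \<in> carrier R"
    and "x \<in> {x \<in> carrier (free_module R p). (\<lambda>i\<in>{..<p}. h (x i)) \<in> T}"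
  then have x: "x \<in> {..<p} \<rightarrow>\<^sub>E carrier R" "(\<lambda>i\<in>{..<p}. h (x i)) \<in> T" by auto
  have "(\<lambda>i\<in>{..<p}. h ((\<lambda>i\<in>{..<p}. a \<otimes> x i) i)) =
      (\<lambda>i\<in>{..<p}. h a \<otimes>\<^bsub>S\<^esub> (\<lambda>i\<in>{..<p}. h (x i)) i)"
    using x(1) a by (auto simp: fun_eq_iff PiE_iff)
  also have "\<dots> \<in> T" by (rule S.submodule_free_smult[OF T hom_closed[OF a] x(2)])
  finally show "(\<lambda>i\<in>{..<p}. a \<otimes> x i) \<in>
      {x \<in> carrier (free_module R p). (\<lambda>i\<in>{..<p}. h (x i)) \<in> T}"
    using x(1) a by (simp add: PiE_iff)
qed auto

lemma vec_image_span:
  assumes Z: "Z \<subseteq> carrier (free_module R p)" and x: "x \<in> submodule_gen R (free_module R p) Z"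
    and T: "submodule T S (free_module S p)" "\<And>z. z \<in> Z \<Longrightarrow> (\<lambda>i\<in>{..<p}. h (z i)) \<in> T"
  shows "(\<lambda>i\<in>{..<p}. h (x i)) \<in> T"
  using submodule_gen_minimal[OF vec_vimage_submodule[OF T(1)], of Z] Z x T(2) by blast

lemma vec_image_span_image:
  assumes C: "\<forall>j<q. C j \<in> carrier (free_module R p)"
    and x: "x \<in> submodule_gen R (free_module R p) (C ` {..<q})"
  shows "(\<lambda>i\<in>{..<p}. h (x i)) \<in>
    submodule_gen S (free_module S p) ((\<lambda>j. \<lambda>i\<in>{..<p}. h (C j i)) ` {..<q})"
proof (rule vec_image_span[OF _ x])
  interpret F: module S "free_module S p" by (rule S.free_module_module)
  show "C ` {..<q} \<subseteq> carrier (free_module R p)" unfolding image_subset_iff using C by simp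
  have "(\<lambda>j. \<lambda>i\<in>{..<p}. h (C j i)) ` {..<q} \<subseteq> carrier (free_module S p)"
    unfolding image_subset_iff using C by (simp add: PiE_iff)
  then show "submodule (submodule_gen S (free_module S p) ((\<lambda>j. \<lambda>i\<in>{..<p}. h (C j i)) ` {..<q}))
      S (free_module S p)" by (rule F.submodule_gen_submodule)
  fix y assume "y \<in> C ` {..<q}"
  then show "(\<lambda>i\<in>{..<p}. h (y i)) \<in>
      submodule_gen S (free_module S p) ((\<lambda>j. \<lambda>i\<in>{..<p}. h (C j i)) ` {..<q})"
    by (intro subsetD[OF submodule_gen_superset]) blast
qed

text \<open>The elements mapped into the ideal generated by the image of \<open>Z\<close> form an
  ideal containing \<open>Z\<close>. Extended ideals can thus be computed from minors alone.\<close>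

lemma hom_genideal:
  assumes Z: "Z \<subseteq> carrier R"
  shows "Idl\<^bsub>S\<^esub> (h ` (Idl Z)) = Idl\<^bsub>S\<^esub> (h ` Z)"
proof (rule equalityI)
  have hZ: "h ` Z \<subseteq> carrier S" using Z by auto
  have RI: "Idl Z \<subseteq> carrier R" by (rule additive_subgroup.a_subset[OF ideal.axioms(1)[OF R.genideal_ideal[OF Z]]])
  then have hI: "h ` (Idl Z) \<subseteq> carrier S" by auto
  show "Idl\<^bsub>S\<^esub> (h ` Z) \<subseteq> Idl\<^bsub>S\<^esub> (h ` (Idl Z))"
    by (rule S.subset_Idl_subset[OF hI image_mono[OF R.genideal_self[OF Z]]])
  interpret J: ideal "Idl\<^bsub>S\<^esub> (h ` Z)" S by (rule S.genideal_ideal[OF hZ])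
  have "ideal {a \<in> carrier R. h a \<in> Idl\<^bsub>S\<^esub> (h ` Z)} R"
  proof (rule idealI)
    show "ring R" by (rule R.ring_axioms)
    show "subgroup {a \<in> carrier R. h a \<in> Idl\<^bsub>S\<^esub> (h ` Z)} (add_monoid R)"
      by (rule R.add.subgroupI) (auto simp: J.a_closed intro!: exI[of _ \<zero>])
  qed (auto intro: J.I_l_closed J.I_r_closed)
  moreover have "Z \<subseteq> {a \<in> carrier R. h a \<in> Idl\<^bsub>S\<^esub> (h ` Z)}" using S.genideal_self[OF hZ] Z by auto
  ultimately have "Idl Z \<subseteq> {a \<in> carrier R. h a \<in> Idl\<^bsub>S\<^esub> (h ` Z)}" by (rule R.genideal_minimal)
  then have "h ` (Idl Z) \<subseteq> Idl\<^bsub>S\<^esub> (h ` Z)" by auto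
  then show "Idl\<^bsub>S\<^esub> (h ` (Idl Z)) \<subseteq> Idl\<^bsub>S\<^esub> (h ` Z)" by (rule S.genideal_minimal[OF J.is_ideal])
qed

end

text \<open>With \<open>Z\<close> a set of minors, comparing closures is reduced to comparing the
  images of the minors in each \<open>V\<close>.\<close>

lemma ideal_closure_genideal_iff:
  assumes "cring R" and Z: "Z \<subseteq> carrier R"
  shows "x \<in> ideal_closure R (genideal R Z) \<longleftrightarrow> x \<in> carrier R \<and>
    (\<forall>P V. minimal_prime R P \<longrightarrow> valuation_between R P V \<longrightarrow>
      residue_map R P x \<in> genideal (residue_field R P\<lparr>carrier := V\<rparr>) (residue_map R P ` Z))"
proof (cases "x \<in> carrier R")
  case x: True
  interpret cring R by fact
  have "vec_image R P 1 (\<lambda>i\<in>{..<1}. x) \<in> submodule_gen (residue_field R P\<lparr>carrier := V\<rparr>)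
        (free_module (residue_field R P\<lparr>carrier := V\<rparr>) 1) (vec_image R P 1 ` ({..<1} \<rightarrow>\<^sub>E genideal R Z)) \<longleftrightarrow>
      residue_map R P x \<in> genideal (residue_field R P\<lparr>carrier := V\<rparr>) (residue_map R P ` Z)"
    if PV: "minimal_prime R P" "valuation_between R P V" for P V
  proof -
    interpret P: primeideal P R using PV(1) by (simp add: minimal_prime_def)
    let ?W = "residue_field R P\<lparr>carrier := V\<rparr>"
    interpret h: ring_hom_cring R ?W "residue_map R P" by (rule P.residue_map_valuation_hom[OF PV(2)])
    have RI: "genideal R Z \<subseteq> carrier R"
      by (rule additive_subgroup.a_subset[OF ideal.axioms(1)[OF genideal_ideal[OF Z]]])
    then have hI: "residue_map R P ` genideal R Z \<subseteq> carrier ?W" using h.hom_closed by auto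
    have x1: "vec_image R P 1 (\<lambda>i\<in>{..<1}. x) = (\<lambda>i\<in>{..<1}. residue_map R P x)"
      by (auto simp: vec_image_def fun_eq_iff)
    have "vec_image R P 1 ` ({..<1} \<rightarrow>\<^sub>E genideal R Z) =
        (\<lambda>z. \<lambda>i\<in>{..<1}. z) ` residue_map R P ` genideal R Z" (is "?A = ?B")
    proof (intro equalityI subsetI)
      fix y assume "y \<in> ?A"
      then obtain v where v: "v \<in> {..<1} \<rightarrow>\<^sub>E genideal R Z" "y = vec_image R P 1 v" by blast
      then have "y = (\<lambda>i\<in>{..<1}. residue_map R P (v 0))" by (auto simp: vec_image_def fun_eq_iff)
      moreover have "v 0 \<in> genideal R Z" using v(1) by auto
      ultimately show "y \<in> ?B" by blast
    next
      fix y assume "y \<in> ?B"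
      then obtain z where z: "z \<in> genideal R Z" "y = (\<lambda>i\<in>{..<1}. residue_map R P z)" by blast
      then have "y = vec_image R P 1 (\<lambda>i\<in>{..<1}. z)" by (auto simp: vec_image_def fun_eq_iff)
      moreover have "(\<lambda>i\<in>{..<1}. z) \<in> {..<1} \<rightarrow>\<^sub>E genideal R Z" using z(1) by simp
      ultimately show "y \<in> ?A" by blast
    qed
    then show ?thesis
      unfolding x1 using h.S.singleton_mem_submodule_gen[OF hI, of "residue_map R P x"]
        h.hom_genideal[OF Z] by simp
  qed
  then show ?thesis
    unfolding ideal_closure_def integral_closure_def Let_def using x by auto
qed (simp add: ideal_closure_def)

text \<open>Finite generation makes the choice in \<open>minors_ideal\<close> a choice from a
  nonempty set. The matrix may depend on \<open>i\<close>, so later arguments fix \<open>i\<close>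
  before obtaining it.\<close>

lemma minors_ideal_obtain:
  assumes "cring R" "noetherian_ring R" "submodule M R (free_module R p)"
  obtains n A where "generating_matrix R p M n A"
    "minors_ideal R p i M = genideal R (minors R p n A i)"
proof -
  obtain n A where "generating_matrix R p M n A"
    using submodule_free_finitely_generated[OF assms] .
  then have "\<exists>I n A. generating_matrix R p M n A \<and> I = genideal R (minors R p n A i)" by blast
  from someI_ex[OF this] show ?thesis
    unfolding minors_ideal_def[symmetric] using that by blast
qed

text \<open>Applied to a submodule, \<open>localized_basis\<close> yields sums in the record with
  carrier \<open>M\<close>, whose \<open>finsum\<close> differs from that of the free module; the
  induction passes to coordinates.\<close>

lemma (in cring) submodule_finsum_eq_lincomb:
  assumes M: "submodule M R (free_module R p)"
    and g: "\<forall>j<n. g j \<in> M" and a: "\<forall>j<n. a j \<in> carrier R"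
  shows "(\<Oplus>\<^bsub>free_module R p\<lparr>carrier := M\<rparr>\<^esub>j\<in>{..<n}. a j \<odot>\<^bsub>free_module R p\<lparr>carrier := M\<rparr>\<^esub> g j) =
    lincomb R p n a g"
proof -
  interpret N: module R "free_module R p\<lparr>carrier := M\<rparr>"
    by (rule submodule.submodule_is_module[OF M free_module_module])
  show ?thesis
    using g a
  proof (induction n)
    case 0
    then show ?case
      by (simp add: lincomb_def)
  next
    case (Suc n)
    have c: "a j \<odot>\<^bsub>free_module R p\<lparr>carrier := M\<rparr>\<^esub> g j \<in> carrier (free_module R p\<lparr>carrier := M\<rparr>)"
      if "j < Suc n" for j
      using Suc.prems that by (intro N.smult_closed) auto
    have IH: "(\<Oplus>\<^bsub>free_module R p\<lparr>carrier := M\<rparr>\<^esub>j\<in>{..<n}. a j \<odot>\<^bsub>free_module R p\<lparr>carrier := M\<rparr>\<^esub> g j) =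
        lincomb R p n a g"
      by (rule Suc.IH) (use Suc.prems in auto)
    have gR: "g j i \<in> carrier R" if "j < Suc n" "i < p" for i j
      using Suc.prems(1) that submodule_free_subset[OF M] by auto
    have "(\<Oplus>\<^bsub>free_module R p\<lparr>carrier := M\<rparr>\<^esub>j\<in>{..<Suc n}. a j \<odot>\<^bsub>free_module R p\<lparr>carrier := M\<rparr>\<^esub> g j) =
        a n \<odot>\<^bsub>free_module R p\<lparr>carrier := M\<rparr>\<^esub> g n \<oplus>\<^bsub>free_module R p\<lparr>carrier := M\<rparr>\<^esub>
        (\<Oplus>\<^bsub>free_module R p\<lparr>carrier := M\<rparr>\<^esub>j\<in>{..<n}. a j \<odot>\<^bsub>free_module R p\<lparr>carrier := M\<rparr>\<^esub> g j)"
      unfolding lessThan_Suc using c by (intro N.finsum_insert) auto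
    also have "\<dots> = (\<lambda>i\<in>{..<p}. a n \<otimes> g n i \<oplus> lincomb R p n a g i)"
      unfolding IH by (auto simp: fun_eq_iff)
    also have "\<dots> = lincomb R p (Suc n) a g"
      using gR Suc.prems(2)
      by (auto simp: lincomb_def lessThan_Suc fun_eq_iff intro!: finsum_insert[symmetric])
    finally show ?case .
  qed
qed

text \<open>Specializes \<open>localized_basis\<close> to submodules of \<open>R^p\<close>; the
  definition of \<open>is_rank\<close> is unfolded here. The last two conclusions have opposite
  uses: spanning bounds the size of nonvanishing minors from above, independence from below.\<close>

lemma (in cring) rank_basis:
  assumes M: "submodule M R (free_module R p)" and P: "associated_prime R P"
    and rank: "is_rank R (free_module R p\<lparr>carrier := M\<rparr>) r"
  obtains g where "\<forall>j<r. g j \<in> M"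
    and "\<forall>x\<in>M. \<exists>t\<in>carrier R - P. \<exists>a. (\<forall>j<r. a j \<in> carrier R) \<and>
      (\<lambda>i\<in>{..<p}. t \<otimes> x i) = lincomb R p r a g"
    and "\<forall>a. (\<forall>j<r. a j \<in> carrier R) \<longrightarrow> lincomb R p r a g = (\<lambda>i\<in>{..<p}. \<zero>) \<longrightarrow>
      (\<forall>j<r. \<exists>u\<in>carrier R - P. u \<otimes> a j = \<zero>)"
proof -
  interpret P: primeideal P R using P by (simp add: associated_prime_def)
  interpret S: multiplicative_subset R "carrier R - P" by (rule P.complement_multiplicative_subset)
  let ?N = "free_module R p\<lparr>carrier := M\<rparr>"
  have N: "module R ?N" by (rule submodule.submodule_is_module[OF M free_module_module])
  have iso: "module_isomorphic (loc_ring R (carrier R - P)) (loc_module R (carrier R - P) ?N)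
      (free_module (loc_ring R (carrier R - P)) r)"
    using rank P by (simp add: is_rank_def)
  obtain g where g: "\<forall>j<r. g j \<in> carrier ?N"
    and span: "\<forall>x\<in>carrier ?N. \<exists>t\<in>carrier R - P. \<exists>a. (\<forall>j<r. a j \<in> carrier R) \<and>
      t \<odot>\<^bsub>?N\<^esub> x = (\<Oplus>\<^bsub>?N\<^esub>j\<in>{..<r}. a j \<odot>\<^bsub>?N\<^esub> g j)"
    and indep: "\<forall>a. (\<forall>j<r. a j \<in> carrier R) \<longrightarrow> (\<Oplus>\<^bsub>?N\<^esub>j\<in>{..<r}. a j \<odot>\<^bsub>?N\<^esub> g j) = \<zero>\<^bsub>?N\<^esub> \<longrightarrow>
      (\<forall>j<r. \<exists>u\<in>carrier R - P. u \<otimes> a j = \<zero>)"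
    using S.localized_basis[OF N iso] .
  have gM: "\<forall>j<r. g j \<in> M" using g by simp
  note eq = submodule_finsum_eq_lincomb[OF M gM]
  show ?thesis
  proof (rule that[OF gM]; intro ballI allI impI)
    fix x assume "x \<in> M"
    then have "x \<in> carrier ?N" by simp
    then obtain t a where "t \<in> carrier R - P" and a: "\<forall>j<r. a j \<in> carrier R"
      and "t \<odot>\<^bsub>?N\<^esub> x = (\<Oplus>\<^bsub>?N\<^esub>j\<in>{..<r}. a j \<odot>\<^bsub>?N\<^esub> g j)"
      using span by blast
    then show "\<exists>t\<in>carrier R - P. \<exists>a. (\<forall>j<r. a j \<in> carrier R) \<and>
        (\<lambda>i\<in>{..<p}. t \<otimes> x i) = lincomb R p r a g"
      unfolding eq[OF a] by auto
  next
    fix a j assume a: "\<forall>j<r. a j \<in> carrier R" and 0: "lincomb R p r a g = (\<lambda>i\<in>{..<p}. \<zero>)"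
      and j: "j < r"
    have "(\<Oplus>\<^bsub>?N\<^esub>j\<in>{..<r}. a j \<odot>\<^bsub>?N\<^esub> g j) = \<zero>\<^bsub>?N\<^esub>" unfolding eq[OF a] 0 by simp
    then show "\<exists>u\<in>carrier R - P. u \<otimes> a j = \<zero>" using indep a j by blast
  qed
qed

text \<open>The matrices \<open>A\<close> and \<open>B\<close> come from unrelated choices, so their
  minors are compared through spans over \<open>V\<close>: the image of every column of one lies in
  the span of the images of the other, and \<open>span_minor_mem_ideal\<close> applies in both
  directions.\<close>

lemma minors_closure_eq_if_mem_closure:
  fixes R (structure)
  assumes "cring R" "noetherian_ring R" and M: "submodule M R (free_module R p)"
    and h: "h \<in> integral_closure R p M"
  shows "ideal_closure R (minors_ideal R p i M) = ideal_closure R (minors_ideal R p i (adjoin R p M h))"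
proof -
  interpret cring R by fact
  have hc: "h \<in> carrier (free_module R p)" using h by (simp add: integral_closure_def)
  note N = adjoin_submodule[OF M hc]
  obtain n A where A: "generating_matrix R p M n A"
    and IA: "minors_ideal R p i M = Idl (minors R p n A i)"
    using minors_ideal_obtain[OF assms(1-3)] .
  obtain m B where B: "generating_matrix R p (adjoin R p M h) m B"
    and IB: "minors_ideal R p i (adjoin R p M h) = Idl (minors R p m B i)"
    using minors_ideal_obtain[OF assms(1,2) N(1)] .
  have AF: "A ` {..<n} \<subseteq> carrier (free_module R p)" and Agen: "submodule_gen R (free_module R p) (A ` {..<n}) = M"
    and BF: "B ` {..<m} \<subseteq> carrier (free_module R p)"
    and Bgen: "submodule_gen R (free_module R p) (B ` {..<m}) = adjoin R p M h"
    using A B by (auto simp: generating_matrix_def)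
  have Ac: "\<forall>j<n. A j \<in> carrier (free_module R p)" and Bc: "\<forall>j<m. B j \<in> carrier (free_module R p)"
    using AF BF by auto
  have "genideal (residue_field R P\<lparr>carrier := V\<rparr>) (residue_map R P ` minors R p n A i) =
      genideal (residue_field R P\<lparr>carrier := V\<rparr>) (residue_map R P ` minors R p m B i)"
    if PV: "minimal_prime R P" "valuation_between R P V" for P V
  proof -
    interpret P: primeideal P R using PV(1) by (simp add: minimal_prime_def)
    let ?W = "residue_field R P\<lparr>carrier := V\<rparr>"
    interpret \<phi>: ring_hom_cring R ?W "residue_map R P" by (rule P.residue_map_valuation_hom[OF PV(2)])
    interpret F: module ?W "free_module ?W p" by (rule \<phi>.S.free_module_module)
    define A' where "A' j = vec_image R P p (A j)" for j
    define B' where "B' j = vec_image R P p (B j)" for j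
    have vc: "vec_image R P p x \<in> carrier (free_module ?W p)" if "x \<in> carrier (free_module R p)" for x
      using that \<phi>.hom_closed by (auto simp: vec_image_def PiE_iff)
    have A'c: "\<forall>j<n. A' j \<in> carrier (free_module ?W p)" and B'c: "\<forall>j<m. B' j \<in> carrier (free_module ?W p)"
      using vc Ac Bc unfolding A'_def B'_def by blast+
    have A'F: "A' ` {..<n} \<subseteq> carrier (free_module ?W p)" and B'F: "B' ` {..<m} \<subseteq> carrier (free_module ?W p)"
      unfolding image_subset_iff using A'c B'c by simp_all
    let ?SA = "submodule_gen ?W (free_module ?W p) (A' ` {..<n})"
    let ?SB = "submodule_gen ?W (free_module ?W p) (B' ` {..<m})"
    have SA: "submodule ?SA ?W (free_module ?W p)" and SB: "submodule ?SB ?W (free_module ?W p)"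
      using F.submodule_gen_submodule A'F B'F by blast+
    note span_image = \<phi>.vec_image_span_image[folded vec_image_def]
    have MA: "vec_image R P p x \<in> ?SA" if "x \<in> M" for x
      using span_image[OF Ac, of x] that Agen by (simp only: A'_def[abs_def])
    have NB: "vec_image R P p x \<in> ?SB" if "x \<in> adjoin R p M h" for x
      using span_image[OF Bc, of x] that Bgen by (simp only: B'_def[abs_def])
    have "vec_image R P p h \<in> submodule_gen ?W (free_module ?W p) (vec_image R P p ` M)"
      using h PV unfolding integral_closure_def Let_def by blast
    then have hA: "vec_image R P p h \<in> ?SA"
      using submodule_gen_minimal[OF SA, of "vec_image R P p ` M"] MA by blast
    \<comment> \<open>The vectors whose image lies in \<open>?SA\<close> form a submodule of
      \<open>R^p\<close> that contains \<open>M\<close> and \<open>h\<close>.\<close>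
    have NA: "vec_image R P p x \<in> ?SA" if x: "x \<in> adjoin R p M h" for x
    proof -
      have "submodule {x \<in> carrier (free_module R p). vec_image R P p x \<in> ?SA} R (free_module R p)"
        using \<phi>.vec_vimage_submodule[OF SA] unfolding vec_image_def .
      then interpret K: submodule "{x \<in> carrier (free_module R p). vec_image R P p x \<in> ?SA}" R "free_module R p" .
      obtain y a where y: "y \<in> M" "a \<in> carrier R"
        and xy: "x = y \<oplus>\<^bsub>free_module R p\<^esub> (a \<odot>\<^bsub>free_module R p\<^esub> h)"
        using x unfolding adjoin_def by blast
      have "y \<in> carrier (free_module R p)" using y(1) submodule_free_subset[OF M] by auto
      then have "y \<in> {x \<in> carrier (free_module R p). vec_image R P p x \<in> ?SA}" using MA[OF y(1)] by blast
      moreover have "a \<odot>\<^bsub>free_module R p\<^esub> h \<in> {x \<in> carrier (free_module R p). vec_image R P p x \<in> ?SA}"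
        using hA hc y(2) by (intro K.smult_closed CollectI conjI)
      ultimately have "y \<oplus>\<^bsub>free_module R p\<^esub> (a \<odot>\<^bsub>free_module R p\<^esub> h) \<in>
          {x \<in> carrier (free_module R p). vec_image R P p x \<in> ?SA}"
        using K.m_closed by (simp del: free_module_simps mem_Collect_eq)
      then show ?thesis unfolding xy by blast
    qed
    have mA: "residue_map R P ` minors R p n A i = minors ?W p n A' i"
      using \<phi>.image_minors[OF Ac] unfolding A'_def vec_image_def .
    have mB: "residue_map R P ` minors R p m B i = minors ?W p m B' i"
      using \<phi>.image_minors[OF Bc] unfolding B'_def vec_image_def .
    have BA: "\<forall>j<m. B' j \<in> ?SA"
    proof (intro allI impI)
      fix j assume "j < m"
      then have "B j \<in> adjoin R p M h"
        unfolding Bgen[symmetric] by (intro subsetD[OF submodule_gen_superset]) simp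
      then show "B' j \<in> ?SA" unfolding B'_def by (rule NA)
    qed
    have AB: "\<forall>j<n. A' j \<in> ?SB"
    proof (intro allI impI)
      fix j assume "j < n"
      then have "A j \<in> M"
        unfolding Agen[symmetric] by (intro subsetD[OF submodule_gen_superset]) simp
      then show "A' j \<in> ?SB" unfolding A'_def using N(2) by (intro NB) blast
    qed
    have 1: "minors ?W p m B' i \<subseteq> genideal ?W (minors ?W p n A' i)"
    proof
      fix y assume "y \<in> minors ?W p m B' i"
      then obtain \<rho> \<gamma> where y: "y = ring_det ?W i (\<lambda>k l. B' (\<gamma> l) (\<rho> k))"
        and im: "\<rho> ` {..<i} \<subseteq> {..<p}" "\<gamma> ` {..<i} \<subseteq> {..<m}" by (auto simp: minors_def)
      show "y \<in> genideal ?W (minors ?W p n A' i)" unfolding y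
        by (rule \<phi>.S.span_minor_mem_ideal[OF A'c im(1)]) (use BA im(2) in \<open>simp add: image_subset_iff\<close>)
    qed
    have 2: "minors ?W p n A' i \<subseteq> genideal ?W (minors ?W p m B' i)"
    proof
      fix y assume "y \<in> minors ?W p n A' i"
      then obtain \<rho> \<gamma> where y: "y = ring_det ?W i (\<lambda>k l. A' (\<gamma> l) (\<rho> k))"
        and im: "\<rho> ` {..<i} \<subseteq> {..<p}" "\<gamma> ` {..<i} \<subseteq> {..<n}" by (auto simp: minors_def)
      show "y \<in> genideal ?W (minors ?W p m B' i)" unfolding y
        by (rule \<phi>.S.span_minor_mem_ideal[OF B'c im(1)]) (use AB im(2) in \<open>simp add: image_subset_iff\<close>)
    qed
    show ?thesis unfolding mA mB
      by (intro equalityI \<phi>.S.genideal_minimal \<phi>.S.genideal_ideal \<phi>.S.minors_closed A'c B'c 1 2)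
  qed
  then show ?thesis
    unfolding IA IB
    by (auto simp: ideal_closure_genideal_iff[OF assms(1) minors_closed[OF Ac]]
        ideal_closure_genideal_iff[OF assms(1) minors_closed[OF Bc]])
qed

text \<open>The two rank hypotheses enter separately: the family \<open>g\<close> in
  \<open>M\<close> is used for its independence, the family \<open>G\<close> in
  \<open>M + Rh\<close> for spanning. Their common length \<open>r\<close> is what makes
  \<open>mem_span_if_minors\<close> applicable.\<close>

lemma mem_closure_if_minors_closure_eq:
  fixes R (structure)
  assumes "cring R" "noetherian_ring R" and M: "submodule M R (free_module R p)"
    and hc: "h \<in> carrier (free_module R p)"
    and rank_M: "is_rank R (free_module R p\<lparr>carrier := M\<rparr>) r"
    and rank_N: "is_rank R (free_module R p\<lparr>carrier := adjoin R p M h\<rparr>) r"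
    and eq: "ideal_closure R (minors_ideal R p r M) = ideal_closure R (minors_ideal R p r (adjoin R p M h))"
  shows "h \<in> integral_closure R p M"
proof -
  interpret cring R by fact
  interpret RF: module R "free_module R p" by (rule free_module_module)
  note N = adjoin_submodule[OF M hc]
  obtain n A where A: "generating_matrix R p M n A"
    and IA: "minors_ideal R p r M = Idl (minors R p n A r)"
    using minors_ideal_obtain[OF assms(1-3)] .
  obtain m B where B: "generating_matrix R p (adjoin R p M h) m B"
    and IB: "minors_ideal R p r (adjoin R p M h) = Idl (minors R p m B r)"
    using minors_ideal_obtain[OF assms(1,2) N(1)] .
  have AF: "A ` {..<n} \<subseteq> carrier (free_module R p)" and Agen: "submodule_gen R (free_module R p) (A ` {..<n}) = M"
    and BF: "B ` {..<m} \<subseteq> carrier (free_module R p)"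
    and Bgen: "submodule_gen R (free_module R p) (B ` {..<m}) = adjoin R p M h"
    using A B by (auto simp: generating_matrix_def)
  have Ac: "\<forall>j<n. A j \<in> carrier (free_module R p)" and Bc: "\<forall>j<m. B j \<in> carrier (free_module R p)"
    using AF BF by auto
  have AM: "A j \<in> M" if "j < n" for j
    unfolding Agen[symmetric] using that by (intro subsetD[OF submodule_gen_superset]) simp
  have MF: "M \<subseteq> carrier (free_module R p)" using submodule_free_subset[OF M] by simp
  have NF: "adjoin R p M h \<subseteq> carrier (free_module R p)" using submodule_free_subset[OF N(1)] by simp
  have "vec_image R P p h \<in> submodule_gen (residue_field R P\<lparr>carrier := V\<rparr>)
      (free_module (residue_field R P\<lparr>carrier := V\<rparr>) p) (vec_image R P p ` M)"
    if PV: "minimal_prime R P" "valuation_between R P V" for P V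
  proof -
    interpret P: primeideal P R using PV(1) by (simp add: minimal_prime_def)
    let ?W = "residue_field R P\<lparr>carrier := V\<rparr>"
    interpret \<phi>: ring_hom_cring R ?W "residue_map R P" by (rule P.residue_map_valuation_hom[OF PV(2)])
    interpret W: domain ?W by (rule valuation_between_domain[OF PV(2)])
    interpret F: module ?W "free_module ?W p" by (rule \<phi>.S.free_module_module)
    have assoc: "associated_prime R P" by (rule minimal_prime_associated[OF assms(1,2) PV(1)])
    obtain z where z: "z \<in> carrier R" "P = {a \<in> carrier R. a \<otimes> z = \<zero>}"
      using assoc unfolding associated_prime_def by blast
    obtain g where g: "\<forall>j<r. g j \<in> M"
      and indep: "\<forall>a. (\<forall>j<r. a j \<in> carrier R) \<longrightarrow> lincomb R p r a g = (\<lambda>i\<in>{..<p}. \<zero>) \<longrightarrow>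
        (\<forall>j<r. \<exists>u\<in>carrier R - P. u \<otimes> a j = \<zero>)"
      using rank_basis[OF M assoc rank_M] .
    obtain G where G: "\<forall>j<r. G j \<in> adjoin R p M h"
      and span: "\<forall>x\<in>adjoin R p M h. \<exists>t\<in>carrier R - P. \<exists>a. (\<forall>j<r. a j \<in> carrier R) \<and>
        (\<lambda>i\<in>{..<p}. t \<otimes> x i) = lincomb R p r a G"
      using rank_basis[OF N(1) assoc rank_N] .
    have nonzero: "residue_map R P t \<noteq> \<zero>\<^bsub>?W\<^esub>" if "t \<in> carrier R" "t \<notin> P" for t
      using P.residue_map_nonzero[OF that] W.one_not_zero by simp
    define A' where "A' j = vec_image R P p (A j)" for j
    define B' where "B' j = vec_image R P p (B j)" for j
    define G' where "G' j = vec_image R P p (G j)" for j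
    have vc: "vec_image R P p x \<in> carrier (free_module ?W p)" if "x \<in> carrier (free_module R p)" for x
      using that \<phi>.hom_closed by (auto simp: vec_image_def PiE_iff)
    have GF: "\<forall>j<r. G j \<in> carrier (free_module R p)" using G NF by blast
    have A'c: "\<forall>j<n. A' j \<in> carrier (free_module ?W p)" and B'c: "\<forall>j<m. B' j \<in> carrier (free_module ?W p)"
      and G'c: "\<forall>j<r. G' j \<in> carrier (free_module ?W p)"
      using vc Ac Bc GF unfolding A'_def B'_def G'_def by blast+
    note span_image = \<phi>.vec_image_span_image[folded vec_image_def]
    have NB: "vec_image R P p x \<in> submodule_gen ?W (free_module ?W p) (B' ` {..<m})"
      if "x \<in> adjoin R p M h" for x
      using span_image[OF Bc, of x] that Bgen by (simp only: B'_def[abs_def])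
    have mA: "residue_map R P ` minors R p n A r = minors ?W p n A' r"
      using \<phi>.image_minors[OF Ac] unfolding A'_def vec_image_def .
    have mB: "residue_map R P ` minors R p m B r = minors ?W p m B' r"
      using \<phi>.image_minors[OF Bc] unfolding B'_def vec_image_def .
    have "vec_image R P p h \<in> submodule_gen ?W (free_module ?W p) (A' ` {..<n})"
    proof (rule W.mem_span_if_minors[OF _ _ _ B'c G'c])
      show "a divides\<^bsub>?W\<^esub> b \<or> b divides\<^bsub>?W\<^esub> a" if "a \<in> carrier ?W" "b \<in> carrier ?W" for a b
        using valuation_between_divides[OF PV(2)] that by simp
      show "\<forall>j<n. A' j \<in> submodule_gen ?W (free_module ?W p) (B' ` {..<m})"
        unfolding A'_def using AM N(2) NB by blast
      show "vec_image R P p h \<in> submodule_gen ?W (free_module ?W p) (B' ` {..<m})"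
        by (rule NB[OF N(3)])
    next
      fix x assume "x = vec_image R P p h \<or> x \<in> A' ` {..<n}"
      then obtain y where y: "y \<in> adjoin R p M h" "x = vec_image R P p y"
        unfolding A'_def using AM N(2,3) by blast
      then obtain t a where t: "t \<in> carrier R" "t \<notin> P" and a: "\<forall>j<r. a j \<in> carrier R"
        and ty: "(\<lambda>i\<in>{..<p}. t \<otimes> y i) = lincomb R p r a G"
        using span by blast
      have GI: "G ` {..<r} \<subseteq> carrier (free_module R p)" unfolding image_subset_iff using GF by simp
      have "lincomb R p r a G \<in> submodule_gen R (free_module R p) (G ` {..<r})"
        using a by (intro lincomb_mem_submodule RF.submodule_gen_submodule[OF GI]
            subsetD[OF submodule_gen_superset]) auto
      then have "vec_image R P p (\<lambda>i\<in>{..<p}. t \<otimes> y i) \<in> submodule_gen ?W (free_module ?W p) (G' ` {..<r})"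
        unfolding ty using span_image[OF GF] by (simp only: G'_def[abs_def])
      moreover have "vec_image R P p (\<lambda>i\<in>{..<p}. t \<otimes> y i) = (\<lambda>i\<in>{..<p}. residue_map R P t \<otimes>\<^bsub>?W\<^esub> x i)"
        using y subsetD[OF NF y(1)] t(1) by (auto simp: vec_image_def fun_eq_iff PiE_iff)
      ultimately show "\<exists>t\<in>carrier ?W - {\<zero>\<^bsub>?W\<^esub>}.
          (\<lambda>i\<in>{..<p}. t \<otimes>\<^bsub>?W\<^esub> x i) \<in> submodule_gen ?W (free_module ?W p) (G' ` {..<r})"
        using nonzero[OF t] \<phi>.hom_closed[OF t(1)] by (intro bexI[of _ "residue_map R P t"]) auto
    next
      have "residue_map R P b \<in> genideal ?W (residue_map R P ` minors R p n A r)"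
        if b: "b \<in> minors R p m B r" for b
      proof -
        \<comment> \<open>A generator lies in the closure of its own ideal, so the equality of
          closures places \<open>b\<close> in the closure of the ideal for \<open>M\<close>; testing
          that membership at the fixed prime and valuation ring gives the claim.\<close>
        have "b \<in> ideal_closure R (Idl (minors R p m B r))"
          unfolding ideal_closure_genideal_iff[OF assms(1) minors_closed[OF Bc]]
        proof (intro conjI allI impI)
          show "b \<in> carrier R" using b minors_closed[OF Bc] by blast
          fix P V assume PV': "minimal_prime R P" "valuation_between R P V"
          interpret P': primeideal P R using PV'(1) by (simp add: minimal_prime_def)
          interpret \<psi>: ring_hom_cring R "residue_field R P\<lparr>carrier := V\<rparr>" "residue_map R P"
            by (rule P'.residue_map_valuation_hom[OF PV'(2)])
          have "residue_map R P ` minors R p m B r \<subseteq> carrier (residue_field R P\<lparr>carrier := V\<rparr>)"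
            unfolding image_subset_iff using minors_closed[OF Bc] \<psi>.hom_closed by blast
          then show "residue_map R P b \<in>
              genideal (residue_field R P\<lparr>carrier := V\<rparr>) (residue_map R P ` minors R p m B r)"
            using \<psi>.S.genideal_self b by blast
        qed
        then have "b \<in> ideal_closure R (Idl (minors R p n A r))" using eq IA IB by simp
        then show ?thesis
          unfolding ideal_closure_genideal_iff[OF assms(1) minors_closed[OF Ac]] using PV by blast
      qed
      then show "minors ?W p m B' r \<subseteq> genideal ?W (minors ?W p n A' r)"
        unfolding mA[symmetric] mB[symmetric] by blast
    next
      have "\<exists>\<rho>. \<rho> ` {..<r} \<subseteq> {..<p} \<and> ring_det R r (\<lambda>k l. g l (\<rho> k)) \<notin> P"
      proof (rule independent_minor_notin[OF P.primeideal_axioms z])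
        show "\<forall>j<r. g j \<in> carrier (free_module R p)" using g MF by blast
      qed (use indep in blast)
      then obtain \<rho> where \<rho>: "\<rho> ` {..<r} \<subseteq> {..<p}" and D: "ring_det R r (\<lambda>k l. g l (\<rho> k)) \<notin> P"
        by blast
      let ?D = "ring_det R r (\<lambda>k l. g l (\<rho> k))"
      \<comment> \<open>The minor of \<open>g\<close> need not be a minor of \<open>A\<close>, but
        it lies in the ideal generated by those because each \<open>g j\<close> is in
        \<open>M\<close>. If all \<open>r\<close>-minors of \<open>A\<close> vanished in
        \<open>V\<close>, so would its image.\<close>
      have DI: "?D \<in> Idl (minors R p n A r)"
        by (rule span_minor_mem_ideal[OF Ac \<rho>]) (use g Agen in simp)
      have "Idl (minors R p n A r) \<subseteq> carrier R"
        by (rule additive_subgroup.a_subset[OF ideal.axioms(1)[OF genideal_ideal[OF minors_closed[OF Ac]]]])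
      then have nz: "residue_map R P ?D \<noteq> \<zero>\<^bsub>?W\<^esub>" using nonzero D DI by blast
      have hI: "residue_map R P ` (Idl (minors R p n A r)) \<subseteq> carrier ?W"
        unfolding image_subset_iff
        using \<open>Idl (minors R p n A r) \<subseteq> carrier R\<close> \<phi>.hom_closed by blast
      have "residue_map R P ?D \<in> genideal ?W (residue_map R P ` (Idl (minors R p n A r)))"
        using \<phi>.S.genideal_self[OF hI] DI by blast
      then have "residue_map R P ?D \<in> genideal ?W (minors ?W p n A' r)"
        unfolding \<phi>.hom_genideal[OF minors_closed[OF Ac]] mA .
      then show "\<not> minors ?W p n A' r \<subseteq> {\<zero>\<^bsub>?W\<^esub>}"
        using nz \<phi>.S.genideal_minimal[OF \<phi>.S.zeroideal] by blast
    qed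
    moreover have "submodule_gen ?W (free_module ?W p) (A' ` {..<n}) \<subseteq>
        submodule_gen ?W (free_module ?W p) (vec_image R P p ` M)"
    proof (rule submodule_gen_minimal)
      have "vec_image R P p ` M \<subseteq> carrier (free_module ?W p)"
        unfolding image_subset_iff using vc MF by blast
      then show "submodule (submodule_gen ?W (free_module ?W p) (vec_image R P p ` M)) ?W (free_module ?W p)"
        by (rule F.submodule_gen_submodule)
      have "A' ` {..<n} \<subseteq> vec_image R P p ` M" unfolding A'_def using AM by blast
      then show "A' ` {..<n} \<subseteq> submodule_gen ?W (free_module ?W p) (vec_image R P p ` M)"
        using submodule_gen_superset by (rule subset_trans)
    qed
    ultimately show ?thesis by blast
  qed
  then show ?thesis using hc unfolding integral_closure_def Let_def by blast
qed

text \<open>The empty determinant reads no entry of its matrix, so \<open>undefined\<close> can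
  stand for any matrix, and \<open>M\<close> and \<open>M + Rh\<close> give the same ideal. This
  settles rank zero.\<close>

lemma minors_ideal_0:
  assumes "cring R" "noetherian_ring R" "submodule M R (free_module R p)"
  shows "minors_ideal R p 0 M = genideal R {ring_det R 0 (\<lambda>k l. undefined)}"
proof -
  interpret cring R by fact
  obtain n A where "minors_ideal R p 0 M = genideal R (minors R p n A 0)"
    using minors_ideal_obtain[OF assms] .
  moreover have det_0: "ring_det R 0 C = ring_det R 0 (\<lambda>k l. undefined)" for C
    by (rule ring_det_cong) auto
  have "minors R p n A 0 = {ring_det R 0 (\<lambda>k l. undefined)}"
    unfolding minors_def
  proof (intro equalityI subsetI)
    fix x assume "x \<in> {ring_det R 0 (\<lambda>k l. undefined)}"
    then have "x = ring_det R 0 (\<lambda>k l. A l k)"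
      by (simp only: det_0[of "\<lambda>k l. A l k"] singleton_iff)
    then show "x \<in> {ring_det R 0 (\<lambda>k l. A (\<gamma> l) (\<rho> k)) |\<rho> \<gamma>.
        strict_mono_on {..<0} \<rho> \<and> \<rho> ` {..<0} \<subseteq> {..<p} \<and>
        strict_mono_on {..<0} \<gamma> \<and> \<gamma> ` {..<0} \<subseteq> {..<n}}"
      by (intro CollectI exI[of _ "\<lambda>k. k"] conjI) (simp_all add: strict_mono_on_def)
  qed (use det_0 in blast)
  ultimately show ?thesis by simp
qed

theorem theorem2p10:
  fixes R :: "('a, 'c) ring_scheme" and p :: nat
    and M :: "(nat \<Rightarrow> 'a) set" and h :: "nat \<Rightarrow> 'a"
  assumes "cring R" and "noetherian_ring R"
    and "submodule M R (free_module R p)"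
    and "has_rank R (free_module R p \<lparr>carrier := M\<rparr>)"
    and "h \<in> carrier (free_module R p)"
    and "has_rank R (free_module R p \<lparr>carrier := adjoin R p M h\<rparr>)"
    and "rank R (free_module R p \<lparr>carrier := M\<rparr>) =
         rank R (free_module R p \<lparr>carrier := adjoin R p M h\<rparr>)"
  shows "(h \<in> integral_closure R p M \<longleftrightarrow>
            (\<forall>i\<ge>1. ideal_closure R (minors_ideal R p i M) =
                    ideal_closure R (minors_ideal R p i (adjoin R p M h)))) \<and>
         ((\<forall>i\<ge>1. ideal_closure R (minors_ideal R p i M) =
                   ideal_closure R (minors_ideal R p i (adjoin R p M h))) \<longleftrightarrow>
            (let r = rank R (free_module R p \<lparr>carrier := M\<rparr>) in
             ideal_closure R (minors_ideal R p r M) =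
             ideal_closure R (minors_ideal R p r (adjoin R p M h))))"
proof -
  define r where "r = rank R (free_module R p \<lparr>carrier := M\<rparr>)"
  let ?E = "\<lambda>i. ideal_closure R (minors_ideal R p i M) =
    ideal_closure R (minors_ideal R p i (adjoin R p M h))"
  have rank_M: "is_rank R (free_module R p \<lparr>carrier := M\<rparr>) r"
    using assms(4) someI_ex unfolding has_rank_def rank_def r_def by metis
  \<comment> \<open>\<open>rank\<close> chooses one of the possible ranks; the equality of the two
    chosen values makes the same \<open>r\<close> a rank of both modules.\<close>
  have rank_N: "is_rank R (free_module R p \<lparr>carrier := adjoin R p M h\<rparr>) r"
    using assms(6) someI_ex unfolding has_rank_def r_def assms(7) unfolding rank_def by metis
  have 12: "?E i" if "h \<in> integral_closure R p M" for i
    by (rule minors_closure_eq_if_mem_closure[OF assms(1-3) that])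
  have 31: "h \<in> integral_closure R p M" if "?E r"
    by (rule mem_closure_if_minors_closure_eq[OF assms(1-3,5) rank_M rank_N that])
  have 23: "?E r" if "\<forall>i\<ge>1. ?E i"
  \<comment> \<open>Condition (2) starts at \<open>i = 1\<close> and gives no information about the
    ideals of minors when \<open>r\<close> is zero.\<close>
  proof (cases "r = 0")
    case True
    then show ?thesis
      using minors_ideal_0[OF assms(1-3)]
        minors_ideal_0[OF assms(1,2) cring.adjoin_submodule(1)[OF assms(1,3,5)]] by simp
  next
    case False
    then show ?thesis using that by simp
  qed
  show ?thesis
    unfolding Let_def r_def[symmetric] using 12 23 31 by blast
qed

end
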